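(* Suppose that $G$ is a nilpotent group equipped with a conjugation-invariant norm. Then $G$ is independent of scaling, $\hat{\mathcal{C}}(G)$ is abelian, and $$\rho_{\omega,\mathbf{d}}\colon\hat{\mathcal{C}}(G)\to\mathrm{Cone}_\omega(G,\mathbf{d}),\qquad[g]\mapsto\{g(d_n)\}_n,$$ is an isometric embedding for any non-principal ultrafilter $\omega$ on $\mathbb{N}$ and any scaling sequence $\mathbf{d}=(d_n)$.
   Context: Norms. A norm on a group $G$ is a function $\|\cdot\|\colon G\to[0,\infty)$ with $\|g\|=0\iff g=1$, $\|g^{-1}\|=\|g\|$ and $\|gh\|\le\|g\|+\|h\|$; for a pseudonorm one only requires $\|1\|=0$ instead of the first condition. It is conjugation-invariant if $\|hgh^{-1}\|=\|g\|$ for all $g,h$. It induces the bi-invariant (pseudo)metric $d(g,h)=\|g^{-1}h\|$; all metric notions refer to it. The groups $F_{\mathbb{R}}(G)$ and $F(G)$. Let $G$ be a group with a conjugation-invariant norm. $F_{\mathbb{R}}(G)$ is the free product of copies of the additive group $\mathbb{R}$ indexed by the elements $g$ of the set $G$; the element $r$ of the copy indexed by $g$ is written $\overline{g}(r)$. It carries the conjugation-invariant pseudonorm $$\|x\|=\inf\Big\{\sum_{i=1}^n |r_i|\,\|g_i\| : x=\prod_{i=1}^n h_i\,\overline{g_i}(r_i)^{\pm1}h_i^{-1},\ h_i\in F_{\mathbb{R}}(G)\Big\}.$$ $F(G)\le F_{\mathbb{R}}(G)$ is the subgroup generated by the elements $\overline{g}:=\overline{g}(1)$; it is free on $\{\overline{g}: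 g\in G\}$. For $t\in\mathbb{R}$, $\psi_t\colon F_{\mathbb{R}}(G)\to F_{\mathbb{R}}(G)$ is the homomorphism with $\psi_t(\overline{g}(r))=\overline{g}(tr)$. $\pi\colon F(G)\to G$ is the homomorphism with $\pi(\overline{g})=g$. Directional asymptotic cone. A scaling set is an unbounded subset $T\subseteq(0,\infty)$; limits over $t\in T$ are taken as $t\to\infty$. A function $f$ from $T$ to a pseudometric space is Cauchy if for every $\epsilon>0$, $d(f(t),f(t'))<\epsilon$ for all sufficiently large $t,t'\in T$. $\mathcal{D}(G,T)$ is the group (pointwise product) of all functions $w\colon T\to F(G)$ such that $t\mapsto\psi_{1/t}(w(t))\in F_{\mathbb{R}}(G)$ is Cauchy, with pseudonorm $\|w\|=\lim_{t\in T}\|\psi_{1/t}(w(t))\|$. $\mathcal{C}(G,T)=\{\pi\circ w: w\in\mathcal{D}(G,T)\}$, a group of functions $T\to G$, with pseudonorm $\|g\|=\inf\{\|w\|: w\in\mathcal{D}(G,T),\ \pi\circ w=g\}$. The directional asymptotic cone $\hat{\mathcal{C}}(G,T)$ is the quotient of $\mathcal{C}(G,T)$ by the normal subgroup of elements of pseudonorm $0$, with the induced conjugation-invariant norm; $[g]$ denotes the class of $g$. Write $\hat{\mathcal{C}}(G)=\hat{\mathcal{C}}(G,(0,\infty))$. Independence of scaling. For scaling sets $T\subseteq T'$ there is a well-defined homomorphism $\hat{\mathcal{C}}(G,T')\to\hat{\mathcal{C}}(G,T)$, $[g]\mapsto[g|_T]$. $G$ is independent of scaling if this is an isometry for all scaling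 sets $T\subseteq T'$. Ultrafilter cone. A scaling sequence is a sequence $\mathbf{d}=(d_n)$ of positive reals with $d_n\to\infty$. For a non-principal ultrafilter $\omega$ on $\mathbb{N}$, $\mathrm{Cone}_\omega(G,\mathbf{d})$ is the group of sequences $(g_n)$ in $G$ with $\limsup_n\|g_n\|/d_n<\infty$ (pointwise product), modulo $(g_n)\sim(h_n)\iff\omega\text{-}\lim_n\|g_n^{-1}h_n\|/d_n=0$, with the norm $\|\{g_n\}\|=\omega\text{-}\lim_n\|g_n\|/d_n$; $\{g_n\}$ denotes the class of $(g_n)$. The map $\rho_{\omega,\mathbf{d}}$ is a well-defined homomorphism. *)

theory Defs
  imports "HOL-Analysis.Analysis" "HOL-Algebra.Product_Groups"
begin

section \<open>Norms and nilpotency\<close>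

text \<open>Only the values of \<open>N\<close> on the carrier are relevant.\<close>

definition conj_invariant_norm :: "('a, 'b) monoid_scheme \<Rightarrow> ('a \<Rightarrow> real) \<Rightarrow> bool" where
  "conj_invariant_norm G N \<longleftrightarrow>
     (\<forall>g\<in>carrier G. 0 \<le> N g \<and> (N g = 0 \<longleftrightarrow> g = \<one>\<^bsub>G\<^esub>) \<and> N (inv\<^bsub>G\<^esub> g) = N g) \<and>
     (\<forall>g\<in>carrier G. \<forall>h\<in>carrier G. N (g \<otimes>\<^bsub>G\<^esub> h) \<le> N g + N h) \<and>
     (\<forall>g\<in>carrier G. \<forall>h\<in>carrier G. N (h \<otimes>\<^bsub>G\<^esub> g \<otimes>\<^bsub>G\<^esub> inv\<^bsub>G\<^esub> h) = N g)"

definition norm_dist :: "('a, 'b) monoid_scheme \<Rightarrow> ('a \<Rightarrow> real) \<Rightarrow> 'a \<Rightarrow> 'a \<Rightarrow> real" where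
  "norm_dist G N g h = N (inv\<^bsub>G\<^esub> g \<otimes>\<^bsub>G\<^esub> h)"

primrec lower_central :: "('a, 'b) monoid_scheme \<Rightarrow> nat \<Rightarrow> 'a set" where
  "lower_central G 0 = carrier G"
| "lower_central G (Suc n) = generate G
     (\<Union>x\<in>lower_central G n. \<Union>y\<in>carrier G. {x \<otimes>\<^bsub>G\<^esub> y \<otimes>\<^bsub>G\<^esub> inv\<^bsub>G\<^esub> x \<otimes>\<^bsub>G\<^esub> inv\<^bsub>G\<^esub> y})"

definition nilpotent_group :: "('a, 'b) monoid_scheme \<Rightarrow> bool" where
  "nilpotent_group G \<longleftrightarrow> group G \<and> (\<exists>n. lower_central G n = {\<one>\<^bsub>G\<^esub>})"

definition isometric_embedding ::
  "('a, 'b) monoid_scheme \<Rightarrow> ('a \<Rightarrow> real) \<Rightarrow> ('c, 'd) monoid_scheme \<Rightarrow> ('c \<Rightarrow> real) \<Rightarrow> ('a \<Rightarrow> 'c) \<Rightarrow> bool"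
where
  "isometric_embedding A NA B NB f \<longleftrightarrow> f \<in> hom A B \<and>
     (\<forall>x\<in>carrier A. \<forall>y\<in>carrier A. norm_dist B NB (f x) (f y) = norm_dist A NA x y)"

text \<open>An isometry, as opposed to an isometric embedding, is onto.\<close>

definition isometry ::
  "('a, 'b) monoid_scheme \<Rightarrow> ('a \<Rightarrow> real) \<Rightarrow> ('c, 'd) monoid_scheme \<Rightarrow> ('c \<Rightarrow> real) \<Rightarrow> ('a \<Rightarrow> 'c) \<Rightarrow> bool"
where
  "isometry A NA B NB f \<longleftrightarrow>
     isometric_embedding A NA B NB f \<and> bij_betw f (carrier A) (carrier B)"

section \<open>The free product of copies of the reals indexed by a group\<close>

text \<open>
  Elements are represented by their normal forms: lists of syllables \<open>(g, r)\<close> with \<open>r \<noteq> 0\<close>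
  in which neighbouring syllables belong to different factors.  \<open>fp_cons (g, r)\<close> is left
  multiplication by the element \<open>r\<close> of the factor indexed by \<open>g\<close>.
\<close>

definition fp_reduced :: "'a set \<Rightarrow> ('a \<times> real) list \<Rightarrow> bool" where
  "fp_reduced S w \<longleftrightarrow>
     (\<forall>(g, r)\<in>set w. g \<in> S \<and> r \<noteq> 0) \<and> successively (\<lambda>x y. fst x \<noteq> fst y) w"

fun fp_cons :: "'a \<times> real \<Rightarrow> ('a \<times> real) list \<Rightarrow> ('a \<times> real) list" where
  "fp_cons (g, r) [] = (if r = 0 then [] else [(g, r)])"
| "fp_cons (g, r) ((h, s) # w) =
     (if r = 0 then (h, s) # w
      else if g = h then (if r + s = 0 then w else (g, r + s) # w)
      else (g, r) # (h, s) # w)"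

definition FR :: "('a, 'b) monoid_scheme \<Rightarrow> ('a \<times> real) list monoid" where
  "FR G = \<lparr>carrier = {w. fp_reduced (carrier G) w}, mult = (\<lambda>u v. foldr fp_cons u v), one = []\<rparr>"

definition gbar :: "'a \<Rightarrow> real \<Rightarrow> ('a \<times> real) list" where
  "gbar g r = fp_cons (g, r) []"

text \<open>The map induced on the free product by maps \<open>f g\<close> on the individual factors.\<close>

definition fp_lift :: "('c, 'd) monoid_scheme \<Rightarrow> ('a \<Rightarrow> real \<Rightarrow> 'c) \<Rightarrow> ('a \<times> real) list \<Rightarrow> 'c" where
  "fp_lift H f w = foldr (\<lambda>(g, r) x. f g r \<otimes>\<^bsub>H\<^esub> x) w \<one>\<^bsub>H\<^esub>"

text \<open>A tuple \<open>(h, g, r, e)\<close> stands for the conjugate by \<open>h\<close> of \<open>gbar g r\<close> to the power \<open>e\<close>.\<close>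

definition FR_norm :: "('a, 'b) monoid_scheme \<Rightarrow> ('a \<Rightarrow> real) \<Rightarrow> ('a \<times> real) list \<Rightarrow> real" where
  "FR_norm G N x = Inf {\<Sum>(h, g, r, e)\<leftarrow>ps. \<bar>r\<bar> * N g | ps :: (('a \<times> real) list \<times> 'a \<times> real \<times> int) list.
     (\<forall>(h, g, r, e)\<in>set ps. h \<in> carrier (FR G) \<and> g \<in> carrier G \<and> e \<in> {1, -1}) \<and>
     x = foldr (\<otimes>\<^bsub>FR G\<^esub>)
           (map (\<lambda>(h, g, r, e). h \<otimes>\<^bsub>FR G\<^esub> (gbar g r [^]\<^bsub>FR G\<^esub> e) \<otimes>\<^bsub>FR G\<^esub> inv\<^bsub>FR G\<^esub> h) ps)
           \<one>\<^bsub>FR G\<^esub>}"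

definition FZ :: "('a, 'b) monoid_scheme \<Rightarrow> ('a \<times> real) list monoid" where
  "FZ G = subgroup_generated (FR G) ((\<lambda>g. gbar g 1) ` carrier G)"

definition psi :: "('a, 'b) monoid_scheme \<Rightarrow> real \<Rightarrow> ('a \<times> real) list \<Rightarrow> ('a \<times> real) list" where
  "psi G t = fp_lift (FR G) (\<lambda>g r. gbar g (t * r))"

text \<open>The exponents occurring in elements of \<open>FZ G\<close> are integers, so the floor merely converts them;
  outside of \<open>FZ G\<close> the map is not used.\<close>

definition pi_hom :: "('a, 'b) monoid_scheme \<Rightarrow> ('a \<times> real) list \<Rightarrow> 'a" where
  "pi_hom G = fp_lift G (\<lambda>g r. g [^]\<^bsub>G\<^esub> \<lfloor>r\<rfloor>)"

text \<open>These are indeed a group and the homomorphisms described by their values on generators.\<close>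

lemma fp_reduced_Nil [simp]: "fp_reduced S []"
  by (simp add: fp_reduced_def)

lemma fp_reduced_Cons: "fp_reduced S ((g, r) # w) \<longleftrightarrow>
    g \<in> S \<and> r \<noteq> 0 \<and> fp_reduced S w \<and> (w \<noteq> [] \<longrightarrow> fst (hd w) \<noteq> g)"
  by (cases w) (auto simp: fp_reduced_def)

lemma fp_cons_reduced: "g \<in> S \<Longrightarrow> fp_reduced S w \<Longrightarrow> fp_reduced S (fp_cons (g, r) w)"
  by (cases "((g, r), w)" rule: fp_cons.cases) (auto simp: fp_reduced_Cons)

lemma fp_cons_hd: "fp_reduced S ((g, r) # w) \<Longrightarrow> fp_cons (g, r) w = (g, r) # w"
  by (cases w) (auto simp: fp_reduced_Cons)

lemma fp_cons_zero [simp]: "fp_cons (g, 0) w = w"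
  by (cases w) auto

lemma fp_cons_add: "fp_reduced S w \<Longrightarrow> fp_cons (g, r) (fp_cons (g, s) w) = fp_cons (g, r + s) w"
proof (cases w)
  case Nil
  then show ?thesis by auto
next
  case (Cons a v)
  assume "fp_reduced S w"
  then show ?thesis
    using Cons by (cases a; cases v) (auto simp: fp_reduced_Cons add.assoc)
qed

lemma fp_mult_reduced:
  "fp_reduced S u \<Longrightarrow> fp_reduced S v \<Longrightarrow> fp_reduced S (foldr fp_cons u v)"
  by (induction u) (auto simp: fp_reduced_Cons intro: fp_cons_reduced)

lemma fp_mult_cons:
  assumes "fp_reduced S v" "fp_reduced S w"
  shows "foldr fp_cons (fp_cons (g, r) v) w = fp_cons (g, r) (foldr fp_cons v w)"
proof (cases v)
  case Nil
  then show ?thesis by auto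
next
  case (Cons a v')
  obtain h s where a: "a = (h, s)" by (cases a)
  have red: "fp_reduced S (foldr fp_cons v' w)"
    using assms Cons a by (auto simp: fp_reduced_Cons intro: fp_mult_reduced)
  show ?thesis
    unfolding Cons a using fp_cons_add[OF red, of h r s] by auto
qed

lemma fp_mult_assoc:
  assumes "fp_reduced S u" "fp_reduced S v" "fp_reduced S w"
  shows "foldr fp_cons (foldr fp_cons u v) w = foldr fp_cons u (foldr fp_cons v w)"
  using assms(1)
proof (induction u)
  case (Cons a u)
  obtain g r where a: "a = (g, r)" by (cases a)
  have "fp_reduced S (foldr fp_cons u v)"
    using Cons.prems assms(2) a by (auto simp: fp_reduced_Cons intro: fp_mult_reduced)
  with Cons a assms(3) show ?case
    by (simp add: fp_mult_cons fp_reduced_Cons)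
qed simp

lemma fp_left_inverse:
  assumes "fp_reduced S w"
  shows "\<exists>v. fp_reduced S v \<and> foldr fp_cons v w = []"
  using assms
proof (induction w)
  case (Cons a w)
  obtain g r where a: "a = (g, r)" by (cases a)
  have gS: "g \<in> S" and rw: "fp_reduced S w" using Cons.prems by (auto simp: a fp_reduced_Cons)
  then obtain v where v: "fp_reduced S v" "foldr fp_cons v w = []" using Cons.IH by blast
  have b: "fp_reduced S (fp_cons (g, - r) [])" using gS by (intro fp_cons_reduced) auto
  let ?v = "foldr fp_cons v (fp_cons (g, - r) [])"
  have "foldr fp_cons ?v (a # w) = foldr fp_cons v (foldr fp_cons (fp_cons (g, - r) []) (a # w))"
    using v(1) b Cons.prems by (rule fp_mult_assoc)
  also have "foldr fp_cons (fp_cons (g, - r) []) (a # w) = w"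
    using Cons.prems by (auto simp: a fp_reduced_Cons)
  finally have "foldr fp_cons ?v (a # w) = []" using v by simp
  moreover have "fp_reduced S ?v"
    using v(1) b by (rule fp_mult_reduced)
  ultimately show ?case by blast
qed (auto intro: exI[of _ "[]"])

lemma group_FR: "group (FR G)"
proof (rule groupI)
  show "\<exists>y\<in>carrier (FR G). y \<otimes>\<^bsub>FR G\<^esub> x = \<one>\<^bsub>FR G\<^esub>" if "x \<in> carrier (FR G)" for x
    using that fp_left_inverse[of "carrier G" x] by (auto simp: FR_def)
qed (auto simp: FR_def fp_mult_assoc intro!: fp_mult_reduced)

lemma group_FZ: "group (FZ G)"
  unfolding FZ_def by (rule group.group_subgroup_generated[OF group_FR])

lemma gbar_in_FR: "g \<in> carrier G \<Longrightarrow> gbar g r \<in> carrier (FR G)"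
  by (simp add: FR_def gbar_def fp_reduced_Cons)

lemma gbar_add: "gbar g r \<otimes>\<^bsub>FR G\<^esub> gbar g s = gbar g (r + s)"
  by (auto simp: FR_def gbar_def)

text \<open>
  The parameter \<open>R\<close> is a subgroup of the reals: all of them for \<open>psi\<close>, the integers for \<open>pi_hom\<close>.
\<close>

lemma fp_lift_mult:
  assumes H: "group H"
    and f: "\<And>g r. g \<in> S \<Longrightarrow> r \<in> R \<Longrightarrow> f g r \<in> carrier H"
    and f0: "\<And>g. g \<in> S \<Longrightarrow> f g 0 = \<one>\<^bsub>H\<^esub>"
    and fadd: "\<And>g r s. g \<in> S \<Longrightarrow> r \<in> R \<Longrightarrow> s \<in> R \<Longrightarrow> f g (r + s) = f g r \<otimes>\<^bsub>H\<^esub> f g s"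
    and R: "\<And>r s. r \<in> R \<Longrightarrow> s \<in> R \<Longrightarrow> r + s \<in> R"
    and u: "set u \<subseteq> S \<times> R" and v: "set v \<subseteq> S \<times> R"
  shows "fp_lift H f v \<in> carrier H" "set (foldr fp_cons u v) \<subseteq> S \<times> R"
    and "fp_lift H f (foldr fp_cons u v) = fp_lift H f u \<otimes>\<^bsub>H\<^esub> fp_lift H f v"
proof -
  interpret H: group H by (rule H)
  have closed: "fp_lift H f w \<in> carrier H" if "set w \<subseteq> S \<times> R" for w
    using that by (induction w) (auto simp: fp_lift_def intro!: f)
  then show "fp_lift H f v \<in> carrier H" using v by blast
  have cons: "set (fp_cons (g, r) w) \<subseteq> S \<times> R \<and>
      fp_lift H f (fp_cons (g, r) w) = f g r \<otimes>\<^bsub>H\<^esub> fp_lift H f w"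
    if g: "g \<in> S" "r \<in> R" and w: "set w \<subseteq> S \<times> R" for g r w
  proof (cases w)
    case Nil
    then show ?thesis using g f0 by (simp add: fp_lift_def f)
  next
    case (Cons a w')
    obtain h s where a: "a = (h, s)" by (cases a)
    have hs: "h \<in> S" "s \<in> R" and w': "set w' \<subseteq> S \<times> R" using w Cons a by auto
    have c: "foldr (\<lambda>(g, r). (\<otimes>\<^bsub>H\<^esub>) (f g r)) w' \<one>\<^bsub>H\<^esub> \<in> carrier H"
      using closed[OF w'] by (simp add: fp_lift_def)
    show ?thesis
      using g hs w' c f[OF g] f[OF hs] f0[OF g(1)] fadd[OF g(1) g(2), of s] R[of r s]
      by (auto simp: Cons a fp_lift_def H.m_assoc[symmetric])
  qed
  have "set (foldr fp_cons u v) \<subseteq> S \<times> R \<and>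
      fp_lift H f (foldr fp_cons u v) = fp_lift H f u \<otimes>\<^bsub>H\<^esub> fp_lift H f v"
    using u
  proof (induction u)
    case Nil
    then show ?case using v closed[OF v] by (simp add: fp_lift_def)
  next
    case (Cons a u)
    obtain g r where a: "a = (g, r)" by (cases a)
    have gr: "g \<in> S" "r \<in> R" and u: "set u \<subseteq> S \<times> R" using Cons.prems a by auto
    note IH = Cons.IH[OF u]
    have "fp_lift H f (a # u) = f g r \<otimes>\<^bsub>H\<^esub> fp_lift H f u" by (simp add: a fp_lift_def)
    then show ?case
      using cons[OF gr conjunct1[OF IH]] IH closed[OF u] closed[OF v] f[OF gr]
      by (simp add: a H.m_assoc)
  qed
  then show "set (foldr fp_cons u v) \<subseteq> S \<times> R"
    and "fp_lift H f (foldr fp_cons u v) = fp_lift H f u \<otimes>\<^bsub>H\<^esub> fp_lift H f v" by auto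
qed

lemma psi_hom: "psi G t \<in> hom (FR G) (FR G)"
proof (rule homI)
  let ?f = "\<lambda>g r. gbar g (t * r)"
  have red: "set w \<subseteq> carrier G \<times> UNIV" if "w \<in> carrier (FR G)" for w
    using that by (auto simp: FR_def fp_reduced_def)
  have z: "\<And>g. gbar g 0 = \<one>\<^bsub>FR G\<^esub>" by (simp add: gbar_def FR_def)
  have add: "\<And>g r s. gbar g (t * (r + s)) = gbar g (t * r) \<otimes>\<^bsub>FR G\<^esub> gbar g (t * s)"
    by (simp add: gbar_add distrib_left)
  note L = fp_lift_mult[OF group_FR, of "carrier G" UNIV ?f G]
  fix x y assume x: "x \<in> carrier (FR G)" and y: "y \<in> carrier (FR G)"
  show "psi G t x \<in> carrier (FR G)"
    unfolding psi_def by (rule L(1)[of "[]"]) (use red[OF x] in \<open>auto simp: z add gbar_in_FR\<close>)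
  have "psi G t (foldr fp_cons x y) = psi G t x \<otimes>\<^bsub>FR G\<^esub> psi G t y"
    unfolding psi_def
    by (rule L(3)) (use red[OF x] red[OF y] in \<open>auto simp: z add gbar_in_FR\<close>)
  then show "psi G t (x \<otimes>\<^bsub>FR G\<^esub> y) = psi G t x \<otimes>\<^bsub>FR G\<^esub> psi G t y" by (simp add: FR_def)
qed

lemma psi_gbar: "psi G t (gbar g r) = gbar g (t * r)"
  by (simp add: psi_def gbar_def fp_lift_def FR_def)

lemma FZ_letters:
  assumes "w \<in> carrier (FZ G)"
  shows "set w \<subseteq> carrier G \<times> \<int>"
proof -
  interpret FR: group "FR G" by (rule group_FR)
  let ?B = "carrier (FR G) \<inter> (\<lambda>g. gbar g 1) ` carrier G"
  have cons: "set (fp_cons (g, r) w) \<subseteq> carrier G \<times> \<int>"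
    if "g \<in> carrier G" "r \<in> \<int>" "set w \<subseteq> carrier G \<times> \<int>" for g r and w :: "('a \<times> real) list"
    using that by (cases w) (auto split: if_splits)
  have mult: "set (foldr fp_cons u v) \<subseteq> carrier G \<times> \<int>"
    if "set u \<subseteq> carrier G \<times> \<int>" "set v \<subseteq> carrier G \<times> \<int>" for u v :: "('a \<times> real) list"
    using that
  proof (induction u)
    case (Cons a u)
    then show ?case using cons[of "fst a" "snd a" "foldr fp_cons u v"] by (cases a) simp
  qed simp
  have "w \<in> generate (FR G) ?B" using assms by (simp add: FZ_def subgroup_generated_def)
  then show ?thesis
  proof (induction rule: generate.induct)
    case (inv h)
    then obtain g where g: "g \<in> carrier G" "h = gbar g 1" by blast
    have "inv\<^bsub>FR G\<^esub> h = gbar g (-1)"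
    proof (rule FR.inv_equality)
      show "gbar g (- 1) \<otimes>\<^bsub>FR G\<^esub> h = \<one>\<^bsub>FR G\<^esub>" unfolding g(2) gbar_add by (simp add: gbar_def FR_def)
    qed (use g gbar_in_FR in auto)
    then show ?case using g by (auto simp: gbar_def)
  next
    case (eng h1 h2)
    then show ?case using mult[of h1 h2] by (simp add: FR_def)
  qed (auto simp: FR_def gbar_def)
qed

lemma pi_hom_hom:
  assumes "group G"
  shows "pi_hom G \<in> hom (FZ G) G"
proof (rule homI)
  interpret G: group G by (rule assms)
  note L = fp_lift_mult[OF assms, of "carrier G" \<int> "\<lambda>g r. g [^]\<^bsub>G\<^esub> \<lfloor>r\<rfloor>"]
  have add: "\<And>g r s. g \<in> carrier G \<Longrightarrow> r \<in> \<int> \<Longrightarrow> s \<in> \<int> \<Longrightarrow>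
      g [^]\<^bsub>G\<^esub> \<lfloor>r + s\<rfloor> = g [^]\<^bsub>G\<^esub> \<lfloor>r\<rfloor> \<otimes>\<^bsub>G\<^esub> g [^]\<^bsub>G\<^esub> \<lfloor>s\<rfloor>" for r s :: real
    by (auto elim!: Ints_cases simp: G.int_pow_mult)
  fix x y assume x: "x \<in> carrier (FZ G)" and y: "y \<in> carrier (FZ G)"
  show "pi_hom G x \<in> carrier G"
    unfolding pi_hom_def by (rule L(1)[of "[]"]) (use FZ_letters[OF x] in \<open>auto simp: add G.int_pow_mult\<close>)
  have "pi_hom G (foldr fp_cons x y) = pi_hom G x \<otimes>\<^bsub>G\<^esub> pi_hom G y"
    unfolding pi_hom_def by (rule L(3)) (use FZ_letters[OF x] FZ_letters[OF y] in \<open>auto simp: add G.int_pow_mult\<close>)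
  then show "pi_hom G (x \<otimes>\<^bsub>FZ G\<^esub> y) = pi_hom G x \<otimes>\<^bsub>G\<^esub> pi_hom G y"
    by (simp add: FR_def FZ_def subgroup_generated_def)
qed

lemma pi_hom_gbar: "group G \<Longrightarrow> g \<in> carrier G \<Longrightarrow> pi_hom G (gbar g 1) = g"
  by (simp add: pi_hom_def gbar_def fp_lift_def group.is_monoid group.int_pow_1)

section \<open>The directional asymptotic cone\<close>

definition scaling_set :: "real set \<Rightarrow> bool" where
  "scaling_set T \<longleftrightarrow> T \<subseteq> {0<..} \<and> \<not> bdd_above T"

abbreviation within_at_top :: "real set \<Rightarrow> real filter" where
  "within_at_top T \<equiv> inf at_top (principal T)"

definition cauchy_along :: "real set \<Rightarrow> ('a \<Rightarrow> 'a \<Rightarrow> real) \<Rightarrow> (real \<Rightarrow> 'a) \<Rightarrow> bool" where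
  "cauchy_along T d f \<longleftrightarrow>
     (\<forall>\<epsilon>>0. \<exists>t0. \<forall>t\<in>T. \<forall>t'\<in>T. t0 \<le> t \<longrightarrow> t0 \<le> t' \<longrightarrow> d (f t) (f t') < \<epsilon>)"

text \<open>
  Functions on \<open>T\<close> are represented as extensional functions, in accordance with \<open>product_group\<close>.
\<close>

definition DD :: "('a, 'b) monoid_scheme \<Rightarrow> ('a \<Rightarrow> real) \<Rightarrow> real set \<Rightarrow> (real \<Rightarrow> ('a \<times> real) list) monoid" where
  "DD G N T = (product_group T (\<lambda>_. FZ G))
     \<lparr>carrier := {w \<in> carrier (product_group T (\<lambda>_. FZ G)).
        cauchy_along T (norm_dist (FR G) (FR_norm G N)) (\<lambda>t. psi G (1 / t) (w t))}\<rparr>"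

definition DD_norm :: "('a, 'b) monoid_scheme \<Rightarrow> ('a \<Rightarrow> real) \<Rightarrow> real set \<Rightarrow> (real \<Rightarrow> ('a \<times> real) list) \<Rightarrow> real" where
  "DD_norm G N T w = Lim (within_at_top T) (\<lambda>t. FR_norm G N (psi G (1 / t) (w t)))"

definition pi_comp :: "('a, 'b) monoid_scheme \<Rightarrow> real set \<Rightarrow> (real \<Rightarrow> ('a \<times> real) list) \<Rightarrow> real \<Rightarrow> 'a" where
  "pi_comp G T w = (\<lambda>t\<in>T. pi_hom G (w t))"

definition CC :: "('a, 'b) monoid_scheme \<Rightarrow> ('a \<Rightarrow> real) \<Rightarrow> real set \<Rightarrow> (real \<Rightarrow> 'a) monoid" where
  "CC G N T = (product_group T (\<lambda>_. G)) \<lparr>carrier := pi_comp G T ` carrier (DD G N T)\<rparr>"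

definition CC_norm :: "('a, 'b) monoid_scheme \<Rightarrow> ('a \<Rightarrow> real) \<Rightarrow> real set \<Rightarrow> (real \<Rightarrow> 'a) \<Rightarrow> real" where
  "CC_norm G N T g = Inf {DD_norm G N T w | w. w \<in> carrier (DD G N T) \<and> pi_comp G T w = g}"

definition CC_null :: "('a, 'b) monoid_scheme \<Rightarrow> ('a \<Rightarrow> real) \<Rightarrow> real set \<Rightarrow> (real \<Rightarrow> 'a) set" where
  "CC_null G N T = {g \<in> carrier (CC G N T). CC_norm G N T g = 0}"

definition dir_cone :: "('a, 'b) monoid_scheme \<Rightarrow> ('a \<Rightarrow> real) \<Rightarrow> real set \<Rightarrow> (real \<Rightarrow> 'a) set monoid" where
  "dir_cone G N T = CC G N T Mod CC_null G N T"

definition dir_class :: "('a, 'b) monoid_scheme \<Rightarrow> ('a \<Rightarrow> real) \<Rightarrow> real set \<Rightarrow> (real \<Rightarrow> 'a) \<Rightarrow> (real \<Rightarrow> 'a) set" where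
  "dir_class G N T g = CC_null G N T #>\<^bsub>CC G N T\<^esub> g"

text \<open>
  Here and below, \<open>the_elem (f ` A)\<close> is the common value of \<open>f\<close> on the representatives of
  the class \<open>A\<close>.
\<close>

definition dir_cone_norm :: "('a, 'b) monoid_scheme \<Rightarrow> ('a \<Rightarrow> real) \<Rightarrow> real set \<Rightarrow> (real \<Rightarrow> 'a) set \<Rightarrow> real" where
  "dir_cone_norm G N T A = the_elem (CC_norm G N T ` A)"

definition restriction_map ::
  "('a, 'b) monoid_scheme \<Rightarrow> ('a \<Rightarrow> real) \<Rightarrow> real set \<Rightarrow> real set \<Rightarrow> (real \<Rightarrow> 'a) set \<Rightarrow> (real \<Rightarrow> 'a) set"
where
  "restriction_map G N T' T A = the_elem ((\<lambda>g. dir_class G N T (restrict g T)) ` A)"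

definition independent_of_scaling :: "('a, 'b) monoid_scheme \<Rightarrow> ('a \<Rightarrow> real) \<Rightarrow> bool" where
  "independent_of_scaling G N \<longleftrightarrow>
     (\<forall>T T'. scaling_set T \<and> scaling_set T' \<and> T \<subseteq> T' \<longrightarrow>
        (\<forall>g\<in>carrier (CC G N T').
           restriction_map G N T' T (dir_class G N T' g) = dir_class G N T (restrict g T)) \<and>
        isometry (dir_cone G N T') (dir_cone_norm G N T') (dir_cone G N T) (dir_cone_norm G N T)
          (restriction_map G N T' T))"

section \<open>The ultrafilter cone\<close>

definition nonprincipal_ultrafilter :: "nat filter \<Rightarrow> bool" where
  "nonprincipal_ultrafilter \<omega> \<longleftrightarrow> \<omega> \<noteq> bot \<and>
     (\<forall>P. eventually P \<omega> \<or> eventually (\<lambda>n. \<not> P n) \<omega>) \<and> (\<forall>n. \<omega> \<noteq> principal {n})"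

definition scaling_sequence :: "(nat \<Rightarrow> real) \<Rightarrow> bool" where
  "scaling_sequence d \<longleftrightarrow> (\<forall>n. 0 < d n) \<and> filterlim d at_top sequentially"

definition bounded_seqs :: "('a, 'b) monoid_scheme \<Rightarrow> ('a \<Rightarrow> real) \<Rightarrow> (nat \<Rightarrow> real) \<Rightarrow> (nat \<Rightarrow> 'a) monoid" where
  "bounded_seqs G N d = (product_group UNIV (\<lambda>_. G))
     \<lparr>carrier := {g \<in> carrier (product_group UNIV (\<lambda>_. G)). limsup (\<lambda>n. ereal (N (g n) / d n)) < \<infinity>}\<rparr>"

text \<open>
  Two sequences \<open>g\<close>, \<open>h\<close> are identified iff the pointwise product of the inverse of \<open>g\<close> with \<open>h\<close>
  lies in the following normal subgroup; the equivalence classes are its cosets.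
\<close>

definition null_seqs ::
  "('a, 'b) monoid_scheme \<Rightarrow> ('a \<Rightarrow> real) \<Rightarrow> nat filter \<Rightarrow> (nat \<Rightarrow> real) \<Rightarrow> (nat \<Rightarrow> 'a) set"
where
  "null_seqs G N \<omega> d = {g \<in> carrier (bounded_seqs G N d). ((\<lambda>n. N (g n) / d n) \<longlongrightarrow> 0) \<omega>}"

definition ucone ::
  "('a, 'b) monoid_scheme \<Rightarrow> ('a \<Rightarrow> real) \<Rightarrow> nat filter \<Rightarrow> (nat \<Rightarrow> real) \<Rightarrow> (nat \<Rightarrow> 'a) set monoid"
where
  "ucone G N \<omega> d = bounded_seqs G N d Mod null_seqs G N \<omega> d"

definition ucone_class ::
  "('a, 'b) monoid_scheme \<Rightarrow> ('a \<Rightarrow> real) \<Rightarrow> nat filter \<Rightarrow> (nat \<Rightarrow> real) \<Rightarrow> (nat \<Rightarrow> 'a) \<Rightarrow> (nat \<Rightarrow> 'a) set"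
where
  "ucone_class G N \<omega> d g = null_seqs G N \<omega> d #>\<^bsub>bounded_seqs G N d\<^esub> g"

definition ucone_norm ::
  "('a, 'b) monoid_scheme \<Rightarrow> ('a \<Rightarrow> real) \<Rightarrow> nat filter \<Rightarrow> (nat \<Rightarrow> real) \<Rightarrow> (nat \<Rightarrow> 'a) set \<Rightarrow> real"
where
  "ucone_norm G N \<omega> d A = the_elem ((\<lambda>g. Lim \<omega> (\<lambda>n. N (g n) / d n)) ` A)"

definition rho ::
  "('a, 'b) monoid_scheme \<Rightarrow> ('a \<Rightarrow> real) \<Rightarrow> nat filter \<Rightarrow> (nat \<Rightarrow> real) \<Rightarrow> (real \<Rightarrow> 'a) set \<Rightarrow> (nat \<Rightarrow> 'a) set"
where
  "rho G N \<omega> d A = the_elem ((\<lambda>g. ucone_class G N \<omega> d (\<lambda>n. g (d n))) ` A)"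

end

theory Submission
  imports Defs
begin

text \<open>
  The whole statement follows from one formula: for nilpotent \<open>G\<close> and \<open>g\<close> in \<open>CC G N T\<close>, the
  pseudonorm of \<open>g\<close> is the limit of \<open>N (g t) / t\<close> as \<open>t\<close> grows in \<open>T\<close> (\<open>CC_norm_tendsto\<close>).  A limit
  along \<open>T'\<close> is inherited by every unbounded subset \<open>T\<close> and by every sequence \<open>d n\<close> that tends to
  infinity, so restriction to \<open>T\<close> and evaluation along \<open>d\<close> preserve norms; and norm-preserving
  homomorphisms induce isometric embeddings of the quotients by the elements of norm zero.

  That \<open>N (g t) / t\<close> is asymptotically at most the pseudonorm of \<open>g\<close> holds in every group, because
  the projection \<open>pi_hom\<close> does not increase norms (\<open>norm_pi_hom_le\<close>).  This is not obvious, as the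
  infimum defining \<open>FR_norm\<close> involves products of conjugates with real exponents, which cannot be
  projected to \<open>G\<close>.  Such a product is however reduced to the empty word by merging and deleting
  syllables, at a total price equal to its cost, and any reduction of a word can be transferred to
  its normal form without raising the price (\<open>reduces_join\<close>).  Starting from a word with integral
  exponents a reduction only meets integral exponents, so that it can be read in \<open>G\<close>.

  The converse uses nilpotency through a single fact: for fixed \<open>a\<close> and \<open>b\<close>, the distance between
  \<open>(a b)^m\<close> and \<open>a^m b^m\<close> is bounded independently of \<open>m\<close> (\<open>power_mult_bounded\<close>).  Indeed they
  differ by an element of the commutator subgroup of the group \<open>H\<close> generated by \<open>a\<close> and \<open>b\<close>.
  Modulo the next term of the lower central series of \<open>H\<close>, each element of a term beyond the first
  is a product of one commutator with \<open>a\<close> and one with \<open>b\<close>, and a commutator with \<open>a\<close> has norm at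
  most \<open>2 * N a\<close>.  So the commutator subgroup of \<open>H\<close> is bounded.

  Consequently, if \<open>g\<close> is the projection of \<open>w\<close> and \<open>s\<close> is large, then \<open>g t\<close> is close to the power
  of \<open>g s\<close> with exponent \<open>n = nat \<lfloor>t / s\<rfloor>\<close>: the word \<open>w t\<close> is close to \<open>psi n (w s)\<close> by the Cauchy
  property, and the projection of \<open>psi n (w s)\<close> is within bounded distance of \<open>(g s)^n\<close>.  Replacing
  \<open>psi n (w s)\<close> inside \<open>w t\<close> by the single syllable \<open>gbar (g s) n\<close> and a bounded correction yields
  another representative of \<open>g\<close>, of norm at most \<open>N (g s) / s + e\<close> (\<open>direction_improve\<close>).  The same
  approximation by powers shows that the cone is abelian, since \<open>(b a)^n\<close> is the conjugate of
  \<open>(a b)^n\<close> by a fixed element.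

  Finally, every direction along \<open>T\<close> extends to all times by rounding its value at a time of \<open>T\<close> that
  grows slowly with \<open>t\<close> (\<open>direction_extend\<close>), so that restriction is onto.
\<close>

section \<open>Conjugation-invariant pseudonorms\<close>

locale pseudonormed_group = group G for G (structure) +
  fixes p :: "'a \<Rightarrow> real"
  assumes nonneg: "x \<in> carrier G \<Longrightarrow> 0 \<le> p x"
    and norm_one: "p \<one> = 0"
    and norm_inv: "x \<in> carrier G \<Longrightarrow> p (inv x) = p x"
    and triangle: "x \<in> carrier G \<Longrightarrow> y \<in> carrier G \<Longrightarrow> p (x \<otimes> y) \<le> p x + p y"
    and conj: "x \<in> carrier G \<Longrightarrow> h \<in> carrier G \<Longrightarrow> p (h \<otimes> x \<otimes> inv h) = p x"

lemma conj_invariant_norm_imp_pseudonormed: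
  "group G \<Longrightarrow> conj_invariant_norm G N \<Longrightarrow> pseudonormed_group G N"
  unfolding conj_invariant_norm_def pseudonormed_group_def pseudonormed_group_axioms_def
  by (auto simp: group.is_monoid)

context pseudonormed_group
begin

abbreviation dst :: "'a \<Rightarrow> 'a \<Rightarrow> real" where "dst \<equiv> norm_dist G p"

text \<open>
  The two products are conjugate.
\<close>

lemma norm_mult_commute:
  assumes "x \<in> carrier G" "y \<in> carrier G" shows "p (x \<otimes> y) = p (y \<otimes> x)"
proof -
  have "p (x \<otimes> y) = p (inv x \<otimes> (x \<otimes> y) \<otimes> inv (inv x))" using assms conj[of "x \<otimes> y" "inv x"] by simp
  also have "inv x \<otimes> (x \<otimes> y) \<otimes> inv (inv x) = y \<otimes> x"
    using assms by (simp add: m_assoc[symmetric])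
  finally show ?thesis .
qed

lemma dst_nonneg: "x \<in> carrier G \<Longrightarrow> y \<in> carrier G \<Longrightarrow> 0 \<le> dst x y"
  by (simp add: norm_dist_def nonneg)

lemma dst_refl: "x \<in> carrier G \<Longrightarrow> dst x x = 0"
  by (simp add: norm_dist_def norm_one)

lemma dst_one: "x \<in> carrier G \<Longrightarrow> dst \<one> x = p x"
  by (simp add: norm_dist_def)

lemma dst_sym:
  assumes "x \<in> carrier G" "y \<in> carrier G" shows "dst x y = dst y x"
  using norm_inv[of "inv x \<otimes> y"] assms by (simp add: norm_dist_def inv_mult_group)

lemma dst_triangle:
  assumes "x \<in> carrier G" "y \<in> carrier G" "z \<in> carrier G" shows "dst x z \<le> dst x y + dst y z"
proof -
  have "inv x \<otimes> z = (inv x \<otimes> y) \<otimes> (inv y \<otimes> z)"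
    using assms by (simp add: m_assoc m_assoc[of y "inv y" z, symmetric])
  then show ?thesis using triangle[of "inv x \<otimes> y" "inv y \<otimes> z"] assms by (simp add: norm_dist_def)
qed

lemma dst_inv:
  assumes "x \<in> carrier G" "y \<in> carrier G" shows "dst (inv x) (inv y) = dst x y"
proof -
  have "dst (inv x) (inv y) = p (x \<otimes> inv y)" using assms by (simp add: norm_dist_def)
  also have "\<dots> = p (inv y \<otimes> x)" using assms by (intro norm_mult_commute) auto
  also have "\<dots> = dst x y" using dst_sym[OF assms] by (simp add: norm_dist_def)
  finally show ?thesis .
qed

lemma dst_left_mult:
  assumes "x \<in> carrier G" "y \<in> carrier G" "z \<in> carrier G" shows "dst (z \<otimes> x) (z \<otimes> y) = dst x y"
proof -
  have "inv (z \<otimes> x) \<otimes> (z \<otimes> y) = inv x \<otimes> (inv z \<otimes> z) \<otimes> y"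
    using assms by (simp only: inv_mult_group m_assoc inv_closed m_closed)
  then show ?thesis using assms by (simp add: norm_dist_def)
qed

lemma dst_right_mult:
  assumes "x \<in> carrier G" "y \<in> carrier G" "z \<in> carrier G" shows "dst (x \<otimes> z) (y \<otimes> z) = dst x y"
proof -
  have "dst (x \<otimes> z) (y \<otimes> z) = dst (inv z \<otimes> inv x) (inv z \<otimes> inv y)"
    using assms dst_inv[of "x \<otimes> z" "y \<otimes> z"] by (simp add: inv_mult_group)
  then show ?thesis using assms by (simp add: dst_left_mult dst_inv)
qed

lemma dst_mult:
  assumes "x \<in> carrier G" "y \<in> carrier G" "u \<in> carrier G" "v \<in> carrier G"
  shows "dst (x \<otimes> u) (y \<otimes> v) \<le> dst x y + dst u v"
  using dst_triangle[of "x \<otimes> u" "y \<otimes> u" "y \<otimes> v"] assms by (simp add: dst_left_mult dst_right_mult)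

lemma norm_le_dst:
  assumes "x \<in> carrier G" "y \<in> carrier G" shows "p x \<le> p y + dst x y"
  using dst_triangle[of \<one> y x] assms by (simp add: dst_one dst_sym[of x y])

lemma norm_diff_le_dst:
  assumes "x \<in> carrier G" "y \<in> carrier G" shows "\<bar>p x - p y\<bar> \<le> dst x y"
  using norm_le_dst[of x y] norm_le_dst[of y x] assms dst_sym[of x y] by simp

text \<open>Conjugation invariance makes the bound depend on one of the two entries only.\<close>

lemma norm_commutator_le:
  assumes "x \<in> carrier G" "y \<in> carrier G"
  shows "p (x \<otimes> y \<otimes> inv x \<otimes> inv y) \<le> 2 * p y"
  using triangle[of "x \<otimes> y \<otimes> inv x" "inv y"] conj[of y x] norm_inv[of y] assms by simp

definition null :: "'a set" where "null = {x \<in> carrier G. p x = 0}"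

lemma null_normal: "normal null G"
proof -
  have "subgroup null G"
  proof (rule subgroupI)
    show "null \<noteq> {}" using norm_one by (auto simp: null_def)
    show "a \<otimes> b \<in> null" if "a \<in> null" "b \<in> null" for a b
      using that triangle[of a b] nonneg[of "a \<otimes> b"] by (auto simp: null_def)
  qed (auto simp: null_def norm_inv)
  then show ?thesis
    unfolding normal_inv_iff by (auto simp: null_def conj)
qed

lemma coset_memD:
  assumes "x \<in> carrier G" "y \<in> null #> x" shows "y \<in> carrier G" "dst x y = 0"
proof -
  obtain z where z: "z \<in> carrier G" "p z = 0" "y = z \<otimes> x" using assms by (auto simp: r_coset_def null_def)
  then show "y \<in> carrier G" using assms by simp
  have "dst (\<one> \<otimes> x) (z \<otimes> x) = dst \<one> z" using z assms by (intro dst_right_mult) auto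
  then show "dst x y = 0" using z assms by (simp add: dst_one)
qed

lemma coset_eqI:
  assumes "x \<in> carrier G" "y \<in> carrier G" "dst x y = 0" shows "null #> x = null #> y"
proof -
  interpret normal null G by (rule null_normal)
  have "p (x \<otimes> inv y) = p (inv y \<otimes> x)" using assms(1,2) by (intro norm_mult_commute inv_closed)
  also have "\<dots> = 0" using dst_sym[OF assms(1,2)] assms(3) unfolding norm_dist_def by linarith
  finally have "x \<otimes> inv y \<in> null" using assms(1,2) unfolding null_def by simp
  then have "x \<in> null #> y" by (rule rcos_module_rev[OF is_group assms(2,1)])
  then show ?thesis by (rule repr_independence[OF _ assms(2) subgroup_axioms, symmetric])
qed

lemma self_in_coset: "x \<in> carrier G \<Longrightarrow> x \<in> null #> x"
  using null_normal rcos_self normal_imp_subgroup by blast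

lemma the_elem_image_eq:
  assumes "x \<in> A" "\<And>y. y \<in> A \<Longrightarrow> f y = f x" shows "the_elem (f ` A) = f x"
proof -
  have "f ` A \<subseteq> {f x}" by (rule image_subsetI, unfold singleton_iff, rule assms(2))
  then have "f ` A = {f x}" using assms(1) by blast
  then show ?thesis by simp
qed

lemma norm_coset:
  assumes "x \<in> carrier G" shows "the_elem (p ` (null #> x)) = p x"
proof (rule the_elem_image_eq[OF self_in_coset[OF assms]])
  fix y assume "y \<in> null #> x"
  then have "y \<in> carrier G" "dst x y = 0" using coset_memD[OF assms] by auto
  then show "p y = p x" using norm_diff_le_dst[of x y] assms by simp
qed

lemma dst_coset:
  assumes "x \<in> carrier G" "y \<in> carrier G"
  shows "norm_dist (G Mod null) (\<lambda>A. the_elem (p ` A)) (null #> x) (null #> y) = dst x y"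
proof -
  interpret normal null G by (rule null_normal)
  have "inv\<^bsub>G Mod null\<^esub> (null #> x) = null #> inv x"
    using assms by (simp add: inv_FactGroup carrier_FactGroup rcos_inv)
  then show ?thesis using assms by (simp add: norm_dist_def rcos_sum norm_coset)
qed

end

text \<open>
  A norm-preserving homomorphism identifies elements at distance zero, hence descends to the
  quotients by the elements of norm zero, and there it preserves distances.
\<close>

locale norm_preserving_hom = A: pseudonormed_group A p + B: pseudonormed_group B q
  for A (structure) and p :: "'a \<Rightarrow> real" and B (structure) and q :: "'b \<Rightarrow> real" +
  fixes f :: "'a \<Rightarrow> 'b"
  assumes f_hom: "f \<in> hom A B" and f_norm: "x \<in> carrier A \<Longrightarrow> q (f x) = p x"
begin

definition induced :: "'a set \<Rightarrow> 'b set" where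
  "induced X = the_elem ((\<lambda>x. B.null #>\<^bsub>B\<^esub> f x) ` X)"

lemma f_dst:
  assumes "x \<in> carrier A" "y \<in> carrier A" shows "B.dst (f x) (f y) = A.dst x y"
proof -
  interpret H: group_hom A B f
    by (simp add: group_hom_def group_hom_axioms_def f_hom A.is_group B.is_group)
  show ?thesis
    using f_norm[of "inv\<^bsub>A\<^esub> x \<otimes>\<^bsub>A\<^esub> y"] assms by (simp add: norm_dist_def)
qed

lemma f_closed: "x \<in> carrier A \<Longrightarrow> f x \<in> carrier B"
  using f_hom by (rule hom_in_carrier)

lemma induced_class:
  assumes "x \<in> carrier A" shows "induced (A.null #>\<^bsub>A\<^esub> x) = B.null #>\<^bsub>B\<^esub> f x"
  unfolding induced_def
proof (rule A.the_elem_image_eq[OF A.self_in_coset[OF assms]])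
  fix y assume "y \<in> A.null #>\<^bsub>A\<^esub> x"
  then have "y \<in> carrier A" "A.dst x y = 0" using A.coset_memD[OF assms] by auto
  then show "B.null #>\<^bsub>B\<^esub> f y = B.null #>\<^bsub>B\<^esub> f x"
    using assms by (intro B.coset_eqI) (auto simp: f_closed f_dst A.dst_sym[of y x])
qed

lemma induced_isometric_embedding:
  "isometric_embedding (A Mod A.null) (\<lambda>X. the_elem (p ` X)) (B Mod B.null) (\<lambda>X. the_elem (q ` X)) induced"
  unfolding isometric_embedding_def
proof (intro conjI ballI)
  interpret NA: normal A.null A by (rule A.null_normal)
  interpret NB: normal B.null B by (rule B.null_normal)
  show "induced \<in> hom (A Mod A.null) (B Mod B.null)"
  proof (rule homI)
    fix X Y assume "X \<in> carrier (A Mod A.null)" "Y \<in> carrier (A Mod A.null)"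
    then obtain x y where xy: "x \<in> carrier A" "y \<in> carrier A" "X = A.null #>\<^bsub>A\<^esub> x" "Y = A.null #>\<^bsub>A\<^esub> y"
      by (auto simp: carrier_FactGroup)
    show "induced X \<in> carrier (B Mod B.null)" using xy by (simp add: induced_class carrier_FactGroup f_closed)
    have "f (x \<otimes>\<^bsub>A\<^esub> y) = f x \<otimes>\<^bsub>B\<^esub> f y" using f_hom xy by (simp add: hom_mult)
    then show "induced (X \<otimes>\<^bsub>A Mod A.null\<^esub> Y) = induced X \<otimes>\<^bsub>B Mod B.null\<^esub> induced Y"
      using xy by (simp add: NA.rcos_sum NB.rcos_sum induced_class f_closed)
  qed
  fix X Y assume "X \<in> carrier (A Mod A.null)" "Y \<in> carrier (A Mod A.null)"
  then obtain x y where xy: "x \<in> carrier A" "y \<in> carrier A" "X = A.null #>\<^bsub>A\<^esub> x" "Y = A.null #>\<^bsub>A\<^esub> y"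
    by (auto simp: carrier_FactGroup)
  then show "norm_dist (B Mod B.null) (\<lambda>X. the_elem (q ` X)) (induced X) (induced Y) =
      norm_dist (A Mod A.null) (\<lambda>X. the_elem (p ` X)) X Y"
    by (simp add: induced_class A.dst_coset B.dst_coset f_closed f_dst)
qed

lemma induced_isometry:
  assumes "\<And>y. y \<in> carrier B \<Longrightarrow> \<exists>x\<in>carrier A. B.dst (f x) y = 0"
  shows "isometry (A Mod A.null) (\<lambda>X. the_elem (p ` X)) (B Mod B.null) (\<lambda>X. the_elem (q ` X)) induced"
  unfolding isometry_def
proof (intro conjI induced_isometric_embedding, rule bij_betw_imageI)
  show "inj_on induced (carrier (A Mod A.null))"
  proof (rule inj_onI)
    fix X Y assume "X \<in> carrier (A Mod A.null)" "Y \<in> carrier (A Mod A.null)" and eq: "induced X = induced Y"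
    then obtain x y where xy: "x \<in> carrier A" "y \<in> carrier A" "X = A.null #>\<^bsub>A\<^esub> x" "Y = A.null #>\<^bsub>A\<^esub> y"
      by (auto simp: carrier_FactGroup)
    then have "f y \<in> B.null #>\<^bsub>B\<^esub> f x" using eq B.self_in_coset[of "f y"] by (simp add: induced_class f_closed)
    then have "B.dst (f x) (f y) = 0" by (rule B.coset_memD(2)[OF f_closed[OF xy(1)]])
    then show "X = Y" using xy by (simp add: f_dst A.coset_eqI)
  qed
  have surj: "Y \<in> induced ` carrier (A Mod A.null)" if Y: "Y \<in> carrier (B Mod B.null)" for Y
  proof -
    obtain y where y: "y \<in> carrier B" "Y = B.null #>\<^bsub>B\<^esub> y" using Y by (auto simp: carrier_FactGroup)
    then obtain x where x: "x \<in> carrier A" "B.dst (f x) y = 0" using assms by blast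
    then have "Y = induced (A.null #>\<^bsub>A\<^esub> x)"
      using y B.coset_eqI[of "f x" y] by (simp add: induced_class f_closed)
    moreover have "A.null #>\<^bsub>A\<^esub> x \<in> carrier (A Mod A.null)" using x by (simp add: carrier_FactGroup)
    ultimately show ?thesis by (rule image_eqI)
  qed
  have into: "induced X \<in> carrier (B Mod B.null)" if "X \<in> carrier (A Mod A.null)" for X
    using that by (auto simp: carrier_FactGroup induced_class f_closed)
  show "induced ` carrier (A Mod A.null) = carrier (B Mod B.null)"
    by (intro equalityI image_subsetI subsetI surj into)
qed

end

lemma (in group) conj_mult:
  assumes "k \<in> carrier G" "x \<in> carrier G" "y \<in> carrier G"
  shows "k \<otimes> (x \<otimes> y) \<otimes> inv k = (k \<otimes> x \<otimes> inv k) \<otimes> (k \<otimes> y \<otimes> inv k)"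
proof -
  have "inv k \<otimes> (k \<otimes> (y \<otimes> inv k)) = y \<otimes> inv k"
    using assms m_assoc[of "inv k" k "y \<otimes> inv k"] by simp
  then show ?thesis using assms by (simp add: m_assoc)
qed

lemma (in group) conj_conj:
  assumes "k \<in> carrier G" "h \<in> carrier G" "x \<in> carrier G"
  shows "k \<otimes> (h \<otimes> x \<otimes> inv h) \<otimes> inv k = (k \<otimes> h) \<otimes> x \<otimes> inv (k \<otimes> h)"
  using assms by (simp add: m_assoc inv_mult_group)

section \<open>The pseudonorm of the free product\<close>

locale conj_normed_group = group G for G (structure) +
  fixes N :: "'a \<Rightarrow> real"
  assumes norm_axioms: "conj_invariant_norm G N"

sublocale conj_normed_group \<subseteq> N: pseudonormed_group G N
  by (rule conj_invariant_norm_imp_pseudonormed[OF is_group norm_axioms])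

sublocale conj_normed_group \<subseteq> F: group "FR G"
  by (rule group_FR)

context conj_normed_group
begin

lemma FR_one: "\<one>\<^bsub>FR G\<^esub> = []" by (simp add: FR_def)

lemma gbar_0: "gbar g 0 = \<one>\<^bsub>FR G\<^esub>" by (simp add: gbar_def FR_def)

lemma inv_gbar: "g \<in> carrier G \<Longrightarrow> inv\<^bsub>FR G\<^esub> gbar g r = gbar g (- r)"
  by (rule F.inv_equality) (simp_all add: gbar_add gbar_0 gbar_in_FR)

lemma Cons_eq_gbar_mult:
  assumes "(g, r) # w \<in> carrier (FR G)"
  shows "g \<in> carrier G" "w \<in> carrier (FR G)" "(g, r) # w = gbar g r \<otimes>\<^bsub>FR G\<^esub> w"
  using assms fp_cons_hd[of "carrier G" g r w]
  by (auto simp: FR_def gbar_def fp_reduced_Cons)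

lemma FR_induct [consumes 1, case_names one mult]:
  assumes "x \<in> carrier (FR G)" and "P \<one>\<^bsub>FR G\<^esub>"
    and "\<And>g r w. g \<in> carrier G \<Longrightarrow> w \<in> carrier (FR G) \<Longrightarrow> P w \<Longrightarrow> P (gbar g r \<otimes>\<^bsub>FR G\<^esub> w)"
  shows "P x"
  using assms(1)
proof (induction x)
  case Nil
  then show ?case using assms(2) by (simp add: FR_one)
next
  case (Cons a w)
  obtain g r where a: "a = (g, r)" by (cases a)
  note C = Cons_eq_gbar_mult[OF Cons.prems[unfolded a]]
  show ?case unfolding a C(3) by (rule assms(3)[OF C(1,2) Cons.IH[OF C(2)]])
qed

text \<open>
  The sums whose infimum is \<open>FR_norm\<close>, in a form suited to rule induction.  The exponent \<open>\<plusminus>1\<close> of a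
  factor is absorbed into the sign of \<open>r\<close>.
\<close>

inductive conj_cost :: "('a \<times> real) list \<Rightarrow> real \<Rightarrow> bool" where
  one: "conj_cost \<one>\<^bsub>FR G\<^esub> 0"
| mult: "conj_cost x c \<Longrightarrow> h \<in> carrier (FR G) \<Longrightarrow> g \<in> carrier G \<Longrightarrow>
    conj_cost (h \<otimes>\<^bsub>FR G\<^esub> gbar g r \<otimes>\<^bsub>FR G\<^esub> inv\<^bsub>FR G\<^esub> h \<otimes>\<^bsub>FR G\<^esub> x) (\<bar>r\<bar> * N g + c)"

lemma conj_cost_carrier: "conj_cost x c \<Longrightarrow> x \<in> carrier (FR G) \<and> 0 \<le> c"
  by (induction rule: conj_cost.induct) (auto simp: gbar_in_FR N.nonneg)

lemma FR_norm_conj_cost: "FR_norm G N x = Inf {c. conj_cost x c}"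
proof -
  let ?ok = "\<lambda>ps :: (('a \<times> real) list \<times> 'a \<times> real \<times> int) list.
    \<forall>(h, g, r, e)\<in>set ps. h \<in> carrier (FR G) \<and> g \<in> carrier G \<and> e \<in> {1, -1}"
  let ?sum = "\<lambda>ps :: (('a \<times> real) list \<times> 'a \<times> real \<times> int) list. \<Sum>(h, g, r, e)\<leftarrow>ps. \<bar>r\<bar> * N g"
  let ?prod = "\<lambda>ps :: (('a \<times> real) list \<times> 'a \<times> real \<times> int) list. foldr (\<otimes>\<^bsub>FR G\<^esub>)
           (map (\<lambda>(h, g, r, e). h \<otimes>\<^bsub>FR G\<^esub> (gbar g r [^]\<^bsub>FR G\<^esub> e) \<otimes>\<^bsub>FR G\<^esub> inv\<^bsub>FR G\<^esub> h) ps)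
           \<one>\<^bsub>FR G\<^esub>"
  have pow: "gbar g r [^]\<^bsub>FR G\<^esub> (1::int) = gbar g r" "gbar g r [^]\<^bsub>FR G\<^esub> (- 1::int) = gbar g (- r)"
    if "g \<in> carrier G" for g r
    using that gbar_in_FR[OF that, of r] by (simp_all add: F.int_pow_1 F.int_pow_neg inv_gbar)
  have a: "conj_cost (?prod ps) (?sum ps)" if "?ok ps" for ps
    using that
  proof (induction ps)
    case Nil
    then show ?case by (simp add: conj_cost.one)
  next
    case (Cons q ps)
    obtain h g r e where q: "q = (h, g, r, e)" by (cases q) auto
    have ok: "?ok ps" and h: "h \<in> carrier (FR G)" and g: "g \<in> carrier G" and e: "e = 1 \<or> e = -1"
      using Cons.prems q by auto
    define s where "s = (if e = 1 then r else - r)"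
    have s: "gbar g r [^]\<^bsub>FR G\<^esub> e = gbar g s" "\<bar>s\<bar> = \<bar>r\<bar>" using e pow[OF g] by (auto simp: s_def)
    show ?case using conj_cost.mult[OF Cons.IH[OF ok] h g, of s] by (simp add: q s)
  qed
  have b: "\<exists>ps. ?ok ps \<and> x = ?prod ps \<and> c = ?sum ps" if "conj_cost x c" for x c
    using that
  proof (induction rule: conj_cost.induct)
    case one
    show ?case by (rule exI[of _ "[]"]) simp
  next
    case (mult x c h g r)
    then obtain ps where ps: "?ok ps" "x = ?prod ps" "c = ?sum ps" by blast
    show ?case by (rule exI[of _ "(h, g, r, 1) # ps"]) (use ps mult.hyps pow in auto)
  qed
  have "{?sum ps | ps. ?ok ps \<and> x = ?prod ps} = {c. conj_cost x c}"
    using a b by blast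
  then show ?thesis unfolding FR_norm_def by simp
qed

lemma conj_cost_mult: "conj_cost x c \<Longrightarrow> conj_cost y d \<Longrightarrow> conj_cost (x \<otimes>\<^bsub>FR G\<^esub> y) (c + d)"
proof (induction rule: conj_cost.induct)
  case one
  then show ?case using conj_cost_carrier by simp
next
  case (mult x c h g r)
  have "x \<in> carrier (FR G)" "y \<in> carrier (FR G)" using mult conj_cost_carrier by auto
  then show ?case using conj_cost.mult[OF mult.IH[OF mult.prems] mult.hyps(2,3), of r] mult.hyps
    by (simp add: F.m_assoc gbar_in_FR add.assoc)
qed

lemma conj_cost_gbar:
  assumes "g \<in> carrier G" shows "conj_cost (gbar g r) (\<bar>r\<bar> * N g)"
  using conj_cost.mult[OF conj_cost.one F.one_closed assms, of r] assms by (simp add: gbar_in_FR)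

lemma conj_cost_conj:
  assumes "conj_cost x c" "k \<in> carrier (FR G)"
  shows "conj_cost (k \<otimes>\<^bsub>FR G\<^esub> x \<otimes>\<^bsub>FR G\<^esub> inv\<^bsub>FR G\<^esub> k) c"
  using assms
proof (induction rule: conj_cost.induct)
  case one
  then show ?case by (simp add: conj_cost.one)
next
  case (mult x c h g r)
  have x: "x \<in> carrier (FR G)" using mult.hyps(1) conj_cost_carrier by blast
  have g: "gbar g r \<in> carrier (FR G)" using mult.hyps(3) by (rule gbar_in_FR)
  have eq: "k \<otimes>\<^bsub>FR G\<^esub> (h \<otimes>\<^bsub>FR G\<^esub> gbar g r \<otimes>\<^bsub>FR G\<^esub> inv\<^bsub>FR G\<^esub> h \<otimes>\<^bsub>FR G\<^esub> x) \<otimes>\<^bsub>FR G\<^esub> inv\<^bsub>FR G\<^esub> k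
      = (k \<otimes>\<^bsub>FR G\<^esub> h) \<otimes>\<^bsub>FR G\<^esub> gbar g r \<otimes>\<^bsub>FR G\<^esub> inv\<^bsub>FR G\<^esub> (k \<otimes>\<^bsub>FR G\<^esub> h)
        \<otimes>\<^bsub>FR G\<^esub> (k \<otimes>\<^bsub>FR G\<^esub> x \<otimes>\<^bsub>FR G\<^esub> inv\<^bsub>FR G\<^esub> k)"
    using mult.hyps(2) mult.prems x g by (subst F.conj_mult) (auto simp only: F.conj_conj F.m_closed F.inv_closed)
  show ?case unfolding eq
    by (rule conj_cost.mult[OF mult.IH[OF mult.prems] F.m_closed[OF mult.prems mult.hyps(2)] mult.hyps(3)])
qed

lemma conj_cost_inv: "conj_cost x c \<Longrightarrow> conj_cost (inv\<^bsub>FR G\<^esub> x) c"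
proof (induction rule: conj_cost.induct)
  case one
  show ?case by (simp add: conj_cost.one)
next
  case (mult x c h g r)
  have x: "x \<in> carrier (FR G)" using mult.hyps conj_cost_carrier by blast
  have eq: "inv\<^bsub>FR G\<^esub> (h \<otimes>\<^bsub>FR G\<^esub> gbar g r \<otimes>\<^bsub>FR G\<^esub> inv\<^bsub>FR G\<^esub> h \<otimes>\<^bsub>FR G\<^esub> x)
      = inv\<^bsub>FR G\<^esub> x \<otimes>\<^bsub>FR G\<^esub> (h \<otimes>\<^bsub>FR G\<^esub> gbar g (- r) \<otimes>\<^bsub>FR G\<^esub> inv\<^bsub>FR G\<^esub> h)"
    using x mult.hyps by (simp add: F.inv_mult_group F.m_assoc gbar_in_FR inv_gbar)
  have "conj_cost (h \<otimes>\<^bsub>FR G\<^esub> gbar g (- r) \<otimes>\<^bsub>FR G\<^esub> inv\<^bsub>FR G\<^esub> h) (\<bar>- r\<bar> * N g)"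
    using mult.hyps by (intro conj_cost_conj conj_cost_gbar)
  from conj_cost_mult[OF mult.IH this] show ?case unfolding eq by (simp add: add.commute)
qed

lemma psi_FR_hom: "group_hom (FR G) (FR G) (psi G t)"
  by (simp add: group_hom_def group_hom_axioms_def psi_hom F.is_group)

lemma psi_closed [simp]: "x \<in> carrier (FR G) \<Longrightarrow> psi G t x \<in> carrier (FR G)"
  using psi_hom by (rule hom_in_carrier)

lemma psi_mult: "x \<in> carrier (FR G) \<Longrightarrow> y \<in> carrier (FR G) \<Longrightarrow>
    psi G t (x \<otimes>\<^bsub>FR G\<^esub> y) = psi G t x \<otimes>\<^bsub>FR G\<^esub> psi G t y"
  using psi_hom by (rule hom_mult)

lemma psi_one: "psi G t \<one>\<^bsub>FR G\<^esub> = \<one>\<^bsub>FR G\<^esub>"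
  using psi_FR_hom by (rule group_hom.hom_one)

lemma psi_inv: "x \<in> carrier (FR G) \<Longrightarrow> psi G t (inv\<^bsub>FR G\<^esub> x) = inv\<^bsub>FR G\<^esub> psi G t x"
  by (rule group_hom.hom_inv[OF psi_FR_hom])

lemma conj_cost_psi: "conj_cost x c \<Longrightarrow> conj_cost (psi G t x) (\<bar>t\<bar> * c)"
proof (induction rule: conj_cost.induct)
  case one
  show ?case by (simp add: conj_cost.one psi_one)
next
  case (mult x c h g r)
  have x: "x \<in> carrier (FR G)" using mult.hyps conj_cost_carrier by blast
  show ?case
    using conj_cost.mult[OF mult.IH psi_closed[OF mult.hyps(2)] mult.hyps(3), of t "t * r"] x mult.hyps
    by (simp add: psi_mult psi_inv psi_gbar gbar_in_FR distrib_left abs_mult mult.assoc)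
qed

lemma conj_cost_exists: "x \<in> carrier (FR G) \<Longrightarrow> \<exists>c. conj_cost x c"
proof (induction rule: FR_induct)
  case one
  show ?case using conj_cost.one by blast
next
  case (mult g r w)
  then show ?case using conj_cost_mult conj_cost_gbar by blast
qed

lemma FR_norm_le: "conj_cost x c \<Longrightarrow> FR_norm G N x \<le> c"
  unfolding FR_norm_conj_cost by (rule cInf_lower) (auto simp: bdd_below_def dest: conj_cost_carrier)

lemma FR_norm_greatest:
  "x \<in> carrier (FR G) \<Longrightarrow> (\<And>c. conj_cost x c \<Longrightarrow> b \<le> c) \<Longrightarrow> b \<le> FR_norm G N x"
  unfolding FR_norm_conj_cost using conj_cost_exists by (intro cInf_greatest) auto

lemma FR_norm_approx:
  assumes "x \<in> carrier (FR G)" "0 < e" shows "\<exists>c. conj_cost x c \<and> c < FR_norm G N x + e"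
proof (rule ccontr)
  assume "\<nexists>c. conj_cost x c \<and> c < FR_norm G N x + e"
  then have "FR_norm G N x + e \<le> FR_norm G N x" by (intro FR_norm_greatest assms) force
  then show False using assms by simp
qed

lemma pseudonormed_FR: "pseudonormed_group (FR G) (FR_norm G N)"
proof unfold_locales
  fix x assume x: "x \<in> carrier (FR G)"
  show "0 \<le> FR_norm G N x" using x conj_cost_carrier by (intro FR_norm_greatest) auto
  have "FR_norm G N (inv\<^bsub>FR G\<^esub> y) \<le> FR_norm G N y" if "y \<in> carrier (FR G)" for y
    using that by (intro FR_norm_greatest FR_norm_le conj_cost_inv)
  from this[OF x] this[of "inv\<^bsub>FR G\<^esub> x"] show "FR_norm G N (inv\<^bsub>FR G\<^esub> x) = FR_norm G N x" using x by simp
  fix y assume y: "y \<in> carrier (FR G)"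
  show "FR_norm G N (x \<otimes>\<^bsub>FR G\<^esub> y) \<le> FR_norm G N x + FR_norm G N y"
  proof (rule field_le_epsilon)
    fix e :: real assume "0 < e"
    then obtain c d where "conj_cost x c" "c < FR_norm G N x + e/2" "conj_cost y d" "d < FR_norm G N y + e/2"
      using FR_norm_approx[OF x, of "e/2"] FR_norm_approx[OF y, of "e/2"] by auto
    then show "FR_norm G N (x \<otimes>\<^bsub>FR G\<^esub> y) \<le> FR_norm G N x + FR_norm G N y + e"
      using FR_norm_le[OF conj_cost_mult, of x c y d] by simp
  qed
next
  fix x h assume x: "x \<in> carrier (FR G)" and h: "h \<in> carrier (FR G)"
  let ?c = "\<lambda>h x. h \<otimes>\<^bsub>FR G\<^esub> x \<otimes>\<^bsub>FR G\<^esub> inv\<^bsub>FR G\<^esub> h"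
  have le: "FR_norm G N (?c k y) \<le> FR_norm G N y" if "y \<in> carrier (FR G)" "k \<in> carrier (FR G)" for k y
    using that by (intro FR_norm_greatest FR_norm_le conj_cost_conj)
  have "?c (inv\<^bsub>FR G\<^esub> h) (?c h x) = inv\<^bsub>FR G\<^esub> h \<otimes>\<^bsub>FR G\<^esub> h \<otimes>\<^bsub>FR G\<^esub> x \<otimes>\<^bsub>FR G\<^esub> (inv\<^bsub>FR G\<^esub> h \<otimes>\<^bsub>FR G\<^esub> h)"
    using x h by (simp only: F.m_assoc F.m_closed F.inv_closed F.inv_inv)
  then have "?c (inv\<^bsub>FR G\<^esub> h) (?c h x) = x" using x h by simp
  then show "FR_norm G N (?c h x) = FR_norm G N x"
    using le[OF x h] le[of "?c h x" "inv\<^bsub>FR G\<^esub> h"] x h by simp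
next
  show "FR_norm G N \<one>\<^bsub>FR G\<^esub> = 0"
  proof (rule antisym)
    show "FR_norm G N \<one>\<^bsub>FR G\<^esub> \<le> 0" by (rule FR_norm_le[OF conj_cost.one])
    show "0 \<le> FR_norm G N \<one>\<^bsub>FR G\<^esub>" using conj_cost_carrier by (intro FR_norm_greatest) auto
  qed
qed

end

sublocale conj_normed_group \<subseteq> F: pseudonormed_group "FR G" "FR_norm G N"
  by (rule pseudonormed_FR)

context conj_normed_group
begin

lemma FR_norm_gbar: "g \<in> carrier G \<Longrightarrow> FR_norm G N (gbar g r) \<le> \<bar>r\<bar> * N g"
  by (rule FR_norm_le[OF conj_cost_gbar])

lemma FR_norm_psi_le:
  assumes "x \<in> carrier (FR G)" shows "FR_norm G N (psi G t x) \<le> \<bar>t\<bar> * FR_norm G N x"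
proof (cases "t = 0")
  case True
  obtain c where "conj_cost x c" using conj_cost_exists[OF assms] by blast
  from FR_norm_le[OF conj_cost_psi[OF this, of t]] show ?thesis using True by simp
next
  case False
  have "FR_norm G N (psi G t x) / \<bar>t\<bar> \<le> FR_norm G N x"
  proof (rule FR_norm_greatest[OF assms])
    fix c assume "conj_cost x c"
    from FR_norm_le[OF conj_cost_psi[OF this, of t]] show "FR_norm G N (psi G t x) / \<bar>t\<bar> \<le> c"
      using False by (simp add: field_simps)
  qed
  then show ?thesis using False by (simp add: field_simps)
qed

lemma psi_psi: "x \<in> carrier (FR G) \<Longrightarrow> psi G s (psi G t x) = psi G (s * t) x"
  by (induction rule: FR_induct) (simp_all add: psi_one psi_mult psi_gbar gbar_in_FR mult.assoc)

lemma psi_1: "x \<in> carrier (FR G) \<Longrightarrow> psi G 1 x = x"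
  by (induction rule: FR_induct) (simp_all add: psi_one psi_mult psi_gbar gbar_in_FR)

text \<open>
  Each syllable \<open>(g, r)\<close> moves at speed at most \<open>\<bar>r\<bar> * N g\<close> along the path of homomorphisms \<open>psi\<close>; hence
  the constant depends on \<open>x\<close>.
\<close>

lemma psi_Lipschitz:
  assumes "x \<in> carrier (FR G)"
  shows "\<exists>C\<ge>0. \<forall>s t. F.dst (psi G s x) (psi G t x) \<le> C * \<bar>s - t\<bar>"
  using assms
proof (induction rule: FR_induct)
  case one
  show ?case by (rule exI[of _ 0]) (simp add: psi_one F.dst_refl)
next
  case (mult g r w)
  then obtain C where C: "C \<ge> 0" "\<And>s t. F.dst (psi G s w) (psi G t w) \<le> C * \<bar>s - t\<bar>" by blast
  show ?case
  proof (intro exI[of _ "\<bar>r\<bar> * N g + C"] conjI allI)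
    show "0 \<le> \<bar>r\<bar> * N g + C" using C mult.hyps N.nonneg by simp
    fix s t
    have "F.dst (gbar g (s * r)) (gbar g (t * r)) = FR_norm G N (gbar g ((t - s) * r))"
      using mult.hyps by (simp add: norm_dist_def inv_gbar gbar_add left_diff_distrib)
    also have "\<dots> \<le> \<bar>(t - s) * r\<bar> * N g" by (rule FR_norm_gbar[OF mult.hyps(1)])
    also have "\<dots> = \<bar>r\<bar> * N g * \<bar>s - t\<bar>" by (simp add: abs_mult abs_minus_commute)
    finally have "F.dst (gbar g (s * r)) (gbar g (t * r)) \<le> \<bar>r\<bar> * N g * \<bar>s - t\<bar>" .
    moreover have "F.dst (gbar g (s * r) \<otimes>\<^bsub>FR G\<^esub> psi G s w) (gbar g (t * r) \<otimes>\<^bsub>FR G\<^esub> psi G t w)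
        \<le> F.dst (gbar g (s * r)) (gbar g (t * r)) + F.dst (psi G s w) (psi G t w)"
      using mult.hyps by (intro F.dst_mult psi_closed gbar_in_FR)
    ultimately show "F.dst (psi G s (gbar g r \<otimes>\<^bsub>FR G\<^esub> w)) (psi G t (gbar g r \<otimes>\<^bsub>FR G\<^esub> w))
        \<le> (\<bar>r\<bar> * N g + C) * \<bar>s - t\<bar>"
      using C(2)[of s t] mult.hyps by (simp add: psi_mult psi_gbar gbar_in_FR distrib_right)
  qed
qed

end

sublocale conj_normed_group \<subseteq> Z: group "FZ G"
  by (rule group_FZ)

context conj_normed_group
begin

lemma FZ_subgroup: "subgroup (carrier (FZ G)) (FR G)"
  by (simp add: FZ_def carrier_subgroup_generated F.generate_is_subgroup)

lemma FZ_subset: "x \<in> carrier (FZ G) \<Longrightarrow> x \<in> carrier (FR G)"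
  using subgroup.mem_carrier[OF FZ_subgroup] .

lemma FZ_mult [simp]: "x \<otimes>\<^bsub>FZ G\<^esub> y = x \<otimes>\<^bsub>FR G\<^esub> y" and FZ_one [simp]: "\<one>\<^bsub>FZ G\<^esub> = \<one>\<^bsub>FR G\<^esub>"
  by (simp_all add: FZ_def)

lemma FZ_inv: "x \<in> carrier (FZ G) \<Longrightarrow> inv\<^bsub>FZ G\<^esub> x = inv\<^bsub>FR G\<^esub> x"
  unfolding FZ_def by (rule F.inv_subgroup_generated)

lemma gbar_in_FZ:
  assumes "g \<in> carrier G" shows "gbar g (of_int k) \<in> carrier (FZ G)"
proof -
  have nat: "gbar g (of_nat n) = gbar g 1 [^]\<^bsub>FR G\<^esub> n" for n :: nat
  proof (induction n)
    case (Suc n)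
    then show ?case using gbar_add[where G = G, of g "of_nat n" 1] by (simp add: add.commute)
  qed (simp add: gbar_0)
  have "gbar g 1 \<in> carrier (FZ G)"
    using assms by (auto simp: FZ_def carrier_subgroup_generated gbar_in_FR intro!: generate.incl)
  then have pos: "gbar g (of_nat n) \<in> carrier (FZ G)" for n :: nat
    unfolding nat using FZ_subgroup by (metis F.group_axioms group.subgroup_int_pow_closed int_pow_int)
  then have "gbar g (- of_nat n) \<in> carrier (FZ G)" for n :: nat
    using subgroup.m_inv_closed[OF FZ_subgroup pos[of n]] assms by (simp add: inv_gbar)
  then show ?thesis using pos by (cases k) (auto simp flip: of_nat_Suc)
qed

lemma FZ_iff: "x \<in> carrier (FZ G) \<longleftrightarrow> x \<in> carrier (FR G) \<and> snd ` set x \<subseteq> \<int>"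
proof (intro iffI conjI)
  assume "x \<in> carrier (FR G) \<and> snd ` set x \<subseteq> \<int>"
  then have "x \<in> carrier (FR G)" "snd ` set x \<subseteq> \<int>" by auto
  then show "x \<in> carrier (FZ G)"
  proof (induction x)
    case Nil
    then show ?case using Z.one_closed by (simp add: FR_one)
  next
    case (Cons a w)
    obtain g r where a: "a = (g, r)" by (cases a)
    note C = Cons_eq_gbar_mult[OF Cons.prems(1)[unfolded a]]
    obtain k where "r = of_int k" using Cons.prems(2) a by (auto elim: Ints_cases)
    then have "gbar g r \<in> carrier (FZ G)" using gbar_in_FZ C(1) by simp
    moreover have "w \<in> carrier (FZ G)" using C Cons by simp
    ultimately show ?case unfolding a C(3) using Z.m_closed by force
  qed
qed (use FZ_subset FZ_letters in fastforce)+

lemma FZ_induct [consumes 1, case_names one mult]: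
  assumes "x \<in> carrier (FZ G)" and "P \<one>\<^bsub>FR G\<^esub>"
    and "\<And>g k w. g \<in> carrier G \<Longrightarrow> w \<in> carrier (FZ G) \<Longrightarrow> P w \<Longrightarrow> P (gbar g (of_int k) \<otimes>\<^bsub>FR G\<^esub> w)"
  shows "P x"
  using assms(1)
proof (induction x)
  case Nil
  then show ?case using assms(2) by (simp add: FR_one)
next
  case (Cons a w)
  obtain g r where a: "a = (g, r)" by (cases a)
  have FR: "(g, r) # w \<in> carrier (FR G)" and Z: "snd ` set ((g, r) # w) \<subseteq> \<int>"
    using Cons.prems a FZ_iff by auto
  note C = Cons_eq_gbar_mult[OF FR]
  obtain k where k: "r = of_int k" using Z by (auto elim: Ints_cases)
  have "snd ` set w \<subseteq> \<int>" using Z by auto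
  then have w: "w \<in> carrier (FZ G)" using C(2) FZ_iff by blast
  show ?case
    using assms(3)[OF C(1) w Cons.IH[OF w], of k] unfolding a C(3) k[symmetric] .
qed

lemma psi_in_FZ: "x \<in> carrier (FZ G) \<Longrightarrow> psi G (of_nat n) x \<in> carrier (FZ G)"
proof (induction rule: FZ_induct)
  case one
  then show ?case using Z.one_closed by (simp add: psi_one)
next
  case (mult g k w)
  have "gbar g (of_int (int n * k)) \<in> carrier (FZ G)" using mult.hyps by (intro gbar_in_FZ)
  then show ?case
    using mult Z.m_closed[of "gbar g (of_int (int n * k))" "psi G (of_nat n) w"] FZ_subset
    by (simp add: psi_mult gbar_in_FR psi_gbar)
qed

lemma pi_hom_closed: "x \<in> carrier (FZ G) \<Longrightarrow> pi_hom G x \<in> carrier G"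
  using pi_hom_hom[OF is_group] by (rule hom_in_carrier)

lemma pi_hom_mult: "x \<in> carrier (FZ G) \<Longrightarrow> y \<in> carrier (FZ G) \<Longrightarrow>
    pi_hom G (x \<otimes>\<^bsub>FR G\<^esub> y) = pi_hom G x \<otimes> pi_hom G y"
  using hom_mult[OF pi_hom_hom[OF is_group]] by simp

lemma pi_group_hom: "group_hom (FZ G) G (pi_hom G)"
  by (simp add: group_hom_def group_hom_axioms_def pi_hom_hom is_group Z.is_group)

lemma pi_hom_one: "pi_hom G \<one>\<^bsub>FR G\<^esub> = \<one>"
  using group_hom.hom_one[OF pi_group_hom] by simp

lemma pi_hom_inv: "x \<in> carrier (FZ G) \<Longrightarrow> pi_hom G (inv\<^bsub>FR G\<^esub> x) = inv pi_hom G x"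
  using group_hom.hom_inv[OF pi_group_hom, of x] by (simp add: FZ_inv)

lemma pi_hom_gbar_int: "g \<in> carrier G \<Longrightarrow> pi_hom G (gbar g (of_int k)) = g [^] k"
  by (simp add: pi_hom_def gbar_def fp_lift_def)

end

section \<open>The projection to the group does not increase norms\<close>

lemma append_Cons_eq_append_Cons:
  assumes "a @ y # b = u @ z # v"
  obtains "a = u" "y = z" "b = v"
  | x where "u = a @ y # x" "b = x @ z # v"
  | x where "a = u @ z # x" "v = x @ y # b"
  using assms by (auto simp: append_eq_append_conv2 Cons_eq_append_conv append_eq_Cons_conv)

lemma append_Cons2_eq_append_Cons:
  assumes "a @ y # y' # b = u @ z # v"
  obtains x where "u = a @ y # y' # x" "b = x @ z # v"
  | "a = u" "y = z" "v = y' # b"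
  | "u = a @ [y]" "y' = z" "b = v"
  | x where "a = u @ z # x" "v = x @ y # y' # b"
  using assms by (auto simp: append_eq_append_conv2 Cons_eq_append_conv append_eq_Cons_conv)

context conj_normed_group
begin

text \<open>
  The number \<open>c\<close> bounds the total price of the deletions in a reduction of the word to the empty one; the
  word need not be in normal form.  Both moves, read from the word to be reduced towards the empty
  one, keep integral exponents integral.
\<close>

inductive reduces :: "('a \<times> real) list \<Rightarrow> real \<Rightarrow> bool" where
  Nil: "0 \<le> c \<Longrightarrow> reduces [] c"
| merge: "reduces (u @ (g, r + s) # v) c \<Longrightarrow> reduces (u @ (g, r) # (g, s) # v) c"
| delete: "reduces (u @ v) c \<Longrightarrow> reduces (u @ (g, r) # v) (\<bar>r\<bar> * N g + c)"

lemma reduces_mono: "reduces w c \<Longrightarrow> c \<le> c' \<Longrightarrow> reduces w c'"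
proof (induction arbitrary: c' rule: reduces.induct)
  case (delete u v c g r)
  then show ?case using reduces.delete[of u v "c' - \<bar>r\<bar> * N g" g r] by simp
qed (auto intro: reduces.intros)

text \<open>
  The reduction of the perturbed word makes the same moves.  The change of the exponent is carried
  along by the merges and is paid for when the syllable that has absorbed it is deleted.
\<close>

lemma reduces_perturb:
  assumes "reduces w c" "w = u @ (g, s) # v" "g \<in> carrier G"
  shows "reduces (u @ (g, t) # v) (\<bar>t - s\<bar> * N g + c)"
  using assms(1,2)
proof (induction arbitrary: u s t v rule: reduces.induct)
  case (Nil c)
  then show ?case by simp
next
  case (merge a h p q b c)
  from merge.prems show ?case
  proof (cases rule: append_Cons2_eq_append_Cons)
    case (1 x)
    have "reduces ((a @ (h, p + q) # x) @ (g, t) # v) (\<bar>t - s\<bar> * N g + c)"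
      by (rule merge.IH) (simp add: 1)
    then show ?thesis using reduces.merge[of a h p q "x @ (g, t) # v"] by (simp add: 1)
  next
    case 2
    have "reduces (a @ (h, t + q) # b) (\<bar>t + q - (p + q)\<bar> * N g + c)"
      using merge.IH[of a "p + q" b "t + q"] 2 by simp
    then show ?thesis using reduces.merge[of a h t q b] 2 by simp
  next
    case 3
    have "reduces (a @ (h, p + t) # b) (\<bar>p + t - (p + q)\<bar> * N g + c)"
      using merge.IH[of a "p + q" b "p + t"] 3 by simp
    then show ?thesis using reduces.merge[of a h p t b] 3 by simp
  next
    case (4 x)
    have "reduces (u @ (g, t) # x @ (h, p + q) # b) (\<bar>t - s\<bar> * N g + c)"
      by (rule merge.IH) (simp add: 4)
    then show ?thesis using reduces.merge[of "u @ (g, t) # x" h p q b] by (simp add: 4)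
  qed
next
  case (delete a b c h r)
  from delete.prems show ?case
  proof (cases rule: append_Cons_eq_append_Cons)
    case 1
    have "\<bar>t\<bar> * N g \<le> \<bar>t - s\<bar> * N g + \<bar>s\<bar> * N g"
      using N.nonneg[OF assms(3)] by (simp flip: distrib_right add: mult_right_mono)
    then show ?thesis using reduces_mono[OF reduces.delete[OF delete.hyps, of g t]] 1 by simp
  next
    case (2 x)
    have "reduces ((a @ x) @ (g, t) # v) (\<bar>t - s\<bar> * N g + c)"
      by (rule delete.IH) (simp add: 2)
    then show ?thesis using reduces.delete[of a "x @ (g, t) # v" "\<bar>t - s\<bar> * N g + c" h r]
      by (simp add: 2 add.left_commute)
  next
    case (3 x)
    have "reduces (u @ (g, t) # x @ b) (\<bar>t - s\<bar> * N g + c)"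
      by (rule delete.IH) (simp add: 3)
    then show ?thesis using reduces.delete[of "u @ (g, t) # x" b "\<bar>t - s\<bar> * N g + c" h r]
      by (simp add: 3 add.left_commute)
  qed
qed

lemma reduces_remove_zero:
  assumes "reduces w c" "w = u @ (g, 0) # v"
  shows "reduces (u @ v) c"
  using assms
proof (induction arbitrary: u v rule: reduces.induct)
  case (Nil c)
  then show ?case by simp
next
  case (merge a h p q b c)
  from merge.prems show ?case
  proof (cases rule: append_Cons2_eq_append_Cons)
    case (1 x)
    have "reduces ((a @ (h, p + q) # x) @ v) c" by (rule merge.IH) (simp add: 1)
    then show ?thesis using reduces.merge[of a h p q "x @ v"] by (simp add: 1)
  next
    case 2
    then show ?thesis using merge.hyps by simp
  next
    case 3
    then show ?thesis using merge.hyps by simp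
  next
    case (4 x)
    have "reduces (u @ x @ (h, p + q) # b) c" by (rule merge.IH) (simp add: 4)
    then show ?thesis using reduces.merge[of "u @ x" h p q b] by (simp add: 4)
  qed
next
  case (delete a b c h r)
  from delete.prems show ?case
  proof (cases rule: append_Cons_eq_append_Cons)
    case 1
    then show ?thesis using delete.hyps by simp
  next
    case (2 x)
    have "reduces ((a @ x) @ v) c" by (rule delete.IH) (simp add: 2)
    then show ?thesis using reduces.delete[of a "x @ v" c h r] by (simp add: 2)
  next
    case (3 x)
    have "reduces (u @ x @ b) c" by (rule delete.IH) (simp add: 3)
    then show ?thesis using reduces.delete[of "u @ x" b c h r] by (simp add: 3)
  qed
qed

lemma append_Cons2_eq_append_Cons2:
  assumes "a @ y # y' # b = u @ z # z' # v"
  obtains x where "u = a @ y # y' # x" "b = x @ z # z' # v"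
  | "u = a @ [y]" "y' = z" "b = z' # v"
  | "a = u" "y = z" "y' = z'" "b = v"
  | "a = u @ [z]" "z' = y" "v = y' # b"
  | x where "a = u @ z # z' # x" "v = x @ y # y' # b"
  using assms by (auto simp: append_eq_append_conv2 Cons_eq_append_conv append_eq_Cons_conv)

lemma append_Cons_eq_append_Cons2:
  assumes "a @ y # b = u @ z # z' # v"
  obtains x where "u = a @ y # x" "b = x @ z # z' # v"
  | "a = u" "y = z" "b = z' # v"
  | "a = u @ [z]" "y = z'" "b = v"
  | x where "a = u @ z # z' # x" "v = x @ y # b"
  using assms by (auto simp: append_eq_append_conv2 Cons_eq_append_conv append_eq_Cons_conv)

text \<open>
  This inverts the rule \<open>merge\<close>.  A given reduction may first merge one of the two syllables with its
  other neighbour, which commutes with joining them, or delete one of them; in that case the deleted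
  exponent is instead added to the remaining syllable, at the same price.
\<close>

lemma reduces_join:
  assumes "reduces w c" "w = u @ (g, r) # (g, s) # v" "g \<in> carrier G"
  shows "reduces (u @ (g, r + s) # v) c"
  using assms(1,2)
proof (induction arbitrary: u r s v rule: reduces.induct)
  case (Nil c)
  then show ?case by simp
next
  case (merge a h p q b c)
  from merge.prems show ?case
  proof (cases rule: append_Cons2_eq_append_Cons2)
    case (1 x)
    have "reduces ((a @ (h, p + q) # x) @ (g, r + s) # v) c" by (rule merge.IH) (simp add: 1)
    then show ?thesis using reduces.merge[of a h p q "x @ (g, r + s) # v"] by (simp add: 1)
  next
    case 2
    have "reduces (a @ (g, p + q + s) # v) c" by (rule merge.IH) (use 2 in simp)
    then show ?thesis using reduces.merge[of a g p "r + s" v] 2 by (simp add: add.assoc)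
  next
    case 3
    then show ?thesis using merge.hyps by simp
  next
    case 4
    have "reduces (u @ (g, r + (p + q)) # b) c" by (rule merge.IH) (use 4 in simp)
    then show ?thesis using reduces.merge[of u g "r + s" q b] 4 by (simp add: add.assoc)
  next
    case (5 x)
    have "reduces (u @ (g, r + s) # x @ (h, p + q) # b) c" by (rule merge.IH) (simp add: 5)
    then show ?thesis using reduces.merge[of "u @ (g, r + s) # x" h p q b] by (simp add: 5)
  qed
next
  case (delete a b c h p)
  from delete.prems show ?case
  proof (cases rule: append_Cons_eq_append_Cons2)
    case (1 x)
    have "reduces ((a @ x) @ (g, r + s) # v) c" by (rule delete.IH) (simp add: 1)
    then show ?thesis using reduces.delete[of a "x @ (g, r + s) # v" c h p] by (simp add: 1)
  next
    case 2
    then show ?thesis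
      using reduces_perturb[OF delete.hyps, of u g s v "r + s"] assms(3) by simp
  next
    case 3
    then show ?thesis
      using reduces_perturb[OF delete.hyps, of u g r v "r + s"] assms(3) by simp
  next
    case (4 x)
    have "reduces (u @ (g, r + s) # x @ b) c" by (rule delete.IH) (simp add: 4)
    then show ?thesis using reduces.delete[of "u @ (g, r + s) # x" b c h p] by (simp add: 4)
  qed
qed

lemma reduces_insert:
  assumes "reduces x c" "reduces (u @ v) d" shows "reduces (u @ x @ v) (c + d)"
  using assms
proof (induction rule: reduces.induct)
  case (Nil c)
  then show ?case by (auto intro: reduces_mono)
next
  case (merge a g r s b c)
  then show ?case using reduces.merge[of "u @ a" g r s "b @ v"] by simp
next
  case (delete a b c g r)
  then show ?case using reduces.delete[of "u @ a" "b @ v" _ g r] by (simp add: add.assoc)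
qed

definition inv_word :: "('a \<times> real) list \<Rightarrow> ('a \<times> real) list" where
  "inv_word w = rev (map (\<lambda>(g, r). (g, - r)) w)"

lemma reduces_inv_word: "reduces (w @ inv_word w) 0"
proof (induction w)
  case Nil
  show ?case by (simp add: inv_word_def reduces.Nil)
next
  case (Cons a w)
  obtain g r where a: "a = (g, r)" by (cases a)
  have "reduces ([] @ [(g, r + - r)]) 0"
    using reduces.delete[of "[]" "[]" 0 g 0] reduces.Nil[OF order_refl] by simp
  then have "reduces ([(g, r)] @ [(g, - r)]) 0" using reduces.merge[of "[]" g r "- r" "[]" 0] by simp
  from reduces_insert[OF Cons.IH this] show ?case by (simp add: a inv_word_def)
qed

lemma reduces_fp_cons:
  assumes "reduces (u @ (g, r) # w) c" "g \<in> carrier G"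
  shows "reduces (u @ fp_cons (g, r) w) c"
proof (cases "r = 0")
  case True
  then show ?thesis using reduces_remove_zero[OF assms(1), of u g w] by simp
next
  case False
  show ?thesis
  proof (cases "\<exists>s w'. w = (g, s) # w'")
    case True
    then obtain s w' where w: "w = (g, s) # w'" by blast
    have j: "reduces (u @ (g, r + s) # w') c"
      using reduces_join[OF assms(1), of u g r s w'] assms(2) by (simp add: w)
    then show ?thesis using False reduces_remove_zero[OF j, of u g w'] by (simp add: w)
  next
    case none: False
    then have "fp_cons (g, r) w = (g, r) # w"
      using False by (cases "((g, r), w)" rule: fp_cons.cases) auto
    then show ?thesis using assms(1) by simp
  qed
qed

text \<open>
  Normal forms are computed by joining syllables and removing zeros.
\<close>

lemma reduces_normal_form:
  assumes "reduces (u @ w) c" "fst ` set w \<subseteq> carrier G"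
  shows "reduces (u @ foldr fp_cons w []) c"
  using assms
proof (induction w arbitrary: u)
  case (Cons a w)
  obtain g r where a: "a = (g, r)" by (cases a)
  have "reduces ((u @ [a]) @ foldr fp_cons w []) c" using Cons.prems by (intro Cons.IH) auto
  then show ?case using reduces_fp_cons[of u g r "foldr fp_cons w []" c] Cons.prems a by simp
qed simp

lemma FR_mult: "x \<otimes>\<^bsub>FR G\<^esub> y = foldr fp_cons x y"
  by (simp add: FR_def)

lemma gbar_mult: "gbar g r \<otimes>\<^bsub>FR G\<^esub> w = fp_cons (g, r) w"
  by (simp add: FR_mult gbar_def)

lemma inv_word_mult:
  assumes "h \<in> carrier (FR G)" "x \<in> carrier (FR G)"
  shows "foldr fp_cons (inv_word h) x = inv\<^bsub>FR G\<^esub> h \<otimes>\<^bsub>FR G\<^esub> x"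
  using assms
proof (induction h arbitrary: x)
  case Nil
  then have "inv\<^bsub>FR G\<^esub> [] = []" using F.inv_one by (simp add: FR_one)
  then show ?case by (simp add: inv_word_def FR_mult)
next
  case (Cons a h)
  obtain g r where a: "a = (g, r)" by (cases a)
  note C = Cons_eq_gbar_mult[OF Cons.prems(1)[unfolded a]]
  have "foldr fp_cons (inv_word (a # h)) x = foldr fp_cons (inv_word h) (gbar g (- r) \<otimes>\<^bsub>FR G\<^esub> x)"
    by (simp add: a inv_word_def gbar_mult)
  also have "\<dots> = inv\<^bsub>FR G\<^esub> h \<otimes>\<^bsub>FR G\<^esub> (gbar g (- r) \<otimes>\<^bsub>FR G\<^esub> x)"
    using C Cons.prems by (intro Cons.IH) (auto simp: gbar_in_FR)
  also have "\<dots> = inv\<^bsub>FR G\<^esub> (gbar g r \<otimes>\<^bsub>FR G\<^esub> h) \<otimes>\<^bsub>FR G\<^esub> x"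
    using C Cons.prems by (simp add: F.inv_mult_group F.m_assoc gbar_in_FR inv_gbar)
  finally show ?case unfolding a C(3) .
qed

lemma FR_letters: "x \<in> carrier (FR G) \<Longrightarrow> fst ` set x \<subseteq> carrier G"
  by (auto simp: FR_def fp_reduced_def)

text \<open>
  Each conjugate \<open>h (g, r) h\<inverse>\<close> reduces by deleting its middle syllable, since \<open>h h\<inverse>\<close> then vanishes
  free of charge.
\<close>

lemma conj_cost_imp_reduces: "conj_cost x c \<Longrightarrow> reduces x c"
proof (induction rule: conj_cost.induct)
  case one
  show ?case by (simp add: FR_one reduces.Nil)
next
  case (mult x c h g r)
  have x: "x \<in> carrier (FR G)" using mult.hyps conj_cost_carrier by blast
  let ?w = "h @ (g, r) # inv_word h @ x"
  have "reduces (h @ inv_word h @ x) c"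
    using reduces_insert[OF reduces_inv_word[of h], of "[]" x c] mult.IH by simp
  then have "reduces ([] @ ?w) (\<bar>r\<bar> * N g + c)"
    using reduces.delete[of h "inv_word h @ x" c g r] by simp
  then have "reduces ([] @ foldr fp_cons ?w []) (\<bar>r\<bar> * N g + c)"
    using FR_letters[OF mult.hyps(2)] FR_letters[OF x] mult.hyps(3)
    by (intro reduces_normal_form) (force simp: inv_word_def)+
  moreover have "foldr fp_cons ?w [] = h \<otimes>\<^bsub>FR G\<^esub> (gbar g r \<otimes>\<^bsub>FR G\<^esub> (inv\<^bsub>FR G\<^esub> h \<otimes>\<^bsub>FR G\<^esub> x))"
  proof -
    have "foldr fp_cons x [] = x" using F.r_one[OF x] by (simp add: FR_mult FR_one)
    then show ?thesis using inv_word_mult[OF mult.hyps(2) x] by (simp add: FR_mult gbar_def)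
  qed
  ultimately show ?case using x mult.hyps by (simp add: F.m_assoc gbar_in_FR)
qed

lemma norm_int_pow_le:
  assumes "g \<in> carrier G" shows "N (g [^] (k::int)) \<le> \<bar>of_int k\<bar> * N g"
proof -
  have nat: "N (g [^] (n::nat)) \<le> of_nat n * N g" for n
  proof (induction n)
    case (Suc n)
    then show ?case using N.triangle[of "g [^] n" g] assms by (simp add: distrib_right)
  qed (simp add: N.norm_one)
  show ?thesis
  proof (cases k rule: int_cases2)
    case (nonneg n)
    then show ?thesis using nat[of n] by (simp add: int_pow_int)
  next
    case (nonpos n)
    then show ?thesis using nat[of n] assms by (simp add: int_pow_neg int_pow_int N.norm_inv)
  qed
qed

lemma pi_hom_append:
  assumes "fst ` set u \<subseteq> carrier G" "fst ` set v \<subseteq> carrier G"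
  shows "pi_hom G v \<in> carrier G" "pi_hom G (u @ v) = pi_hom G u \<otimes> pi_hom G v"
proof -
  have cl: "pi_hom G w \<in> carrier G" if "fst ` set w \<subseteq> carrier G" for w
    using that by (induction w) (auto simp: pi_hom_def fp_lift_def)
  show "pi_hom G v \<in> carrier G" using cl assms by blast
  have C: "pi_hom G ((g, r) # w) = g [^] \<lfloor>r\<rfloor> \<otimes> pi_hom G w" for g r w
    by (simp add: pi_hom_def fp_lift_def)
  show "pi_hom G (u @ v) = pi_hom G u \<otimes> pi_hom G v"
    using assms(1)
  proof (induction u)
    case Nil
    then show ?case using cl[OF assms(2)] by (simp add: pi_hom_def fp_lift_def)
  next
    case (Cons a u)
    then show ?case using cl[OF assms(2)] cl[of u] by (cases a) (simp add: C m_assoc)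
  qed
qed

text \<open>
  A merge of integral syllables does not change the image in \<open>G\<close>, and removing a factor \<open>g [^] k\<close> from
  a product changes its norm by at most \<open>\<bar>k\<bar> * N g\<close>, by conjugation invariance.
\<close>

lemma norm_pi_hom_le_reduces:
  assumes "reduces w c" "set w \<subseteq> carrier G \<times> \<int>"
  shows "N (pi_hom G w) \<le> c"
  using assms
proof (induction rule: reduces.induct)
  case (Nil c)
  then show ?case by (simp add: pi_hom_def fp_lift_def N.norm_one)
next
  case (merge u g r s v c)
  have *: "fst ` set u \<subseteq> carrier G" "fst ` set v \<subseteq> carrier G" "g \<in> carrier G" using merge.prems by auto
  obtain k l where "r = of_int k" "s = of_int l" using merge.prems by (auto elim!: Ints_cases)
  then have "pi_hom G ((g, r) # (g, s) # v) = pi_hom G ((g, r + s) # v)"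
    using * pi_hom_append(1)[of "[]" v]
    by (simp add: pi_hom_def fp_lift_def m_assoc[symmetric] int_pow_mult flip: of_int_add)
  then have "pi_hom G (u @ (g, r) # (g, s) # v) = pi_hom G (u @ (g, r + s) # v)"
    using * by (simp add: pi_hom_append)
  then show ?case using merge.IH merge.prems by simp
next
  case (delete u v c g r)
  have *: "fst ` set u \<subseteq> carrier G" "fst ` set v \<subseteq> carrier G" "g \<in> carrier G" using delete.prems by auto
  let ?u = "pi_hom G u" and ?v = "pi_hom G v"
  have uv: "?u \<in> carrier G" "?v \<in> carrier G" using * pi_hom_append(1)[of "[]"] by auto
  obtain k where k: "r = of_int k" using delete.prems by (auto elim!: Ints_cases)
  have "pi_hom G (u @ (g, r) # v) = ?u \<otimes> (g [^] k \<otimes> ?v)"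
    using * pi_hom_append(2)[of u "(g, r) # v"] by (simp add: k) (simp add: pi_hom_def fp_lift_def)
  also have "\<dots> = (?u \<otimes> g [^] k \<otimes> inv ?u) \<otimes> (?u \<otimes> ?v)"
  proof -
    have "inv ?u \<otimes> (?u \<otimes> ?v) = ?v" using uv m_assoc[of "inv ?u" ?u ?v] by simp
    then show ?thesis using uv * by (simp add: m_assoc)
  qed
  also have "N \<dots> \<le> N (?u \<otimes> g [^] k \<otimes> inv ?u) + N (?u \<otimes> ?v)"
    using uv * by (intro N.triangle) auto
  also have "N (?u \<otimes> g [^] k \<otimes> inv ?u) = N (g [^] k)" using uv * by (intro N.conj) auto
  also have "\<dots> \<le> \<bar>r\<bar> * N g" using norm_int_pow_le[OF *(3)] by (simp add: k)
  also have "N (?u \<otimes> ?v) \<le> c" using delete * by (simp add: pi_hom_append)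
  finally show ?case by simp
qed

theorem norm_pi_hom_le:
  assumes "x \<in> carrier (FZ G)" shows "N (pi_hom G x) \<le> FR_norm G N x"
  using FZ_subset[OF assms] FZ_letters[OF assms]
  by (intro FR_norm_greatest norm_pi_hom_le_reduces conj_cost_imp_reduces)

end

section \<open>Powers of products in nilpotent groups\<close>

definition commutator :: "('a, 'b) monoid_scheme \<Rightarrow> 'a \<Rightarrow> 'a \<Rightarrow> 'a" where
  "commutator G x y = x \<otimes>\<^bsub>G\<^esub> y \<otimes>\<^bsub>G\<^esub> inv\<^bsub>G\<^esub> x \<otimes>\<^bsub>G\<^esub> inv\<^bsub>G\<^esub> y"

lemma lower_central_Suc:
  "lower_central G (Suc k) = generate G {commutator G x y | x y. x \<in> lower_central G k \<and> y \<in> carrier G}"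
proof -
  have "(\<Union>x\<in>lower_central G k. \<Union>y\<in>carrier G. {x \<otimes>\<^bsub>G\<^esub> y \<otimes>\<^bsub>G\<^esub> inv\<^bsub>G\<^esub> x \<otimes>\<^bsub>G\<^esub> inv\<^bsub>G\<^esub> y})
      = {commutator G x y | x y. x \<in> lower_central G k \<and> y \<in> carrier G}"
    unfolding commutator_def by blast
  then show ?thesis by simp
qed

(* lower_central_Suc, with commutators in place of the four-fold products, is used instead. *)
declare lower_central.simps(2) [simp del]

context group
begin

lemma commutator_closed [simp]:
  "x \<in> carrier G \<Longrightarrow> y \<in> carrier G \<Longrightarrow> commutator G x y \<in> carrier G"
  by (simp add: commutator_def)

lemma inv_mult_cancel: "x \<in> carrier G \<Longrightarrow> y \<in> carrier G \<Longrightarrow> inv x \<otimes> (x \<otimes> y) = y"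
  by (simp add: m_assoc[symmetric])

lemma mult_inv_cancel: "x \<in> carrier G \<Longrightarrow> y \<in> carrier G \<Longrightarrow> x \<otimes> (inv x \<otimes> y) = y"
  by (simp add: m_assoc[symmetric])

lemma commutator_mult_eq:
  assumes "x \<in> carrier G" "y \<in> carrier G" shows "commutator G x y \<otimes> (y \<otimes> x) = x \<otimes> y"
  using assms by (simp add: commutator_def m_assoc inv_mult_cancel)

lemma conj_commutator:
  assumes "g \<in> carrier G" "x \<in> carrier G" "y \<in> carrier G"
  shows "g \<otimes> commutator G x y \<otimes> inv g = commutator G (g \<otimes> x \<otimes> inv g) (g \<otimes> y \<otimes> inv g)"
  using assms by (simp add: commutator_def m_assoc inv_mult_group inv_mult_cancel)

lemma commutator_mult_left:
  assumes "x \<in> carrier G" "x' \<in> carrier G" "g \<in> carrier G"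
  shows "commutator G (x \<otimes> x') g = x \<otimes> commutator G x' g \<otimes> inv x \<otimes> commutator G x g"
  using assms by (simp add: commutator_def m_assoc inv_mult_group inv_mult_cancel)

lemma commutator_mult_right:
  assumes "x \<in> carrier G" "g \<in> carrier G" "h \<in> carrier G"
  shows "commutator G x (g \<otimes> h) = commutator G x g \<otimes> (g \<otimes> commutator G x h \<otimes> inv g)"
  using assms by (simp add: commutator_def m_assoc inv_mult_group inv_mult_cancel)

lemma lower_central_normal: "lower_central G k \<lhd> G"
proof (induction k)
  case 0
  show ?case by (simp add: normal_inv_iff subgroup_self)
next
  case (Suc k)
  then interpret L: normal "lower_central G k" G .
  show ?case
    unfolding lower_central_Suc
  proof (rule normal_generateI)
    show "{commutator G x y |x y. x \<in> lower_central G k \<and> y \<in> carrier G} \<subseteq> carrier G"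
      using L.subset by auto
    fix h g assume h: "h \<in> {commutator G x y |x y. x \<in> lower_central G k \<and> y \<in> carrier G}" and g: "g \<in> carrier G"
    then obtain x y where xy: "h = commutator G x y" "x \<in> lower_central G k" "y \<in> carrier G" by blast
    have "x \<in> carrier G" using xy(2) L.mem_carrier by simp
    then have "g \<otimes> h \<otimes> inv g = commutator G (g \<otimes> x \<otimes> inv g) (g \<otimes> y \<otimes> inv g)"
      using xy g conj_commutator by simp
    moreover have "g \<otimes> x \<otimes> inv g \<in> lower_central G k" using L.inv_op_closed2[OF g xy(2)] .
    moreover have "g \<otimes> y \<otimes> inv g \<in> carrier G" using g xy by simp
    ultimately show "g \<otimes> h \<otimes> inv g \<in> {commutator G x y |x y. x \<in> lower_central G k \<and> y \<in> carrier G}"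
      by blast
  qed
qed

lemma lower_central_subset: "lower_central G k \<subseteq> carrier G"
  using lower_central_normal normal_imp_subgroup subgroup.subset by blast

lemma commutator_in_lower_central:
  "x \<in> lower_central G k \<Longrightarrow> y \<in> carrier G \<Longrightarrow> commutator G x y \<in> lower_central G (Suc k)"
  unfolding lower_central_Suc by (rule generate.incl) blast

lemma lower_central_decreasing: "lower_central G (Suc k) \<subseteq> lower_central G k"
  unfolding lower_central_Suc
proof (rule generate_subgroup_incl)
  interpret L: normal "lower_central G k" G by (rule lower_central_normal)
  show "subgroup (lower_central G k) G" by (rule L.subgroup_axioms)
  show "{commutator G x y |x y. x \<in> lower_central G k \<and> y \<in> carrier G} \<subseteq> lower_central G k"
  proof clarify
    fix x y assume x: "x \<in> lower_central G k" and y: "y \<in> carrier G"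
    then have "y \<otimes> inv x \<otimes> inv y \<in> lower_central G k" by (intro L.inv_op_closed2 L.m_inv_closed)
    then have "x \<otimes> (y \<otimes> inv x \<otimes> inv y) \<in> lower_central G k" by (rule L.m_closed[OF x])
    moreover have "commutator G x y = x \<otimes> (y \<otimes> inv x \<otimes> inv y)"
      using L.mem_carrier[OF x] y by (simp add: commutator_def m_assoc)
    ultimately show "commutator G x y \<in> lower_central G k" by simp
  qed
qed

text \<open>
  When the commutators of \<open>X\<close> with the group are central, \<open>[x, g]\<close> is multiplicative in both
  entries.  Writing \<open>g\<close> as a word in \<open>a\<close> and \<open>b\<close> turns \<open>[x, g]\<close> into a product of commutators with
  \<open>a\<close> and \<open>b\<close>, and those with the same generator combine into a single one.
\<close>

lemma generate_central_commutators:
  assumes X: "subgroup X G"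
    and cent: "\<And>x g h. x \<in> X \<Longrightarrow> g \<in> carrier G \<Longrightarrow> h \<in> carrier G \<Longrightarrow>
      commutator G x g \<otimes> h = h \<otimes> commutator G x g"
    and ab: "a \<in> carrier G" "b \<in> carrier G" and gen: "carrier G = generate G {a, b}"
    and z: "z \<in> generate G {commutator G x g | x g. x \<in> X \<and> g \<in> carrier G}"
  shows "\<exists>x\<in>X. \<exists>y\<in>X. z = commutator G x a \<otimes> commutator G y b"
proof -
  interpret X: subgroup X G by (rule X)
  let ?M = "{commutator G x a \<otimes> commutator G y b | x y. x \<in> X \<and> y \<in> X}"
  have Xc: "x \<in> carrier G" if "x \<in> X" for x using that by (rule X.mem_carrier)
  have conj: "g \<otimes> commutator G x h \<otimes> inv g = commutator G x h"
    if "x \<in> X" "g \<in> carrier G" "h \<in> carrier G" for x g h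
  proof -
    have "g \<otimes> commutator G x h \<otimes> inv g = commutator G x h \<otimes> g \<otimes> inv g"
      by (simp only: cent[OF that(1,3,2)])
    then show ?thesis using that Xc by (simp add: m_assoc)
  qed
  have left: "commutator G (x \<otimes> y) g = commutator G x g \<otimes> commutator G y g"
    if "x \<in> X" "y \<in> X" "g \<in> carrier G" for x y g
  proof -
    have "commutator G (x \<otimes> y) g = commutator G y g \<otimes> commutator G x g"
      unfolding commutator_mult_left[OF Xc[OF that(1)] Xc[OF that(2)] that(3)]
      by (simp only: conj[OF that(2) Xc[OF that(1)] that(3)])
    also have "\<dots> = commutator G x g \<otimes> commutator G y g"
      using that Xc by (intro cent) auto
    finally show ?thesis .
  qed
  have right: "commutator G x (g \<otimes> h) = commutator G x g \<otimes> commutator G x h"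
    if "x \<in> X" "g \<in> carrier G" "h \<in> carrier G" for x g h
    unfolding commutator_mult_right[OF Xc[OF that(1)] that(2,3)] conj[OF that] ..
  have comm_one: "commutator G \<one> g = \<one>" "commutator G g \<one> = \<one>" if "g \<in> carrier G" for g
    using that by (simp_all add: commutator_def)
  have comm_inv: "commutator G (inv x) g = inv commutator G x g" if "x \<in> X" "g \<in> carrier G" for x g
  proof -
    have "commutator G (inv x) g \<otimes> commutator G x g = \<one>"
      using left[of "inv x" x g] that X.mem_carrier comm_one(1) by simp
    then show ?thesis using that X.mem_carrier by (intro inv_equality[symmetric]) auto
  qed
  have inv_right: "commutator G x (inv g) = commutator G (inv x) g" if "x \<in> X" "g \<in> carrier G" for x g
  proof -
    have "commutator G x (inv g) \<otimes> commutator G x g = \<one>"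
      using right[of x "inv g" g] that X.mem_carrier comm_one(2) by simp
    then show ?thesis using that X.mem_carrier unfolding comm_inv[OF that] by (intro inv_equality[symmetric]) auto
  qed
  have M_mult: "u \<otimes> v \<in> ?M" if u: "u \<in> ?M" and v: "v \<in> ?M" for u v
  proof -
    obtain x y where xy: "x \<in> X" "y \<in> X" "u = commutator G x a \<otimes> commutator G y b" using u by blast
    obtain x' y' where xy': "x' \<in> X" "y' \<in> X" "v = commutator G x' a \<otimes> commutator G y' b" using v by blast
    have C: "commutator G p q \<in> carrier G" if "p \<in> X" "q \<in> carrier G" for p q
      using that X.mem_carrier by simp
    have "u \<otimes> v = commutator G x a \<otimes> (commutator G y b \<otimes> commutator G x' a) \<otimes> commutator G y' b"
      unfolding xy(3) xy'(3) using C xy(1,2) xy'(1,2) ab by (simp add: m_assoc)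
    also have "commutator G y b \<otimes> commutator G x' a = commutator G x' a \<otimes> commutator G y b"
      using C xy xy' ab by (intro cent)
    also have "commutator G x a \<otimes> (commutator G x' a \<otimes> commutator G y b) \<otimes> commutator G y' b
        = commutator G (x \<otimes> x') a \<otimes> commutator G (y \<otimes> y') b"
      using C xy(1,2) xy'(1,2) ab by (simp add: left m_assoc)
    finally show ?thesis using X.m_closed xy(1,2) xy'(1,2) by blast
  qed
  have in_a: "commutator G x a \<in> ?M" and in_b: "commutator G x b \<in> ?M" if "x \<in> X" for x
  proof -
    have "commutator G x a = commutator G x a \<otimes> commutator G \<one> b"
      "commutator G x b = commutator G \<one> a \<otimes> commutator G x b"
      using that X.mem_carrier ab comm_one by simp_all
    then show "commutator G x a \<in> ?M" "commutator G x b \<in> ?M" using that X.one_closed by blast+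
  qed
  have M_one: "\<one> \<in> ?M" using in_a[OF X.one_closed] comm_one(1)[OF ab(1)] by simp
  have gens: "commutator G x g \<in> ?M" if x: "x \<in> X" and g: "g \<in> generate G {a, b}" for x g
    using g x
  proof (induction arbitrary: x rule: generate.induct)
    case one
    then show ?case using M_one comm_one(2) X.mem_carrier by simp
  next
    case (incl h)
    then show ?case using in_a in_b by blast
  next
    case (inv h)
    then have "commutator G (inv x) h \<in> ?M" using in_a in_b X.m_inv_closed by blast
    moreover have "commutator G x (inv h) = commutator G (inv x) h" using inv ab by (intro inv_right) auto
    ultimately show ?case by (simp only:)
  next
    case (eng g h)
    then have "commutator G x (g \<otimes> h) = commutator G x g \<otimes> commutator G x h"
      using gen by (intro right) auto
    then show ?case using M_mult[OF eng.IH(1)[OF eng.prems] eng.IH(2)[OF eng.prems]] by simp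
  qed
  have "z \<in> ?M"
    using z
  proof (induction rule: generate.induct)
    case one
    show ?case by (rule M_one)
  next
    case (incl h)
    then show ?case using gens gen by blast
  next
    case (inv h)
    then obtain x g where "h = commutator G x g" "x \<in> X" "g \<in> generate G {a, b}" using gen by blast
    then show ?case using gens[of "inv x" g] gen by (simp add: comm_inv)
  next
    case (eng g h)
    then show ?case using M_mult by blast
  qed
  then show ?thesis by blast
qed

lemma group_hom_quotient: "H \<lhd> G \<Longrightarrow> group_hom G (G Mod H) (\<lambda>x. H #> x)"
  by (simp add: group_hom_def group_hom_axioms_def normal.factorgroup_is_group normal.r_coset_hom_Mod is_group)

lemma inv_mult_eq_one_iff:
  assumes "u \<in> carrier G" "v \<in> carrier G" shows "inv u \<otimes> v = \<one> \<longleftrightarrow> u = v"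
proof
  assume "inv u \<otimes> v = \<one>"
  then show "u = v" using mult_inv_cancel[OF assms] assms by simp
qed (use assms in simp)

lemma coset_eq_iff:
  assumes "H \<lhd> G" "x \<in> carrier G" "y \<in> carrier G"
  shows "H #> x = H #> y \<longleftrightarrow> inv x \<otimes> y \<in> H"
proof -
  interpret normal H G by (rule assms)
  interpret q: group_hom G "G Mod H" "\<lambda>x. H #> x" by (rule group_hom_quotient[OF assms(1)])
  have "H #> z = H \<longleftrightarrow> z \<in> H" if "z \<in> carrier G" for z
    using rcos_self[OF that subgroup_axioms] coset_join2[OF that subgroup_axioms] by auto
  moreover have "inv x \<otimes> y \<in> carrier G" using assms(2,3) by simp
  ultimately have "inv x \<otimes> y \<in> H \<longleftrightarrow> H #> (inv x \<otimes> y) = \<one>\<^bsub>G Mod H\<^esub>"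
    unfolding one_FactGroup by blast
  also have "H #> (inv x \<otimes> y) = inv\<^bsub>G Mod H\<^esub> (H #> x) \<otimes>\<^bsub>G Mod H\<^esub> (H #> y)"
    using assms by (simp only: q.hom_mult q.hom_inv inv_closed)
  also have "\<dots> = \<one>\<^bsub>G Mod H\<^esub> \<longleftrightarrow> H #> x = H #> y"
    by (rule q.H.inv_mult_eq_one_iff[OF q.hom_closed[OF assms(2)] q.hom_closed[OF assms(3)]])
  finally show ?thesis by blast
qed

text \<open>
  In the quotient by the term of index \<open>k + 2\<close>, the commutators of the image of the term of index \<open>k\<close>
  are central.
\<close>

lemma lower_central_Suc_decompose:
  assumes ab: "a \<in> carrier G" "b \<in> carrier G" and gen: "carrier G = generate G {a, b}"
    and z: "z \<in> lower_central G (Suc k)"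
  shows "\<exists>x\<in>carrier G. \<exists>y\<in>carrier G. \<exists>e\<in>lower_central G (Suc (Suc k)).
    z = commutator G x a \<otimes> commutator G y b \<otimes> e"
proof -
  let ?E = "lower_central G (Suc (Suc k))" and ?L = "lower_central G k"
  let ?q = "\<lambda>x. ?E #> x"
  have E: "?E \<lhd> G" by (rule lower_central_normal)
  interpret q: group_hom G "G Mod ?E" ?q by (rule group_hom_quotient[OF E])
  have qcomm: "?q (commutator G x y) = commutator (G Mod ?E) (?q x) (?q y)"
    if "x \<in> carrier G" "y \<in> carrier G" for x y
    unfolding commutator_def using that by (simp only: q.hom_mult q.hom_inv m_closed inv_closed)
  have onto: "\<exists>x\<in>carrier G. X = ?q x" if "X \<in> carrier (G Mod ?E)" for X
    using that unfolding carrier_FactGroup by blast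
  have L: "x \<in> carrier G" if "x \<in> ?L" for x using that lower_central_subset by blast
  have S: "{commutator G x y | x y. x \<in> ?L \<and> y \<in> carrier G} \<subseteq> carrier G" using L by auto
  have "\<exists>X\<in>?q ` ?L. \<exists>Y\<in>?q ` ?L. ?q z = commutator (G Mod ?E) X (?q a) \<otimes>\<^bsub>G Mod ?E\<^esub> commutator (G Mod ?E) Y (?q b)"
  proof (rule q.H.generate_central_commutators)
    show "subgroup (?q ` ?L) (G Mod ?E)"
      using lower_central_normal by (intro q.subgroup_img_is_subgroup normal_imp_subgroup)
    show "?q a \<in> carrier (G Mod ?E)" "?q b \<in> carrier (G Mod ?E)" using ab q.hom_closed by blast+
    show "carrier (G Mod ?E) = generate (G Mod ?E) {?q a, ?q b}"
    proof -
      have "generate (G Mod ?E) (?q ` {a, b}) = ?q ` generate G {a, b}"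
        by (rule q.generate_img) (use ab in blast)
      then show ?thesis unfolding gen[symmetric] carrier_FactGroup image_insert image_empty by (rule sym)
    qed
    have "?q z \<in> ?q ` generate G {commutator G x y | x y. x \<in> ?L \<and> y \<in> carrier G}"
      using z unfolding lower_central_Suc[of G k] by (rule imageI)
    also have "\<dots> = generate (G Mod ?E) (?q ` {commutator G x y | x y. x \<in> ?L \<and> y \<in> carrier G})"
      by (rule q.generate_img[OF S, symmetric])
    also have "\<dots> \<subseteq> generate (G Mod ?E) {commutator (G Mod ?E) X Y | X Y. X \<in> ?q ` ?L \<and> Y \<in> carrier (G Mod ?E)}"
    proof (rule q.H.mono_generate, rule subsetI)
      fix U assume "U \<in> ?q ` {commutator G x y | x y. x \<in> ?L \<and> y \<in> carrier G}"
      then obtain x y where xy: "U = ?q (commutator G x y)" "x \<in> ?L" "y \<in> carrier G" by blast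
      then show "U \<in> {commutator (G Mod ?E) X Y | X Y. X \<in> ?q ` ?L \<and> Y \<in> carrier (G Mod ?E)}"
        unfolding xy(1) qcomm[OF L[OF xy(2)] xy(3)]
        by (intro CollectI exI[of _ "?q x"] exI[of _ "?q y"] conjI refl imageI xy(2) q.hom_closed xy(3))
    qed
    finally show "?q z \<in> generate (G Mod ?E) {commutator (G Mod ?E) X Y | X Y. X \<in> ?q ` ?L \<and> Y \<in> carrier (G Mod ?E)}" .
    fix X g h assume X: "X \<in> ?q ` ?L" and gc: "g \<in> carrier (G Mod ?E)" and hc: "h \<in> carrier (G Mod ?E)"
    obtain x where x: "x \<in> ?L" "X = ?q x" using X by (elim imageE)
    obtain g' where g: "g' \<in> carrier G" "g = ?q g'" using onto[OF gc] by (elim bexE)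
    obtain h' where h: "h' \<in> carrier G" "h = ?q h'" using onto[OF hc] by (elim bexE)
    let ?c = "commutator G x g'"
    have c: "?c \<in> carrier G" using L x g by simp
    have "commutator G ?c h' \<in> ?E"
      using x g h by (intro commutator_in_lower_central)
    then have "?q (commutator G ?c h') = \<one>\<^bsub>G Mod ?E\<^esub>"
      using coset_join2[of "commutator G ?c h'" ?E] E c h by (simp add: normal_imp_subgroup)
    then have "?q (commutator G ?c h' \<otimes> (h' \<otimes> ?c)) = ?q (h' \<otimes> ?c)"
      using c h by (simp only: q.hom_mult commutator_closed m_closed q.hom_closed q.H.m_closed q.H.l_one)
    then have "?q (?c \<otimes> h') = ?q (h' \<otimes> ?c)" using commutator_mult_eq[OF c h(1)] by simp
    then show "commutator (G Mod ?E) X g \<otimes>\<^bsub>G Mod ?E\<^esub> h = h \<otimes>\<^bsub>G Mod ?E\<^esub> commutator (G Mod ?E) X g"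
      unfolding x(2) g(2) h(2) qcomm[OF L[OF x(1)] g(1), symmetric]
      using c h by (simp only: q.hom_mult)
  qed
  then obtain x y where xy: "x \<in> ?L" "y \<in> ?L"
    "?q z = commutator (G Mod ?E) (?q x) (?q a) \<otimes>\<^bsub>G Mod ?E\<^esub> commutator (G Mod ?E) (?q y) (?q b)"
    by blast
  let ?w = "commutator G x a \<otimes> commutator G y b"
  have w: "?w \<in> carrier G" using L xy ab by simp
  have zc: "z \<in> carrier G" using z lower_central_subset by blast
  have "?q ?w = ?q z"
    using L xy ab by (simp only: xy(3) qcomm q.hom_mult commutator_closed)
  then have "inv ?w \<otimes> z \<in> ?E" using coset_eq_iff[OF E w zc] by simp
  moreover have "z = ?w \<otimes> (inv ?w \<otimes> z)" using w zc by (simp add: mult_inv_cancel)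
  ultimately show ?thesis using L xy(1,2) by blast
qed

end

context pseudonormed_group
begin

text \<open>
  Descending induction along the lower central series: modulo the next term, every element of a
  term is a product of just two commutators with the generators, and conjugation invariance bounds
  these.
\<close>

lemma lower_central_bounded:
  assumes ab: "a \<in> carrier G" "b \<in> carrier G" and gen: "carrier G = generate G {a, b}"
    and nil: "lower_central G n = {\<one>}"
  shows "\<exists>K. \<forall>z\<in>lower_central G (Suc 0). p z \<le> K"
proof -
  have "\<exists>K. \<forall>z\<in>lower_central G (Suc k). p z \<le> K" if "k \<le> n" for k
    using that
  proof (induction k rule: inc_induct)
    case base
    have "lower_central G (Suc n) \<subseteq> {\<one>}" using lower_central_decreasing[of n] nil by simp
    then have "\<forall>z\<in>lower_central G (Suc n). p z \<le> 0" using norm_one by fastforce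
    then show ?case by blast
  next
    case (step k)
    then obtain K where K: "\<And>z. z \<in> lower_central G (Suc (Suc k)) \<Longrightarrow> p z \<le> K" by blast
    have "p z \<le> 2 * p a + 2 * p b + K" if "z \<in> lower_central G (Suc k)" for z
    proof -
      obtain x y e where x: "x \<in> carrier G" and y: "y \<in> carrier G" and e: "e \<in> lower_central G (Suc (Suc k))"
        and z: "z = commutator G x a \<otimes> commutator G y b \<otimes> e"
        using lower_central_Suc_decompose[OF ab gen \<open>z \<in> lower_central G (Suc k)\<close>] by blast
      have ec: "e \<in> carrier G" using e lower_central_subset by blast
      have "p z \<le> p (commutator G x a) + p (commutator G y b) + p e"
        unfolding z using triangle[of "commutator G x a \<otimes> commutator G y b" e]
          triangle[of "commutator G x a" "commutator G y b"] x y ec ab by simp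
      also have "\<dots> \<le> 2 * p a + 2 * p b + K"
        using K[OF e] norm_commutator_le[OF x ab(1)] norm_commutator_le[OF y ab(2)]
        by (simp add: commutator_def)
      finally show ?thesis .
    qed
    then show ?case by blast
  qed
  then show ?thesis by blast
qed

text \<open>
  Both powers agree in the abelian quotient by the commutator subgroup.
\<close>

lemma power_mult_bounded_two_generated:
  assumes ab: "a \<in> carrier G" "b \<in> carrier G" and gen: "carrier G = generate G {a, b}"
    and nil: "lower_central G n = {\<one>}"
  shows "\<exists>K. \<forall>m::nat. dst ((a \<otimes> b) [^] m) (a [^] m \<otimes> b [^] m) \<le> K"
proof -
  obtain K where K: "\<And>z. z \<in> lower_central G (Suc 0) \<Longrightarrow> p z \<le> K"
    using lower_central_bounded[OF assms] by blast
  let ?E = "lower_central G (Suc 0)"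
  let ?q = "\<lambda>x. ?E #> x"
  have E: "?E \<lhd> G" by (rule lower_central_normal)
  interpret q: group_hom G "G Mod ?E" ?q by (rule group_hom_quotient[OF E])
  have "commutator G a b \<in> ?E" using ab by (intro commutator_in_lower_central) simp_all
  then have "?q (commutator G a b) = \<one>\<^bsub>G Mod ?E\<^esub>"
    using coset_join2[of "commutator G a b" ?E] E ab by (simp add: normal_imp_subgroup)
  then have "?q (commutator G a b \<otimes> (b \<otimes> a)) = ?q (b \<otimes> a)"
    using ab by (simp only: q.hom_mult commutator_closed m_closed q.hom_closed q.H.m_closed q.H.l_one)
  then have comm: "?q a \<otimes>\<^bsub>G Mod ?E\<^esub> ?q b = ?q b \<otimes>\<^bsub>G Mod ?E\<^esub> ?q a"
    unfolding commutator_mult_eq[OF ab] using ab by (simp only: q.hom_mult)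
  have "dst ((a \<otimes> b) [^] m) (a [^] m \<otimes> b [^] m) \<le> K" for m :: nat
  proof -
    have "?q ((a \<otimes> b) [^] m) = (?q a \<otimes>\<^bsub>G Mod ?E\<^esub> ?q b) [^]\<^bsub>G Mod ?E\<^esub> m"
      using ab by (simp only: q.hom_nat_pow q.hom_mult m_closed)
    also have "\<dots> = ?q a [^]\<^bsub>G Mod ?E\<^esub> m \<otimes>\<^bsub>G Mod ?E\<^esub> ?q b [^]\<^bsub>G Mod ?E\<^esub> m"
      by (rule q.H.pow_mult_distrib[OF comm q.hom_closed[OF ab(1)] q.hom_closed[OF ab(2)]])
    also have "\<dots> = ?q (a [^] m \<otimes> b [^] m)"
      using ab by (simp only: q.hom_nat_pow q.hom_mult nat_pow_closed)
    finally have eq: "?q ((a \<otimes> b) [^] m) = ?q (a [^] m \<otimes> b [^] m)" .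
    have "inv ((a \<otimes> b) [^] m) \<otimes> (a [^] m \<otimes> b [^] m) \<in> ?E"
      by (rule coset_eq_iff[OF E, THEN iffD1, OF _ _ eq]) (use ab in simp_all)
    then show ?thesis unfolding norm_dist_def by (rule K)
  qed
  then show ?thesis by blast
qed

lemma pseudonormed_subgroup:
  assumes "subgroup H G" shows "pseudonormed_group (G\<lparr>carrier := H\<rparr>) p"
proof -
  interpret H: subgroup H G by (rule assms)
  interpret GH: group "G\<lparr>carrier := H\<rparr>" by (rule subgroup_imp_group[OF assms])
  show ?thesis
    by unfold_locales
      (use nonneg norm_one norm_inv triangle conj in \<open>simp_all add: m_inv_consistent[OF assms]\<close>)
qed

lemma lower_central_subgroup_subset:
  assumes "subgroup H G" shows "lower_central (G\<lparr>carrier := H\<rparr>) k \<subseteq> lower_central G k"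
proof (induction k)
  case 0
  show ?case using subgroup.subset[OF assms] by simp
next
  case (Suc k)
  interpret H: subgroup H G by (rule assms)
  interpret GH: group "G\<lparr>carrier := H\<rparr>" by (rule subgroup_imp_group[OF assms])
  let ?S = "{commutator (G\<lparr>carrier := H\<rparr>) x y | x y. x \<in> lower_central (G\<lparr>carrier := H\<rparr>) k \<and> y \<in> H}"
  have L: "x \<in> H" if "x \<in> lower_central (G\<lparr>carrier := H\<rparr>) k" for x
    using that GH.lower_central_subset by auto
  have c: "commutator (G\<lparr>carrier := H\<rparr>) x y = commutator G x y" if "x \<in> H" "y \<in> H" for x y
    using that by (simp add: commutator_def m_inv_consistent[OF assms])
  have "?S \<subseteq> H" using GH.commutator_closed L by auto
  then have "lower_central (G\<lparr>carrier := H\<rparr>) (Suc k) = generate G ?S"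
    unfolding lower_central_Suc using generate_consistent[OF _ assms, of ?S] by simp
  also have "\<dots> \<subseteq> lower_central G (Suc k)"
    unfolding lower_central_Suc
  proof (rule mono_generate, rule subsetI)
    fix u assume "u \<in> ?S"
    then obtain x y where "u = commutator G x y" "x \<in> lower_central (G\<lparr>carrier := H\<rparr>) k" "y \<in> H"
      using c L by blast
    then show "u \<in> {commutator G x y |x y. x \<in> lower_central G k \<and> y \<in> carrier G}"
      using Suc.IH H.mem_carrier by blast
  qed
  finally show ?case .
qed

text \<open>
  The bound comes from the subgroup generated by \<open>a\<close> and \<open>b\<close>; the commutator subgroup of the whole
  group need not be bounded.
\<close>

lemma power_mult_bounded:
  assumes ab: "a \<in> carrier G" "b \<in> carrier G" and nil: "lower_central G n = {\<one>}"
  shows "\<exists>K. \<forall>m::nat. dst ((a \<otimes> b) [^] m) (a [^] m \<otimes> b [^] m) \<le> K"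
proof -
  let ?H = "generate G {a, b}" and ?GH = "G\<lparr>carrier := generate G {a, b}\<rparr>"
  have H: "subgroup ?H G" using ab by (intro generate_is_subgroup) auto
  interpret H: subgroup ?H G by (rule H)
  interpret GH: pseudonormed_group ?GH p by (rule pseudonormed_subgroup[OF H])
  have abH: "a \<in> ?H" "b \<in> ?H" by (auto intro: generate.incl)
  have "lower_central ?GH n \<subseteq> {\<one>}" using lower_central_subgroup_subset[OF H, of n] nil by simp
  moreover have "\<one>\<^bsub>?GH\<^esub> \<in> lower_central ?GH n"
    using GH.lower_central_normal[of n] normal_imp_subgroup subgroup.one_closed by blast
  ultimately have nilH: "lower_central ?GH n = {\<one>\<^bsub>?GH\<^esub>}" by auto
  have gen: "carrier ?GH = generate ?GH {a, b}"
    using generate_consistent[OF _ H, of "{a, b}"] abH by simp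
  have pow: "x [^]\<^bsub>?GH\<^esub> m = x [^] m" for x and m :: nat
    by (simp add: nat_pow_def)
  have "\<exists>K. \<forall>m::nat. GH.dst ((a \<otimes>\<^bsub>?GH\<^esub> b) [^]\<^bsub>?GH\<^esub> m) (a [^]\<^bsub>?GH\<^esub> m \<otimes>\<^bsub>?GH\<^esub> b [^]\<^bsub>?GH\<^esub> m) \<le> K"
    using abH gen nilH by (intro GH.power_mult_bounded_two_generated) simp_all
  moreover have "GH.dst ((a \<otimes>\<^bsub>?GH\<^esub> b) [^]\<^bsub>?GH\<^esub> m) (a [^]\<^bsub>?GH\<^esub> m \<otimes>\<^bsub>?GH\<^esub> b [^]\<^bsub>?GH\<^esub> m)
      = dst ((a \<otimes> b) [^] m) (a [^] m \<otimes> b [^] m)" for m :: nat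
  proof -
    have "(a \<otimes> b) [^] m \<in> ?H" using abH GH.nat_pow_closed[of "a \<otimes> b" m] by (simp add: pow)
    then show ?thesis by (simp add: norm_dist_def pow m_inv_consistent[OF H])
  qed
  ultimately show ?thesis by simp
qed

end

locale nilpotent_normed_group = conj_normed_group +
  assumes nilpotent: "nilpotent_group G"
begin

lemma power_mult_almost:
  assumes "a \<in> carrier G" "b \<in> carrier G"
  shows "\<exists>K. \<forall>m::nat. N.dst ((a \<otimes> b) [^] m) (a [^] m \<otimes> b [^] m) \<le> K"
  using nilpotent N.power_mult_bounded[OF assms] unfolding nilpotent_group_def by blast

text \<open>
  The powers of \<open>a \<otimes> b\<close> and of \<open>b \<otimes> a\<close> are conjugate by \<open>a\<close>, so they are at distance at most \<open>2 * N a\<close>.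
\<close>

lemma power_mult_commute_almost:
  assumes ab: "a \<in> carrier G" "b \<in> carrier G"
  shows "\<exists>K. \<forall>m::nat. N.dst (a [^] m \<otimes> b [^] m) (b [^] m \<otimes> a [^] m) \<le> K"
proof -
  obtain K where K: "\<And>m::nat. N.dst ((a \<otimes> b) [^] m) (a [^] m \<otimes> b [^] m) \<le> K"
    using power_mult_almost[OF ab] by blast
  obtain K' where K': "\<And>m::nat. N.dst ((b \<otimes> a) [^] m) (b [^] m \<otimes> a [^] m) \<le> K'"
    using power_mult_almost[OF ab(2,1)] by blast
  have shift: "(a \<otimes> b) [^] m \<otimes> a = a \<otimes> (b \<otimes> a) [^] m" for m :: nat
  proof (induction m)
    case (Suc m)
    have "(a \<otimes> b) [^] Suc m \<otimes> a = (a \<otimes> b) [^] m \<otimes> a \<otimes> (b \<otimes> a)" using ab by (simp add: m_assoc)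
    also have "\<dots> = a \<otimes> (b \<otimes> a) [^] Suc m" unfolding Suc using ab by (simp add: m_assoc)
    finally show ?case .
  qed (use ab in simp)
  have "N.dst (a [^] m \<otimes> b [^] m) (b [^] m \<otimes> a [^] m) \<le> K + 2 * N a + K'" for m :: nat
  proof -
    let ?x = "(a \<otimes> b) [^] m" and ?y = "(b \<otimes> a) [^] m"
    have c: "?x \<in> carrier G" "?y \<in> carrier G" "a [^] m \<in> carrier G" "b [^] m \<in> carrier G" using ab by auto
    have "N.dst ?x (?x \<otimes> a) = N a" using ab c N.dst_left_mult[of \<one> a ?x] by (simp add: N.dst_one)
    moreover have "N.dst (a \<otimes> ?y) ?y = N a"
      using ab c N.dst_right_mult[of \<one> a ?y] N.dst_sym[of "a \<otimes> ?y" ?y] by (simp add: N.dst_one)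
    ultimately have "N.dst ?x ?y \<le> 2 * N a"
      using N.dst_triangle[of ?x "?x \<otimes> a" ?y] ab c shift by simp
    moreover have "N.dst (a [^] m \<otimes> b [^] m) ?x \<le> K" using K[of m] N.dst_sym c by simp
    ultimately show ?thesis
      using N.dst_triangle[of "a [^] m \<otimes> b [^] m" ?x ?y] N.dst_triangle[of "a [^] m \<otimes> b [^] m" ?y "b [^] m \<otimes> a [^] m"]
        K'[of m] c by simp
  qed
  then show ?thesis by blast
qed

text \<open>
  Scaling a word by \<open>n\<close> multiplies all exponents by \<open>n\<close>; in the group this is almost the same as
  taking the \<open>n\<close>-th power.
\<close>

lemma pi_hom_psi_almost_power:
  assumes "x \<in> carrier (FZ G)"
  shows "\<exists>K. \<forall>n::nat. N.dst (pi_hom G (psi G (of_nat n) x)) (pi_hom G x [^] n) \<le> K"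
  using assms
proof (induction rule: FZ_induct)
  case one
  show ?case by (rule exI[of _ 0]) (simp add: psi_one pi_hom_one N.dst_refl)
next
  case (mult g k w)
  let ?p = "\<lambda>n. pi_hom G (psi G (of_nat n) w)" and ?h = "g [^] k" and ?r = "pi_hom G w"
  have c: "?h \<in> carrier G" "?r \<in> carrier G" "?p n \<in> carrier G" for n
    using mult.hyps pi_hom_closed psi_in_FZ by auto
  obtain K where K: "\<And>n::nat. N.dst (?p n) (?r [^] n) \<le> K" using mult.IH by blast
  obtain K' where K': "\<And>n::nat. N.dst ((?h \<otimes> ?r) [^] n) (?h [^] n \<otimes> ?r [^] n) \<le> K'"
    using power_mult_almost[of ?h ?r] c by blast
  have gk: "gbar g (of_int l) \<in> carrier (FZ G)" for l by (rule gbar_in_FZ[OF mult.hyps(1)])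
  have "N.dst (pi_hom G (psi G (of_nat n) (gbar g (of_int k) \<otimes>\<^bsub>FR G\<^esub> w)))
      (pi_hom G (gbar g (of_int k) \<otimes>\<^bsub>FR G\<^esub> w) [^] n) \<le> K + K'" for n :: nat
  proof -
    have "psi G (of_nat n) (gbar g (of_int k) \<otimes>\<^bsub>FR G\<^esub> w)
        = gbar g (of_int (k * int n)) \<otimes>\<^bsub>FR G\<^esub> psi G (of_nat n) w"
      using FZ_subset[OF mult.hyps(2)] gbar_in_FR[OF mult.hyps(1)]
      by (simp add: psi_mult psi_gbar mult.commute)
    then have "pi_hom G (psi G (of_nat n) (gbar g (of_int k) \<otimes>\<^bsub>FR G\<^esub> w)) = g [^] (k * int n) \<otimes> ?p n"
      using pi_hom_mult[OF gk[of "k * int n"] psi_in_FZ[OF mult.hyps(2), of n]]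
        pi_hom_gbar_int[OF mult.hyps(1), of "k * int n"]
      by simp
    also have "g [^] (k * int n) = ?h [^] n"
      using int_pow_pow[OF mult.hyps(1), of k "int n"] by (simp add: int_pow_int)
    finally have 1: "pi_hom G (psi G (of_nat n) (gbar g (of_int k) \<otimes>\<^bsub>FR G\<^esub> w)) = ?h [^] n \<otimes> ?p n" .
    have 2: "pi_hom G (gbar g (of_int k) \<otimes>\<^bsub>FR G\<^esub> w) = ?h \<otimes> ?r"
      using pi_hom_mult[OF gk mult.hyps(2)] pi_hom_gbar_int[OF mult.hyps(1)] by simp
    have "N.dst (?h [^] n \<otimes> ?p n) (?h [^] n \<otimes> ?r [^] n) \<le> K"
      using K[of n] c by (simp add: N.dst_left_mult)
    moreover have "N.dst (?h [^] n \<otimes> ?r [^] n) ((?h \<otimes> ?r) [^] n) \<le> K'"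
      using K'[of n] c N.dst_sym[of "?h [^] n \<otimes> ?r [^] n" "(?h \<otimes> ?r) [^] n"] by simp
    ultimately show ?thesis unfolding 1 2
      using N.dst_triangle[of "?h [^] n \<otimes> ?p n" "?h [^] n \<otimes> ?r [^] n" "(?h \<otimes> ?r) [^] n"] c by simp
  qed
  then show ?case by blast
qed

end

section \<open>Limits along scaling sets\<close>

lemma eventually_within_at_top:
  "eventually P (within_at_top T) \<longleftrightarrow> (\<exists>t0. \<forall>t\<in>T. t0 \<le> t \<longrightarrow> P t)"
  by (auto simp: eventually_inf_principal eventually_at_top_linorder)

lemma within_at_top_neq_bot:
  assumes "scaling_set T" shows "within_at_top T \<noteq> bot"
proof
  assume "within_at_top T = bot"
  then have "eventually (\<lambda>_. False) (within_at_top T)" by simp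
  then obtain t0 where t0: "\<And>t. t \<in> T \<Longrightarrow> \<not> t0 \<le> t" unfolding eventually_within_at_top by blast
  then have "bdd_above T" by (intro bdd_aboveI[of _ t0]) force
  then show False using assms by (simp add: scaling_set_def)
qed

lemma scaling_set_pos: "scaling_set T \<Longrightarrow> t \<in> T \<Longrightarrow> 0 < t"
  by (auto simp: scaling_set_def)

lemma scaling_set_unbounded: "scaling_set T \<Longrightarrow> \<exists>t\<in>T. t0 \<le> t"
  unfolding scaling_set_def by (meson bdd_aboveI linear)

lemma eventually_in_scaling_set: "eventually (\<lambda>t. t \<in> T) (within_at_top T)"
  unfolding eventually_within_at_top by blast

lemma filterlim_within_at_top: "filterlim (\<lambda>t. t) at_top (within_at_top T)"
  by (rule filterlim_mono[OF filterlim_ident order_refl inf_le1])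

lemma tendsto_const_over_within_at_top: "((\<lambda>t. (c::real) / t) \<longlongrightarrow> 0) (within_at_top T)"
  by (rule real_tendsto_divide_at_top[OF tendsto_const filterlim_within_at_top])

text \<open>
  The norms of both kinds of cones have this form: they are limits of rescaled norms of the values
  of functions into \<open>G\<close>.
\<close>

lemma (in group) pseudonormed_group_limit:
  assumes A: "group A" and N: "pseudonormed_group G N"
    and F: "F \<noteq> bot" "eventually (\<lambda>i. i \<in> I) F"
    and hom: "\<And>i. i \<in> I \<Longrightarrow> (\<lambda>x. x i) \<in> hom A G" and pos: "\<And>i. i \<in> I \<Longrightarrow> 0 < (d i :: real)"
    and lim: "\<And>x. x \<in> carrier A \<Longrightarrow> ((\<lambda>i. N (x i) / d i) \<longlongrightarrow> q x) F"
  shows "pseudonormed_group A q"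
proof -
  interpret A: group A by (rule A)
  interpret N: pseudonormed_group G N by (rule N)
  have gh: "group_hom A G (\<lambda>x. x i)" if "i \<in> I" for i
    using hom[OF that] by (simp add: group_hom_def group_hom_axioms_def A.is_group is_group)
  have cl: "x i \<in> carrier G" if "i \<in> I" "x \<in> carrier A" for x i
    using hom_in_carrier[OF hom[OF that(1)] that(2)] .
  have eqI: "q x = q y" if "x \<in> carrier A" "y \<in> carrier A" "\<And>i. i \<in> I \<Longrightarrow> N (x i) = N (y i)" for x y
  proof (rule tendsto_unique[OF F(1) lim[OF that(1)]])
    show "((\<lambda>i. N (x i) / d i) \<longlongrightarrow> q y) F"
      using lim[OF that(2)] by (rule Lim_transform_eventually) (use F(2) that(3) in \<open>auto elim!: eventually_mono\<close>)
  qed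
  show ?thesis
  proof unfold_locales
    fix x assume x: "x \<in> carrier A"
    have "eventually (\<lambda>i. 0 \<le> N (x i) / d i) F"
      using F(2) by (rule eventually_mono) (use N.nonneg cl x pos in \<open>simp add: less_imp_le\<close>)
    then show "0 \<le> q x" using tendsto_lowerbound[OF lim[OF x]] F(1) by blast
    show "q (inv\<^bsub>A\<^esub> x) = q x"
      by (rule eqI) (use x group_hom.hom_inv[OF gh x] N.norm_inv cl in simp_all)
    fix y assume y: "y \<in> carrier A"
    have *: "((\<lambda>i. N (x i) / d i + N (y i) / d i) \<longlongrightarrow> q x + q y) F"
      by (rule tendsto_add[OF lim[OF x] lim[OF y]])
    show "q (x \<otimes>\<^bsub>A\<^esub> y) \<le> q x + q y"
    proof (rule tendsto_le[OF F(1) * lim[OF A.m_closed[OF x y]]])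
      show "eventually (\<lambda>i. N ((x \<otimes>\<^bsub>A\<^esub> y) i) / d i \<le> N (x i) / d i + N (y i) / d i) F"
        using F(2)
      proof (rule eventually_mono)
        fix i assume i: "i \<in> I"
        show "N ((x \<otimes>\<^bsub>A\<^esub> y) i) / d i \<le> N (x i) / d i + N (y i) / d i"
          using N.triangle[OF cl[OF i x] cl[OF i y]] pos[OF i] hom_mult[OF hom[OF i] x y]
          by (simp add: divide_right_mono flip: add_divide_distrib)
      qed
    qed
  next
    fix x h assume x: "x \<in> carrier A" and h: "h \<in> carrier A"
    show "q (h \<otimes>\<^bsub>A\<^esub> x \<otimes>\<^bsub>A\<^esub> inv\<^bsub>A\<^esub> h) = q x"
    proof (rule eqI)
      fix i assume i: "i \<in> I"
      interpret g: group_hom A G "\<lambda>x. x i" by (rule gh[OF i])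
      show "N ((h \<otimes>\<^bsub>A\<^esub> x \<otimes>\<^bsub>A\<^esub> inv\<^bsub>A\<^esub> h) i) = N (x i)"
        using x h N.conj[OF cl[OF i x] cl[OF i h]] g.hom_mult[of "h \<otimes>\<^bsub>A\<^esub> x" "inv\<^bsub>A\<^esub> h"] g.hom_mult[of h x] g.hom_inv[of h]
        by simp
    qed (use x h in simp_all)
  next
    have "((\<lambda>i. N (\<one>\<^bsub>A\<^esub> i) / d i) \<longlongrightarrow> 0) F"
    proof (rule tendsto_eventually, use F(2) in \<open>rule eventually_mono\<close>)
      fix i assume i: "i \<in> I"
      show "N (\<one>\<^bsub>A\<^esub> i) / d i = 0" using group_hom.hom_one[OF gh[OF i]] N.norm_one by simp
    qed
    then show "q \<one>\<^bsub>A\<^esub> = 0" using tendsto_unique[OF F(1) lim[OF A.one_closed]] by blast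
  qed
qed

lemma cauchy_along_transform:
  assumes "pseudonormed_group A p"
    and f: "cauchy_along T (norm_dist A p) f" "\<And>t. t \<in> T \<Longrightarrow> f t \<in> carrier A"
    and g: "\<And>t. t \<in> T \<Longrightarrow> g t \<in> carrier A"
    and fg: "((\<lambda>t. norm_dist A p (f t) (g t)) \<longlongrightarrow> 0) (within_at_top T)"
  shows "cauchy_along T (norm_dist A p) g"
  unfolding cauchy_along_def
proof (intro allI impI)
  interpret A: pseudonormed_group A p by (rule assms(1))
  fix e :: real assume e: "0 < e"
  obtain t0 where t0: "\<And>t t'. t \<in> T \<Longrightarrow> t' \<in> T \<Longrightarrow> t0 \<le> t \<Longrightarrow> t0 \<le> t' \<Longrightarrow> A.dst (f t) (f t') < e / 3"
    using f(1) e unfolding cauchy_along_def by (meson divide_pos_pos zero_less_numeral)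
  have "eventually (\<lambda>t. A.dst (f t) (g t) < e / 3) (within_at_top T)"
    using order_tendstoD(2)[OF fg, of "e / 3"] e by simp
  then obtain t1 where t1: "\<And>t. t \<in> T \<Longrightarrow> t1 \<le> t \<Longrightarrow> A.dst (f t) (g t) < e / 3"
    unfolding eventually_within_at_top by blast
  show "\<exists>t0. \<forall>t\<in>T. \<forall>t'\<in>T. t0 \<le> t \<longrightarrow> t0 \<le> t' \<longrightarrow> A.dst (g t) (g t') < e"
  proof (intro exI[of _ "max t0 t1"] ballI impI)
    fix t t' assume t: "t \<in> T" "t' \<in> T" "max t0 t1 \<le> t" "max t0 t1 \<le> t'"
    have c: "f t \<in> carrier A" "f t' \<in> carrier A" "g t \<in> carrier A" "g t' \<in> carrier A" using t f g by auto
    have "A.dst (g t) (g t') \<le> A.dst (g t) (f t) + (A.dst (f t) (f t') + A.dst (f t') (g t'))"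
      using A.dst_triangle[OF c(3,1,4)] A.dst_triangle[OF c(1,2,4)] by simp
    also have "\<dots> < e" using t0[OF t(1,2)] t1[OF t(1)] t1[OF t(2)] t A.dst_sym[OF c(3,1)] by simp
    finally show "A.dst (g t) (g t') < e" .
  qed
qed

section \<open>The directional cone of a nilpotent group\<close>

context conj_normed_group
begin

abbreviation rescale :: "(real \<Rightarrow> ('a \<times> real) list) \<Rightarrow> real \<Rightarrow> ('a \<times> real) list" where
  "rescale w t \<equiv> psi G (1 / t) (w t)"

text \<open>
  The elements of \<open>DD G N T\<close>, but without prescribed values outside \<open>T\<close>.
\<close>

definition direction :: "real set \<Rightarrow> (real \<Rightarrow> ('a \<times> real) list) \<Rightarrow> bool" where
  "direction T w \<longleftrightarrow> (\<forall>t\<in>T. w t \<in> carrier (FZ G)) \<and> cauchy_along T F.dst (rescale w)"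

lemma direction_FZ: "direction T w \<Longrightarrow> t \<in> T \<Longrightarrow> w t \<in> carrier (FZ G)"
  by (simp add: direction_def)

lemma direction_FR: "direction T w \<Longrightarrow> t \<in> T \<Longrightarrow> rescale w t \<in> carrier (FR G)"
  by (simp add: direction_FZ FZ_subset)

lemma direction_cauchy:
  assumes "direction T w" "0 < e"
  obtains t0 where "\<And>t t'. t \<in> T \<Longrightarrow> t' \<in> T \<Longrightarrow> t0 \<le> t \<Longrightarrow> t0 \<le> t' \<Longrightarrow> F.dst (rescale w t) (rescale w t') < e"
  using assms unfolding direction_def cauchy_along_def by meson

lemma direction_cong:
  assumes "\<And>t. t \<in> T \<Longrightarrow> v t = w t" shows "direction T v \<longleftrightarrow> direction T w"
  using assms by (simp add: direction_def cauchy_along_def)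

lemma DD_iff: "w \<in> carrier (DD G N T) \<longleftrightarrow> w \<in> extensional T \<and> direction T w"
  by (auto simp: DD_def direction_def PiE_iff)

lemma direction_one: "direction T (\<lambda>t. \<one>\<^bsub>FR G\<^esub>)"
  using Z.one_closed by (simp add: direction_def cauchy_along_def psi_one F.dst_refl)

lemma direction_inv:
  assumes w: "direction T w" shows "direction T (\<lambda>t. inv\<^bsub>FR G\<^esub> w t)"
proof -
  have "inv\<^bsub>FR G\<^esub> w t \<in> carrier (FZ G)" if "t \<in> T" for t
    using subgroup.m_inv_closed[OF FZ_subgroup direction_FZ[OF w that]] .
  moreover have "F.dst (rescale (\<lambda>t. inv\<^bsub>FR G\<^esub> w t) t) (rescale (\<lambda>t. inv\<^bsub>FR G\<^esub> w t) t') = F.dst (rescale w t) (rescale w t')"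
    if "t \<in> T" "t' \<in> T" for t t'
    using FZ_subset[OF direction_FZ[OF w that(1)]] FZ_subset[OF direction_FZ[OF w that(2)]]
    by (simp add: psi_inv F.dst_inv)
  ultimately show ?thesis using w by (simp add: direction_def cauchy_along_def)
qed

lemma direction_mult:
  assumes v: "direction T v" and w: "direction T w" shows "direction T (\<lambda>t. v t \<otimes>\<^bsub>FR G\<^esub> w t)"
  unfolding direction_def cauchy_along_def
proof (intro conjI ballI allI impI)
  fix t assume t: "t \<in> T"
  show "v t \<otimes>\<^bsub>FR G\<^esub> w t \<in> carrier (FZ G)"
    using subgroup.m_closed[OF FZ_subgroup direction_FZ[OF v t] direction_FZ[OF w t]] .
next
  fix e :: real assume e: "0 < e"
  obtain a where a: "\<And>t t'. t \<in> T \<Longrightarrow> t' \<in> T \<Longrightarrow> a \<le> t \<Longrightarrow> a \<le> t' \<Longrightarrow> F.dst (rescale v t) (rescale v t') < e / 2"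
    using direction_cauchy[OF v, of "e / 2"] e by auto
  obtain b where b: "\<And>t t'. t \<in> T \<Longrightarrow> t' \<in> T \<Longrightarrow> b \<le> t \<Longrightarrow> b \<le> t' \<Longrightarrow> F.dst (rescale w t) (rescale w t') < e / 2"
    using direction_cauchy[OF w, of "e / 2"] e by auto
  show "\<exists>t0. \<forall>t\<in>T. \<forall>t'\<in>T. t0 \<le> t \<longrightarrow> t0 \<le> t' \<longrightarrow>
      F.dst (psi G (1 / t) (v t \<otimes>\<^bsub>FR G\<^esub> w t)) (psi G (1 / t') (v t' \<otimes>\<^bsub>FR G\<^esub> w t')) < e"
  proof (intro exI[of _ "max a b"] ballI impI)
    fix t t' assume t: "t \<in> T" "t' \<in> T" "max a b \<le> t" "max a b \<le> t'"
    have c: "v t \<in> carrier (FR G)" "w t \<in> carrier (FR G)" "v t' \<in> carrier (FR G)" "w t' \<in> carrier (FR G)"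
      using t direction_FZ v w FZ_subset by blast+
    have "F.dst (rescale v t \<otimes>\<^bsub>FR G\<^esub> rescale w t) (rescale v t' \<otimes>\<^bsub>FR G\<^esub> rescale w t')
        \<le> F.dst (rescale v t) (rescale v t') + F.dst (rescale w t) (rescale w t')"
      using c by (intro F.dst_mult psi_closed)
    also have "\<dots> < e" using a[OF t(1,2)] b[OF t(1,2)] t by simp
    finally show "F.dst (psi G (1 / t) (v t \<otimes>\<^bsub>FR G\<^esub> w t)) (psi G (1 / t') (v t' \<otimes>\<^bsub>FR G\<^esub> w t')) < e"
      using c by (simp add: psi_mult)
  qed
qed

lemma DD_norm_tendsto:
  assumes T: "scaling_set T" and w: "direction T w"
  shows "((\<lambda>t. FR_norm G N (rescale w t)) \<longlongrightarrow> DD_norm G N T w) (within_at_top T)"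
proof -
  let ?f = "\<lambda>t. FR_norm G N (rescale w t)" and ?F = "within_at_top T"
  have "cauchy_filter (filtermap ?f ?F)"
    unfolding cauchy_filter_metric_filtermap
  proof (intro allI impI)
    fix e :: real assume "0 < e"
    then obtain t0 where t0: "\<And>t t'. t \<in> T \<Longrightarrow> t' \<in> T \<Longrightarrow> t0 \<le> t \<Longrightarrow> t0 \<le> t' \<Longrightarrow> F.dst (rescale w t) (rescale w t') < e"
      using direction_cauchy[OF w] by blast
    show "\<exists>P. eventually P ?F \<and> (\<forall>x y. P x \<and> P y \<longrightarrow> dist (?f x) (?f y) < e)"
    proof (intro exI[of _ "\<lambda>t. t \<in> T \<and> t0 \<le> t"] conjI allI impI)
      show "eventually (\<lambda>t. t \<in> T \<and> t0 \<le> t) ?F" unfolding eventually_within_at_top by blast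
      fix t t' assume "(t \<in> T \<and> t0 \<le> t) \<and> (t' \<in> T \<and> t0 \<le> t')"
      then have "\<bar>?f t - ?f t'\<bar> < e"
        using t0[of t t'] F.norm_diff_le_dst[OF direction_FR[OF w, of t] direction_FR[OF w, of t']] by simp
      then show "dist (?f t) (?f t') < e" by (simp add: dist_real_def)
    qed
  qed
  moreover have "complete (UNIV :: real set)" by (rule complete_UNIV)
  moreover have "filtermap ?f ?F \<noteq> bot" using within_at_top_neq_bot[OF T] by (simp add: filtermap_bot_iff)
  ultimately obtain L where "filtermap ?f ?F \<le> nhds L"
    unfolding complete_uniform by (metis principal_UNIV top_greatest)
  then have "(?f \<longlongrightarrow> L) ?F" by (simp add: filterlim_def)
  then show ?thesis
    unfolding DD_norm_def using within_at_top_neq_bot[OF T] by (simp add: tendsto_Lim)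
qed

text \<open>
  Since \<open>psi t\<close> scales norms by at most \<open>t\<close>, distances in \<open>G\<close> are controlled by those at scale \<open>t\<close>.
\<close>

lemma pi_hom_dst_le:
  assumes x: "x \<in> carrier (FZ G)" and y: "y \<in> carrier (FZ G)" and t: "0 < t"
  shows "N.dst (pi_hom G x) (pi_hom G y) \<le> t * F.dst (psi G (1 / t) x) (psi G (1 / t) y)"
proof -
  let ?z = "inv\<^bsub>FR G\<^esub> x \<otimes>\<^bsub>FR G\<^esub> y"
  have xi: "inv\<^bsub>FR G\<^esub> x \<in> carrier (FZ G)" by (rule subgroup.m_inv_closed[OF FZ_subgroup x])
  have z: "?z \<in> carrier (FZ G)" by (rule subgroup.m_closed[OF FZ_subgroup xi y])
  note FR = FZ_subset[OF x] FZ_subset[OF y] FZ_subset[OF z]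
  have "N.dst (pi_hom G x) (pi_hom G y) = N (pi_hom G ?z)"
    by (simp add: norm_dist_def pi_hom_mult[OF xi y] pi_hom_inv[OF x])
  also have "\<dots> \<le> FR_norm G N ?z" by (rule norm_pi_hom_le[OF z])
  also have "?z = psi G t (psi G (1 / t) ?z)" using t FR by (simp add: psi_psi psi_1)
  also have "FR_norm G N \<dots> \<le> t * FR_norm G N (psi G (1 / t) ?z)"
    using FR_norm_psi_le[of "psi G (1 / t) ?z" t] FR t by simp
  also have "psi G (1 / t) ?z = inv\<^bsub>FR G\<^esub> psi G (1 / t) x \<otimes>\<^bsub>FR G\<^esub> psi G (1 / t) y"
    using FR by (simp add: psi_mult psi_inv)
  finally show ?thesis by (simp add: norm_dist_def)
qed

lemma rounding_bounds:
  assumes "0 < s" "0 < (t::real)"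
  shows "of_nat (nat \<lfloor>t / s\<rfloor>) / t \<le> 1 / s" "\<bar>of_nat (nat \<lfloor>t / s\<rfloor>) / t - 1 / s\<bar> \<le> 1 / t"
proof -
  have n: "real (nat \<lfloor>t / s\<rfloor>) = of_int \<lfloor>t / s\<rfloor>" using assms by simp
  then have l: "real (nat \<lfloor>t / s\<rfloor>) \<le> t / s" and g: "t / s - 1 \<le> real (nat \<lfloor>t / s\<rfloor>)" by linarith+
  have "real (nat \<lfloor>t / s\<rfloor>) / t \<le> (t / s) / t" using l assms by (intro divide_right_mono) auto
  then show a: "real (nat \<lfloor>t / s\<rfloor>) / t \<le> 1 / s" using assms by simp
  have "(t / s - 1) / t \<le> real (nat \<lfloor>t / s\<rfloor>) / t" using g assms by (intro divide_right_mono) auto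
  moreover have "(t / s - 1) / t = 1 / s - 1 / t" using assms by (simp add: diff_divide_distrib)
  ultimately show "\<bar>real (nat \<lfloor>t / s\<rfloor>) / t - 1 / s\<bar> \<le> 1 / t" using a by linarith
qed

text \<open>
  For a word \<open>x\<close> with integral exponents, \<open>psi (nat \<lfloor>t / s\<rfloor>) x\<close> is an integral approximation, at
  scale \<open>t\<close>, of the direction that \<open>x\<close> has at scale \<open>s\<close>.
\<close>

lemma rounding_dst:
  assumes x: "x \<in> carrier (FR G)" and s: "0 < s"
  obtains C where "0 \<le> C"
    "\<And>t. 0 < t \<Longrightarrow> F.dst (rescale (\<lambda>t. psi G (of_nat (nat \<lfloor>t / s\<rfloor>)) x) t) (psi G (1 / s) x) \<le> C / t"
proof -
  obtain C where C: "0 \<le> C" "\<And>a b. F.dst (psi G a x) (psi G b x) \<le> C * \<bar>a - b\<bar>"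
    using psi_Lipschitz[OF x] by blast
  have "F.dst (rescale (\<lambda>t. psi G (of_nat (nat \<lfloor>t / s\<rfloor>)) x) t) (psi G (1 / s) x) \<le> C / t" if t: "0 < t" for t
  proof -
    let ?n = "real (nat \<lfloor>t / s\<rfloor>)"
    have "rescale (\<lambda>t. psi G (of_nat (nat \<lfloor>t / s\<rfloor>)) x) t = psi G (?n / t) x" using x by (simp add: psi_psi)
    then have "F.dst (rescale (\<lambda>t. psi G (of_nat (nat \<lfloor>t / s\<rfloor>)) x) t) (psi G (1 / s) x) \<le> C * \<bar>?n / t - 1 / s\<bar>"
      using C(2)[of "?n / t" "1 / s"] by simp
    also have "\<dots> \<le> C * (1 / t)" using C(1) rounding_bounds(2)[OF s t] by (intro mult_left_mono)
    finally show ?thesis by simp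
  qed
  then show ?thesis using that C(1) by blast
qed

end

context nilpotent_normed_group
begin

text \<open>
  At scale \<open>t\<close>, both \<open>w t\<close> and the rounded multiple of \<open>w s\<close> are close to the limiting direction, and the
  projection of the latter is almost a power.
\<close>

lemma direction_almost_power:
  assumes T: "scaling_set T" and w: "direction T w" and e: "0 < e"
  obtains t0 where "\<And>s. s \<in> T \<Longrightarrow> t0 \<le> s \<Longrightarrow>
    \<exists>K. \<forall>t\<in>T. t0 \<le> t \<longrightarrow> N.dst (pi_hom G (w t)) (pi_hom G (w s) [^] nat \<lfloor>t / s\<rfloor>) \<le> e * t + K"
proof -
  obtain t0 where t0: "\<And>t t'. t \<in> T \<Longrightarrow> t' \<in> T \<Longrightarrow> t0 \<le> t \<Longrightarrow> t0 \<le> t' \<Longrightarrow> F.dst (rescale w t) (rescale w t') < e"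
    using direction_cauchy[OF w e] by blast
  have "\<exists>K. \<forall>t\<in>T. t0 \<le> t \<longrightarrow> N.dst (pi_hom G (w t)) (pi_hom G (w s) [^] nat \<lfloor>t / s\<rfloor>) \<le> e * t + K"
    if s: "s \<in> T" "t0 \<le> s" for s
  proof -
    have s0: "0 < s" using scaling_set_pos[OF T s(1)] .
    have x: "w s \<in> carrier (FZ G)" using direction_FZ[OF w s(1)] .
    let ?n = "\<lambda>t. nat \<lfloor>t / s\<rfloor>"
    let ?v = "\<lambda>t. psi G (of_nat (?n t)) (w s)"
    obtain C where C: "0 \<le> C" "\<And>t. 0 < t \<Longrightarrow> F.dst (rescale ?v t) (rescale w s) \<le> C / t"
      using rounding_dst[OF FZ_subset[OF x] s0] by blast
    obtain K where K: "\<And>n::nat. N.dst (pi_hom G (psi G (of_nat n) (w s))) (pi_hom G (w s) [^] n) \<le> K"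
      using pi_hom_psi_almost_power[OF x] by blast
    have "N.dst (pi_hom G (w t)) (pi_hom G (w s) [^] ?n t) \<le> e * t + (C + K)" if t: "t \<in> T" "t0 \<le> t" for t
    proof -
      have tp: "0 < t" using scaling_set_pos[OF T t(1)] .
      have wt: "w t \<in> carrier (FZ G)" using direction_FZ[OF w t(1)] .
      have v: "?v t \<in> carrier (FZ G)" using psi_in_FZ[OF x] .
      have R: "rescale w t \<in> carrier (FR G)" "rescale w s \<in> carrier (FR G)" "rescale ?v t \<in> carrier (FR G)"
        using FZ_subset[OF wt] FZ_subset[OF x] FZ_subset[OF v] by auto
      have "F.dst (rescale w t) (rescale ?v t) \<le> F.dst (rescale w t) (rescale w s) + F.dst (rescale ?v t) (rescale w s)"
        using F.dst_triangle[OF R] F.dst_sym[OF R(2,3)] by simp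
      also have "\<dots> \<le> e + C / t" using t0[OF t(1) s(1) t(2) s(2)] C(2)[OF tp] by simp
      finally have "t * F.dst (rescale w t) (rescale ?v t) \<le> t * (e + C / t)"
        using tp by (intro mult_left_mono) auto
      also have "\<dots> = e * t + C" using tp by (simp add: field_simps)
      finally have "N.dst (pi_hom G (w t)) (pi_hom G (?v t)) \<le> e * t + C"
        using pi_hom_dst_le[OF wt v tp] by linarith
      then show ?thesis
        using N.dst_triangle[of "pi_hom G (w t)" "pi_hom G (?v t)" "pi_hom G (w s) [^] ?n t"] K[of "?n t"]
          pi_hom_closed[OF wt] pi_hom_closed[OF v] pi_hom_closed[OF x] by simp
    qed
    then show ?thesis by blast
  qed
  then show ?thesis using that by blast
qed

text \<open>
  The word \<open>w s\<close> may be a much longer expression than its projection \<open>h\<close> requires.  Its rounded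
  multiple is split off \<open>w t\<close> on the left and replaced by the single syllable of exponent
  \<open>nat \<lfloor>t / s\<rfloor>\<close> in the factor indexed by \<open>h\<close>.  In \<open>G\<close> this is an error of bounded norm, which one further syllable corrects.
\<close>

lemma direction_improve:
  assumes T: "scaling_set T" and w: "direction T w" and e: "0 < e"
  obtains t0 where "\<And>s. s \<in> T \<Longrightarrow> t0 \<le> s \<Longrightarrow>
    \<exists>w'. direction T w' \<and> (\<forall>t\<in>T. pi_hom G (w' t) = pi_hom G (w t)) \<and> DD_norm G N T w' \<le> N (pi_hom G (w s)) / s + e"
proof -
  obtain t0 where t0: "\<And>t t'. t \<in> T \<Longrightarrow> t' \<in> T \<Longrightarrow> t0 \<le> t \<Longrightarrow> t0 \<le> t' \<Longrightarrow> F.dst (rescale w t) (rescale w t') < e"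
    using direction_cauchy[OF w e] by blast
  have "\<exists>w'. direction T w' \<and> (\<forall>t\<in>T. pi_hom G (w' t) = pi_hom G (w t)) \<and> DD_norm G N T w' \<le> N (pi_hom G (w s)) / s + e"
    if s: "s \<in> T" "t0 \<le> s" for s
  proof -
    have s0: "0 < s" using scaling_set_pos[OF T s(1)] .
    have x: "w s \<in> carrier (FZ G)" using direction_FZ[OF w s(1)] .
    let ?n = "\<lambda>t. nat \<lfloor>t / s\<rfloor>"
    let ?v = "\<lambda>t. psi G (of_nat (?n t)) (w s)"
    let ?h = "pi_hom G (w s)"
    have h: "?h \<in> carrier G" using pi_hom_closed[OF x] .
    obtain C where C: "0 \<le> C" "\<And>t. 0 < t \<Longrightarrow> F.dst (rescale ?v t) (rescale w s) \<le> C / t"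
      using rounding_dst[OF FZ_subset[OF x] s0] by blast
    obtain K where K: "\<And>n::nat. N.dst (pi_hom G (psi G (of_nat n) (w s))) (pi_hom G (w s) [^] n) \<le> K"
      using pi_hom_psi_almost_power[OF x] by blast
    have v: "?v t \<in> carrier (FZ G)" for t using psi_in_FZ[OF x] .
    have pv: "pi_hom G (?v t) \<in> carrier G" for t using pi_hom_closed[OF v] .
    (* The bounded discrepancy, in the group, between the rounded multiple of w s and the power of h. *)
    define err where "err t = inv (?h [^] ?n t) \<otimes> pi_hom G (?v t)" for t
    have errc: "err t \<in> carrier G" for t using h pv by (simp add: err_def)
    have errK: "N (err t) \<le> K" for t
      using K[of "?n t"] N.dst_sym[of "pi_hom G (?v t)" "?h [^] ?n t"] h pv by (simp add: err_def norm_dist_def)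
    define a where "a t = gbar ?h (of_int (int (?n t)))" for t
    define b where "b t = gbar (err t) (of_int 1)" for t
    have ab: "a t \<in> carrier (FZ G)" "b t \<in> carrier (FZ G)" for t
      unfolding a_def b_def by (rule gbar_in_FZ[OF h], rule gbar_in_FZ[OF errc])
    define w' where "w' t = a t \<otimes>\<^bsub>FR G\<^esub> (b t \<otimes>\<^bsub>FR G\<^esub> (inv\<^bsub>FR G\<^esub> ?v t \<otimes>\<^bsub>FR G\<^esub> w t))" for t
    note mc = subgroup.m_closed[OF FZ_subgroup] and ic = subgroup.m_inv_closed[OF FZ_subgroup]
    have w'Z: "w' t \<in> carrier (FZ G)" if "t \<in> T" for t
      unfolding w'_def by (rule mc[OF ab(1) mc[OF ab(2) mc[OF ic[OF v] direction_FZ[OF w that]]]])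
    have pi: "pi_hom G (w' t) = pi_hom G (w t)" if t: "t \<in> T" for t
    proof -
      have wt: "w t \<in> carrier (FZ G)" using direction_FZ[OF w t] .
      have "pi_hom G (w' t) = ?h [^] ?n t \<otimes> (err t \<otimes> (inv pi_hom G (?v t) \<otimes> pi_hom G (w t)))"
        unfolding w'_def
        using pi_hom_mult[OF ab(1) mc[OF ab(2) mc[OF ic[OF v] wt]], of t t t]
          pi_hom_mult[OF ab(2) mc[OF ic[OF v] wt], of t t] pi_hom_mult[OF ic[OF v] wt, of t] pi_hom_inv[OF v, of t]
          pi_hom_gbar_int[OF h, of "int (?n t)"] pi_hom_gbar_int[OF errc, of t 1] errc
        by (simp add: a_def b_def int_pow_int int_pow_1)
      also have "\<dots> = pi_hom G (w t)"
        unfolding err_def using h pv pi_hom_closed[OF wt]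
        by (simp add: m_assoc mult_inv_cancel)
      finally show ?thesis .
    qed
    (* The limiting shape of w': its roundings have converged and the correction has vanished.
       As a left translate of the rescaled w it is Cauchy. *)
    define z where "z t = gbar ?h (1 / s) \<otimes>\<^bsub>FR G\<^esub> (inv\<^bsub>FR G\<^esub> rescale w s \<otimes>\<^bsub>FR G\<^esub> rescale w t)" for t
    have resc: "rescale w' t = gbar ?h (?n t / t) \<otimes>\<^bsub>FR G\<^esub> (gbar (err t) (1 / t) \<otimes>\<^bsub>FR G\<^esub> (inv\<^bsub>FR G\<^esub> rescale ?v t \<otimes>\<^bsub>FR G\<^esub> rescale w t))"
      if t: "t \<in> T" for t
    proof -
      have R: "a t \<in> carrier (FR G)" "b t \<in> carrier (FR G)" "?v t \<in> carrier (FR G)" "w t \<in> carrier (FR G)"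
        using FZ_subset ab v direction_FZ[OF w t] by blast+
      show ?thesis unfolding w'_def using R by (simp add: psi_mult psi_inv a_def b_def psi_gbar)
    qed
    have Rs: "rescale w s \<in> carrier (FR G)" "gbar ?h r \<in> carrier (FR G)" "gbar (err t) r \<in> carrier (FR G)"
      "rescale ?v t \<in> carrier (FR G)" for r t
      using FZ_subset[OF x] FZ_subset[OF v] gbar_in_FR[OF h] gbar_in_FR[OF errc] by auto
    have gb: "FR_norm G N (gbar (err t) (1 / t)) \<le> K / t" if t: "0 < t" for t
    proof -
      have "FR_norm G N (gbar (err t) (1 / t)) \<le> N (err t) / t"
        using FR_norm_gbar[OF errc, of t "1 / t"] t by simp
      also have "\<dots> \<le> K / t" using errK t by (intro divide_right_mono) auto
      finally show ?thesis .
    qed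
    have close: "F.dst (z t) (rescale w' t) \<le> (N ?h + K + C) / t" if t: "t \<in> T" for t
    proof -
      have tp: "0 < t" using scaling_set_pos[OF T t] .
      have Rt: "rescale w t \<in> carrier (FR G)" using direction_FR[OF w t] .
      let ?y = "inv\<^bsub>FR G\<^esub> rescale w s \<otimes>\<^bsub>FR G\<^esub> rescale w t" and ?y' = "inv\<^bsub>FR G\<^esub> rescale ?v t \<otimes>\<^bsub>FR G\<^esub> rescale w t"
      have y: "?y \<in> carrier (FR G)" "?y' \<in> carrier (FR G)" using Rs Rt by auto
      have "F.dst (gbar ?h (1 / s)) (gbar ?h (?n t / t)) = FR_norm G N (gbar ?h (?n t / t - 1 / s))"
        using inv_gbar[OF h] by (simp add: norm_dist_def gbar_add)
      also have "\<dots> \<le> \<bar>?n t / t - 1 / s\<bar> * N ?h" by (rule FR_norm_gbar[OF h])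
      also have "\<dots> \<le> 1 / t * N ?h"
        by (rule mult_right_mono[OF rounding_bounds(2)[OF s0 tp] N.nonneg[OF h]])
      finally have 1: "F.dst (gbar ?h (1 / s)) (gbar ?h (?n t / t)) \<le> N ?h / t" by simp
      have "F.dst ?y ?y' = F.dst (rescale w s) (rescale ?v t)"
        using Rs Rt by (simp add: F.dst_right_mult F.dst_inv)
      also have "\<dots> \<le> C / t" using C(2)[OF tp] F.dst_sym[OF Rs(1) Rs(4)[of t]] by simp
      finally have 2: "F.dst ?y ?y' \<le> C / t" .
      have "F.dst ?y (gbar (err t) (1 / t) \<otimes>\<^bsub>FR G\<^esub> ?y') \<le> F.dst ?y ?y' + F.dst ?y' (gbar (err t) (1 / t) \<otimes>\<^bsub>FR G\<^esub> ?y')"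
        using y Rs by (intro F.dst_triangle) auto
      also have "F.dst ?y' (gbar (err t) (1 / t) \<otimes>\<^bsub>FR G\<^esub> ?y') = FR_norm G N (gbar (err t) (1 / t))"
        using F.dst_right_mult[OF F.one_closed Rs(3)[of t "1 / t"] y(2)] y(2) F.dst_one[OF Rs(3)[of t "1 / t"]] by simp
      finally have 3: "F.dst ?y (gbar (err t) (1 / t) \<otimes>\<^bsub>FR G\<^esub> ?y') \<le> C / t + K / t" using 2 gb[OF tp] by simp
      have "F.dst (z t) (rescale w' t) \<le> F.dst (gbar ?h (1 / s)) (gbar ?h (?n t / t)) + F.dst ?y (gbar (err t) (1 / t) \<otimes>\<^bsub>FR G\<^esub> ?y')"
        unfolding z_def resc[OF t] using y Rs by (intro F.dst_mult) auto
      also have "\<dots> \<le> (N ?h + K + C) / t" using 1 3 by (simp add: add_divide_distrib)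
      finally show ?thesis .
    qed
    have zR: "z t \<in> carrier (FR G)" if "t \<in> T" for t
      unfolding z_def using Rs direction_FR[OF w that] by auto
    have w'R: "rescale w' t \<in> carrier (FR G)" if "t \<in> T" for t
      using FZ_subset[OF w'Z[OF that]] by simp
    have "F.dst (z t) (z t') = F.dst (rescale w t) (rescale w t')" if "t \<in> T" "t' \<in> T" for t t'
      unfolding z_def using Rs direction_FR[OF w that(1)] direction_FR[OF w that(2)] by (simp add: F.dst_left_mult)
    then have zc: "cauchy_along T F.dst z" using w by (simp add: direction_def cauchy_along_def)
    have zl: "((\<lambda>t. F.dst (z t) (rescale w' t)) \<longlongrightarrow> 0) (within_at_top T)"
    proof (rule tendsto_sandwich[OF _ _ tendsto_const tendsto_const_over_within_at_top])
      show "eventually (\<lambda>t. 0 \<le> F.dst (z t) (rescale w' t)) (within_at_top T)"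
        using F.dst_nonneg[OF zR w'R] eventually_in_scaling_set by (rule eventually_mono[rotated])
      show "eventually (\<lambda>t. F.dst (z t) (rescale w' t) \<le> (N ?h + K + C) / t) (within_at_top T)"
        using close eventually_in_scaling_set by (rule eventually_mono[rotated])
    qed
    have "cauchy_along T F.dst (rescale w')"
      by (rule cauchy_along_transform[OF pseudonormed_FR zc zR w'R zl])
    then have w': "direction T w'" using w'Z by (simp add: direction_def)
    have "DD_norm G N T w' \<le> N ?h / s + e"
    proof (rule tendsto_le[OF within_at_top_neq_bot[OF T] _ DD_norm_tendsto[OF T w']])
      show "((\<lambda>t. N ?h / s + e + (K + C) / t) \<longlongrightarrow> N ?h / s + e) (within_at_top T)"
        using tendsto_add[OF tendsto_const tendsto_const_over_within_at_top[of "K + C" T], of "N ?h / s + e"] by simp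
      show "eventually (\<lambda>t. FR_norm G N (rescale w' t) \<le> N ?h / s + e + (K + C) / t) (within_at_top T)"
        unfolding eventually_within_at_top
      proof (intro exI[of _ t0] ballI impI)
        fix t assume t: "t \<in> T" "t0 \<le> t"
        have tp: "0 < t" using scaling_set_pos[OF T t(1)] .
        have Rt: "rescale w t \<in> carrier (FR G)" using direction_FR[OF w t(1)] .
        let ?y' = "inv\<^bsub>FR G\<^esub> rescale ?v t \<otimes>\<^bsub>FR G\<^esub> rescale w t"
        have y': "?y' \<in> carrier (FR G)" using Rs Rt by auto
        have "FR_norm G N (gbar ?h (?n t / t)) \<le> \<bar>?n t / t\<bar> * N ?h" by (rule FR_norm_gbar[OF h])
        also have "\<dots> \<le> 1 / s * N ?h"
          using rounding_bounds(1)[OF s0 tp] tp by (intro mult_right_mono N.nonneg[OF h]) auto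
        finally have 1: "FR_norm G N (gbar ?h (?n t / t)) \<le> N ?h / s" by simp
        have "FR_norm G N ?y' = F.dst (rescale ?v t) (rescale w t)" by (simp add: norm_dist_def)
        also have "\<dots> \<le> F.dst (rescale ?v t) (rescale w s) + F.dst (rescale w s) (rescale w t)"
          by (rule F.dst_triangle[OF Rs(4) Rs(1) Rt])
        also have "\<dots> \<le> C / t + e" using C(2)[OF tp] t0[OF s(1) t(1) s(2) t(2)] by simp
        finally have 2: "FR_norm G N ?y' \<le> C / t + e" .
        have "FR_norm G N (rescale w' t) \<le> FR_norm G N (gbar ?h (?n t / t)) + FR_norm G N (gbar (err t) (1 / t) \<otimes>\<^bsub>FR G\<^esub> ?y')"
          unfolding resc[OF t(1)] using Rs y' by (intro F.triangle) auto
        also have "FR_norm G N (gbar (err t) (1 / t) \<otimes>\<^bsub>FR G\<^esub> ?y') \<le> FR_norm G N (gbar (err t) (1 / t)) + FR_norm G N ?y'"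
          using Rs y' by (intro F.triangle) auto
        finally show "FR_norm G N (rescale w' t) \<le> N ?h / s + e + (K + C) / t"
          using 1 2 gb[OF tp] by (simp add: add_divide_distrib)
      qed
    qed
    then show ?thesis using w' pi by blast
  qed
  then show ?thesis using that by blast
qed

end

context conj_normed_group
begin

lemma CC_iff: "g \<in> carrier (CC G N T) \<longleftrightarrow> (\<exists>w. direction T w \<and> g = (\<lambda>t\<in>T. pi_hom G (w t)))"
proof
  assume "g \<in> carrier (CC G N T)"
  then show "\<exists>w. direction T w \<and> g = (\<lambda>t\<in>T. pi_hom G (w t))"
    by (auto simp: CC_def pi_comp_def DD_iff)
next
  assume "\<exists>w. direction T w \<and> g = (\<lambda>t\<in>T. pi_hom G (w t))"
  then obtain w where w: "direction T w" "g = (\<lambda>t\<in>T. pi_hom G (w t))" by blast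
  have "direction T (restrict w T)" using w(1) direction_cong[of T "restrict w T" w] by simp
  then have "restrict w T \<in> carrier (DD G N T)" by (simp add: DD_iff)
  moreover have "g = pi_comp G T (restrict w T)" using w(2) by (auto simp: pi_comp_def)
  ultimately show "g \<in> carrier (CC G N T)" by (simp add: CC_def)
qed

lemma CC_memI: "direction T w \<Longrightarrow> (\<lambda>t\<in>T. pi_hom G (w t)) \<in> carrier (CC G N T)"
  unfolding CC_iff by blast

lemma CC_closed: "g \<in> carrier (CC G N T) \<Longrightarrow> t \<in> T \<Longrightarrow> g t \<in> carrier G"
  using direction_FZ pi_hom_closed by (fastforce simp: CC_iff)

lemma CC_mult [simp]: "g \<otimes>\<^bsub>CC G N T\<^esub> h = (\<lambda>t\<in>T. g t \<otimes> h t)"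
  by (simp add: CC_def)

lemma CC_subgroup: "subgroup (carrier (CC G N T)) (product_group T (\<lambda>_. G))"
proof -
  interpret P: group "product_group T (\<lambda>_. G)" by (simp add: is_group)
  show ?thesis
  proof (rule P.subgroupI)
    show sub: "carrier (CC G N T) \<subseteq> carrier (product_group T (\<lambda>_. G))"
      using CC_closed by (auto simp: PiE_iff CC_iff)
    show "carrier (CC G N T) \<noteq> {}" using CC_memI[OF direction_one] by blast
    fix g assume g: "g \<in> carrier (CC G N T)"
    then obtain v where v: "direction T v" "g = (\<lambda>t\<in>T. pi_hom G (v t))" by (auto simp: CC_iff)
    have "inv\<^bsub>product_group T (\<lambda>_. G)\<^esub> g = (\<lambda>t\<in>T. inv g t)"
      using sub g by (intro inv_product_group) (auto simp: is_group)
    also have "\<dots> = (\<lambda>t\<in>T. pi_hom G (inv\<^bsub>FR G\<^esub> v t))"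
      using v direction_FZ[OF v(1)] pi_hom_inv by (auto intro!: restrict_ext)
    finally show "inv\<^bsub>product_group T (\<lambda>_. G)\<^esub> g \<in> carrier (CC G N T)"
      using CC_memI[OF direction_inv[OF v(1)]] by simp
    fix h assume h: "h \<in> carrier (CC G N T)"
    then obtain w where w: "direction T w" "h = (\<lambda>t\<in>T. pi_hom G (w t))" by (auto simp: CC_iff)
    have "g \<otimes>\<^bsub>product_group T (\<lambda>_. G)\<^esub> h = (\<lambda>t\<in>T. pi_hom G (v t \<otimes>\<^bsub>FR G\<^esub> w t))"
      using v(2) w(2) direction_FZ[OF v(1)] direction_FZ[OF w(1)] pi_hom_mult by (auto intro!: restrict_ext)
    then show "g \<otimes>\<^bsub>product_group T (\<lambda>_. G)\<^esub> h \<in> carrier (CC G N T)"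
      using CC_memI[OF direction_mult[OF v(1) w(1)]] by simp
  qed
qed

lemma group_CC: "group (CC G N T)"
proof -
  have eq: "CC G N T = (product_group T (\<lambda>_. G))\<lparr>carrier := carrier (CC G N T)\<rparr>" by (simp add: CC_def)
  have "group ((product_group T (\<lambda>_. G))\<lparr>carrier := carrier (CC G N T)\<rparr>)"
    by (rule group.subgroup_imp_group[OF _ CC_subgroup]) (simp add: is_group)
  then show ?thesis unfolding eq[symmetric] .
qed

lemma eval_hom_CC: "t \<in> T \<Longrightarrow> (\<lambda>g. g t) \<in> hom (CC G N T) G"
  by (rule homI) (auto intro: CC_closed)

lemma CC_inv_mult:
  assumes "g \<in> carrier (CC G N T)" "h \<in> carrier (CC G N T)" "t \<in> T"
  shows "(inv\<^bsub>CC G N T\<^esub> g \<otimes>\<^bsub>CC G N T\<^esub> h) t = inv g t \<otimes> h t"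
proof -
  have "group_hom (CC G N T) G (\<lambda>g. g t)"
    using eval_hom_CC[OF assms(3)] by (simp add: group_hom_def group_hom_axioms_def group_CC is_group)
  from group_hom.hom_inv[OF this assms(1)] show ?thesis using assms(3) by simp
qed

lemma CC_norm_le_DD_norm:
  assumes T: "scaling_set T" and w: "direction T w" and g: "g = (\<lambda>t\<in>T. pi_hom G (w t))"
  shows "CC_norm G N T g \<le> DD_norm G N T w"
proof -
  let ?w = "restrict w T"
  have dw: "direction T ?w" using w direction_cong[of T ?w w] by simp
  have nn: "0 \<le> DD_norm G N T v" if "direction T v" for v
  proof (rule tendsto_lowerbound[OF DD_norm_tendsto[OF T that] _ within_at_top_neq_bot[OF T]])
    show "eventually (\<lambda>t. 0 \<le> FR_norm G N (rescale v t)) (within_at_top T)"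
      using F.nonneg[OF direction_FR[OF that]] eventually_in_scaling_set by (rule eventually_mono[rotated])
  qed
  have "DD_norm G N T ?w = DD_norm G N T w"
  proof (rule tendsto_unique[OF within_at_top_neq_bot[OF T] DD_norm_tendsto[OF T dw]])
    show "((\<lambda>t. FR_norm G N (rescale ?w t)) \<longlongrightarrow> DD_norm G N T w) (within_at_top T)"
      using DD_norm_tendsto[OF T w]
      by (rule Lim_transform_eventually) (rule eventually_mono[OF eventually_in_scaling_set], simp)
  qed
  moreover have "CC_norm G N T g \<le> DD_norm G N T ?w"
    unfolding CC_norm_def
  proof (rule cInf_lower)
    show "DD_norm G N T ?w \<in> {DD_norm G N T w |w. w \<in> carrier (DD G N T) \<and> pi_comp G T w = g}"
      using dw g by (intro CollectI exI[of _ ?w]) (auto simp: DD_iff pi_comp_def)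
    show "bdd_below {DD_norm G N T w |w. w \<in> carrier (DD G N T) \<and> pi_comp G T w = g}"
      using nn by (auto simp: DD_iff intro!: bdd_belowI[of _ 0])
  qed
  ultimately show ?thesis by simp
qed

lemma CC_norm_approx:
  assumes g: "g \<in> carrier (CC G N T)" and c: "CC_norm G N T g < c"
  obtains w where "direction T w" "g = (\<lambda>t\<in>T. pi_hom G (w t))" "DD_norm G N T w < c"
proof -
  obtain w0 where w0: "w0 \<in> carrier (DD G N T)" "g = pi_comp G T w0" using g by (auto simp: CC_def)
  then have ne: "{DD_norm G N T w |w. w \<in> carrier (DD G N T) \<and> pi_comp G T w = g} \<noteq> {}" by blast
  have "\<exists>x\<in>{DD_norm G N T w |w. w \<in> carrier (DD G N T) \<and> pi_comp G T w = g}. x < c"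
  proof (rule ccontr)
    assume "\<not> (\<exists>x\<in>{DD_norm G N T w |w. w \<in> carrier (DD G N T) \<and> pi_comp G T w = g}. x < c)"
    then have "c \<le> CC_norm G N T g" unfolding CC_norm_def by (intro cInf_greatest[OF ne]) force
    then show False using c by simp
  qed
  then obtain w where "w \<in> carrier (DD G N T)" "pi_comp G T w = g" "DD_norm G N T w < c" by blast
  then show ?thesis using that[of w] by (simp add: DD_iff pi_comp_def)
qed

end

context nilpotent_normed_group
begin

text \<open>
  The limit superior is bounded by \<open>pi_hom_dst_le\<close>, applied to representatives of almost minimal
  norm.  For the limit inferior, any single late time \<open>s\<close> provides a representative of norm at most
  \<open>N (g s) / s + e\<close>.
\<close>

theorem CC_norm_tendsto:
  assumes T: "scaling_set T" and g: "g \<in> carrier (CC G N T)"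
  shows "((\<lambda>t. N (g t) / t) \<longlongrightarrow> CC_norm G N T g) (within_at_top T)"
proof (rule order_tendstoI)
  fix c assume c: "CC_norm G N T g < c"
  obtain w where w: "direction T w" "g = (\<lambda>t\<in>T. pi_hom G (w t))" "DD_norm G N T w < c"
    using CC_norm_approx[OF g c] .
  have "eventually (\<lambda>t. FR_norm G N (rescale w t) < c) (within_at_top T)"
    by (rule order_tendstoD(2)[OF DD_norm_tendsto[OF T w(1)] w(3)])
  moreover note eventually_in_scaling_set
  ultimately show "eventually (\<lambda>t. N (g t) / t < c) (within_at_top T)"
  proof eventually_elim
    case (elim t)
    have wt: "w t \<in> carrier (FZ G)" "0 < t" using direction_FZ[OF w(1)] scaling_set_pos[OF T] elim by auto
    have "N.dst (pi_hom G \<one>\<^bsub>FR G\<^esub>) (pi_hom G (w t)) \<le> t * F.dst (psi G (1 / t) \<one>\<^bsub>FR G\<^esub>) (rescale w t)"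
      using pi_hom_dst_le[OF _ wt] Z.one_closed by simp
    then have "N (g t) \<le> t * FR_norm G N (rescale w t)"
      using w(2) elim pi_hom_closed[OF wt(1)] FZ_subset[OF wt(1)]
      by (simp add: pi_hom_one psi_one N.dst_one F.dst_one)
    then have "N (g t) / t \<le> FR_norm G N (rescale w t)" using wt(2) by (simp add: field_simps)
    then show ?case using elim by simp
  qed
next
  fix c assume c: "c < CC_norm G N T g"
  obtain w where w: "direction T w" "g = (\<lambda>t\<in>T. pi_hom G (w t))" using g by (auto simp: CC_iff)
  define e where "e = (CC_norm G N T g - c) / 2"
  have e: "0 < e" "c + e < CC_norm G N T g" using c by (auto simp: e_def field_simps)
  obtain t0 where t0: "\<And>s. s \<in> T \<Longrightarrow> t0 \<le> s \<Longrightarrow>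
    \<exists>w'. direction T w' \<and> (\<forall>t\<in>T. pi_hom G (w' t) = pi_hom G (w t)) \<and> DD_norm G N T w' \<le> N (pi_hom G (w s)) / s + e"
    using direction_improve[OF T w(1) e(1)] by blast
  show "eventually (\<lambda>t. c < N (g t) / t) (within_at_top T)"
    unfolding eventually_within_at_top
  proof (intro exI[of _ t0] ballI impI)
    fix s assume s: "s \<in> T" "t0 \<le> s"
    obtain w' where w': "direction T w'" "\<And>t. t \<in> T \<Longrightarrow> pi_hom G (w' t) = pi_hom G (w t)"
      "DD_norm G N T w' \<le> N (pi_hom G (w s)) / s + e" using t0[OF s] by blast
    have "g = (\<lambda>t\<in>T. pi_hom G (w' t))" using w(2) w'(2) by (auto intro!: restrict_ext)
    from CC_norm_le_DD_norm[OF T w'(1) this] have "CC_norm G N T g \<le> N (g s) / s + e"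
      using w'(3) w(2) s by simp
    then show "c < N (g s) / s" using e by simp
  qed
qed

lemma pseudonormed_CC:
  assumes T: "scaling_set T" shows "pseudonormed_group (CC G N T) (CC_norm G N T)"
  by (rule pseudonormed_group_limit[where F = "within_at_top T" and I = T and d = "\<lambda>t. t"])
    (use within_at_top_neq_bot[OF T] eventually_in_scaling_set eval_hom_CC scaling_set_pos[OF T]
      CC_norm_tendsto[OF T] in \<open>auto intro: group_CC N.pseudonormed_group_axioms\<close>)

lemma CC_dst_tendsto:
  assumes T: "scaling_set T" and g: "g \<in> carrier (CC G N T)" and h: "h \<in> carrier (CC G N T)"
  shows "((\<lambda>t. N.dst (g t) (h t) / t) \<longlongrightarrow> norm_dist (CC G N T) (CC_norm G N T) g h) (within_at_top T)"
proof -
  interpret C: pseudonormed_group "CC G N T" "CC_norm G N T" by (rule pseudonormed_CC[OF T])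
  let ?x = "inv\<^bsub>CC G N T\<^esub> g \<otimes>\<^bsub>CC G N T\<^esub> h"
  have "((\<lambda>t. N (?x t) / t) \<longlongrightarrow> norm_dist (CC G N T) (CC_norm G N T) g h) (within_at_top T)"
    unfolding norm_dist_def by (rule CC_norm_tendsto[OF T C.m_closed[OF C.inv_closed[OF g] h]])
  then show ?thesis
  proof (rule Lim_transform_eventually)
    show "eventually (\<lambda>t. N (?x t) / t = N.dst (g t) (h t) / t) (within_at_top T)"
      using eventually_in_scaling_set
      by (rule eventually_mono) (simp only: CC_inv_mult[OF g h] norm_dist_def)
  qed
qed

lemma CC_dst_eq_0I:
  assumes T: "scaling_set T" and g: "g \<in> carrier (CC G N T)" and h: "h \<in> carrier (CC G N T)"
    and le: "\<And>e. 0 < e \<Longrightarrow> \<exists>K. eventually (\<lambda>t. N.dst (g t) (h t) \<le> e * t + K) (within_at_top T)"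
  shows "norm_dist (CC G N T) (CC_norm G N T) g h = 0"
proof (rule antisym)
  interpret C: pseudonormed_group "CC G N T" "CC_norm G N T" by (rule pseudonormed_CC[OF T])
  show "0 \<le> norm_dist (CC G N T) (CC_norm G N T) g h" by (rule C.dst_nonneg[OF g h])
  show "norm_dist (CC G N T) (CC_norm G N T) g h \<le> 0"
  proof (rule field_le_epsilon)
    fix e :: real assume "0 < e"
    then obtain K where K: "eventually (\<lambda>t. N.dst (g t) (h t) \<le> e * t + K) (within_at_top T)" using le by blast
    have "norm_dist (CC G N T) (CC_norm G N T) g h \<le> e"
    proof (rule tendsto_le[OF within_at_top_neq_bot[OF T] _ CC_dst_tendsto[OF T g h]])
      show "((\<lambda>t. e + K / t) \<longlongrightarrow> e) (within_at_top T)"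
        using tendsto_add[OF tendsto_const tendsto_const_over_within_at_top[of K T], of e] by simp
      show "eventually (\<lambda>t. N.dst (g t) (h t) / t \<le> e + K / t) (within_at_top T)"
        using K eventually_in_scaling_set
      proof eventually_elim
        case (elim t)
        then show ?case using scaling_set_pos[OF T, of t] by (simp add: field_simps)
      qed
    qed
    then show "norm_dist (CC G N T) (CC_norm G N T) g h \<le> 0 + e" by simp
  qed
qed

text \<open>
  At a fixed late time \<open>s\<close>, put \<open>a = g s\<close> and \<open>b = h s\<close>.  Then \<open>g t\<close> and \<open>h t\<close> are close to powers of
  \<open>a\<close> and \<open>b\<close> with one and the same exponent, and these powers almost commute.
\<close>

lemma CC_commute:
  assumes T: "scaling_set T" and g: "g \<in> carrier (CC G N T)" and h: "h \<in> carrier (CC G N T)"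
  shows "norm_dist (CC G N T) (CC_norm G N T) (g \<otimes>\<^bsub>CC G N T\<^esub> h) (h \<otimes>\<^bsub>CC G N T\<^esub> g) = 0"
proof (rule CC_dst_eq_0I[OF T])
  interpret C: group "CC G N T" by (rule group_CC)
  show "g \<otimes>\<^bsub>CC G N T\<^esub> h \<in> carrier (CC G N T)" "h \<otimes>\<^bsub>CC G N T\<^esub> g \<in> carrier (CC G N T)"
    by (rule C.m_closed[OF g h], rule C.m_closed[OF h g])
  obtain v where v: "direction T v" "g = (\<lambda>t\<in>T. pi_hom G (v t))" using g by (auto simp: CC_iff)
  obtain w where w: "direction T w" "h = (\<lambda>t\<in>T. pi_hom G (w t))" using h by (auto simp: CC_iff)
  fix e :: real assume e: "0 < e"
  obtain t1 where t1: "\<And>s. s \<in> T \<Longrightarrow> t1 \<le> s \<Longrightarrow>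
    \<exists>K. \<forall>t\<in>T. t1 \<le> t \<longrightarrow> N.dst (pi_hom G (v t)) (pi_hom G (v s) [^] nat \<lfloor>t / s\<rfloor>) \<le> e / 4 * t + K"
    using direction_almost_power[OF T v(1), of "e / 4"] e by auto
  obtain t2 where t2: "\<And>s. s \<in> T \<Longrightarrow> t2 \<le> s \<Longrightarrow>
    \<exists>K. \<forall>t\<in>T. t2 \<le> t \<longrightarrow> N.dst (pi_hom G (w t)) (pi_hom G (w s) [^] nat \<lfloor>t / s\<rfloor>) \<le> e / 4 * t + K"
    using direction_almost_power[OF T w(1), of "e / 4"] e by auto
  obtain s where s: "s \<in> T" "max t1 t2 \<le> s" using scaling_set_unbounded[OF T] by blast
  let ?a = "pi_hom G (v s)" and ?b = "pi_hom G (w s)" and ?n = "\<lambda>t. nat \<lfloor>t / s\<rfloor>"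
  obtain K1 where K1: "\<And>t. t \<in> T \<Longrightarrow> t1 \<le> t \<Longrightarrow> N.dst (pi_hom G (v t)) (?a [^] ?n t) \<le> e / 4 * t + K1"
    using t1[OF s(1)] s(2) by auto
  obtain K2 where K2: "\<And>t. t \<in> T \<Longrightarrow> t2 \<le> t \<Longrightarrow> N.dst (pi_hom G (w t)) (?b [^] ?n t) \<le> e / 4 * t + K2"
    using t2[OF s(1)] s(2) by auto
  have ab: "?a \<in> carrier G" "?b \<in> carrier G"
    using pi_hom_closed direction_FZ[OF v(1) s(1)] direction_FZ[OF w(1) s(1)] by auto
  obtain K3 where K3: "\<And>m::nat. N.dst (?a [^] m \<otimes> ?b [^] m) (?b [^] m \<otimes> ?a [^] m) \<le> K3"
    using power_mult_commute_almost[OF ab] by blast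
  show "\<exists>K. eventually (\<lambda>t. N.dst ((g \<otimes>\<^bsub>CC G N T\<^esub> h) t) ((h \<otimes>\<^bsub>CC G N T\<^esub> g) t) \<le> e * t + K) (within_at_top T)"
    unfolding eventually_within_at_top
  proof (rule exI[of _ "2 * K1 + 2 * K2 + K3"], rule exI[of _ "max t1 t2"], intro ballI impI)
    fix t assume t: "t \<in> T" "max t1 t2 \<le> t"
    let ?x = "?a [^] ?n t" and ?y = "?b [^] ?n t"
    have c: "?x \<in> carrier G" "?y \<in> carrier G" "g t \<in> carrier G" "h t \<in> carrier G"
      using ab CC_closed[OF g t(1)] CC_closed[OF h t(1)] by auto
    have d: "N.dst (g t) ?x \<le> e / 4 * t + K1" "N.dst (h t) ?y \<le> e / 4 * t + K2"
      using K1[OF t(1)] K2[OF t(1)] t v(2) w(2) by auto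
    have "N.dst (g t \<otimes> h t) (h t \<otimes> g t) \<le> N.dst (g t \<otimes> h t) (?x \<otimes> ?y) + (N.dst (?x \<otimes> ?y) (?y \<otimes> ?x) + N.dst (?y \<otimes> ?x) (h t \<otimes> g t))"
      using N.dst_triangle[of "g t \<otimes> h t" "?x \<otimes> ?y" "h t \<otimes> g t"] N.dst_triangle[of "?x \<otimes> ?y" "?y \<otimes> ?x" "h t \<otimes> g t"] c
      by simp
    also have "N.dst (g t \<otimes> h t) (?x \<otimes> ?y) \<le> N.dst (g t) ?x + N.dst (h t) ?y"
      using c by (intro N.dst_mult)
    also have "N.dst (?y \<otimes> ?x) (h t \<otimes> g t) \<le> N.dst (h t) ?y + N.dst (g t) ?x"
      using N.dst_mult[of ?y "h t" ?x "g t"] N.dst_sym[of ?y "h t"] N.dst_sym[of ?x "g t"] c by simp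
    finally show "N.dst ((g \<otimes>\<^bsub>CC G N T\<^esub> h) t) ((h \<otimes>\<^bsub>CC G N T\<^esub> g) t) \<le> e * t + (2 * K1 + 2 * K2 + K3)"
      using d K3[of "?n t"] t(1) by simp
  qed
qed

lemma CC_null_eq:
  assumes "scaling_set T" shows "CC_null G N T = pseudonormed_group.null (CC G N T) (CC_norm G N T)"
  using pseudonormed_group.null_def[OF pseudonormed_CC[OF assms]] by (simp add: CC_null_def)

lemma comm_group_dir_cone:
  assumes T: "scaling_set T" shows "comm_group (dir_cone G N T)"
proof -
  interpret C: pseudonormed_group "CC G N T" "CC_norm G N T" by (rule pseudonormed_CC[OF T])
  interpret n: normal C.null "CC G N T" by (rule C.null_normal)
  have eq: "dir_cone G N T = CC G N T Mod C.null" by (simp only: dir_cone_def CC_null_eq[OF T])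
  show ?thesis
    unfolding eq
  proof (rule group.group_comm_groupI[OF n.factorgroup_is_group])
    fix X Y assume X: "X \<in> carrier (CC G N T Mod C.null)" and Y: "Y \<in> carrier (CC G N T Mod C.null)"
    obtain x where x: "x \<in> carrier (CC G N T)" "X = C.null #>\<^bsub>CC G N T\<^esub> x"
      using X unfolding carrier_FactGroup by (elim imageE)
    obtain y where y: "y \<in> carrier (CC G N T)" "Y = C.null #>\<^bsub>CC G N T\<^esub> y"
      using Y unfolding carrier_FactGroup by (elim imageE)
    have "C.null #>\<^bsub>CC G N T\<^esub> (x \<otimes>\<^bsub>CC G N T\<^esub> y) = C.null #>\<^bsub>CC G N T\<^esub> (y \<otimes>\<^bsub>CC G N T\<^esub> x)"
      by (rule C.coset_eqI[OF C.m_closed[OF x(1) y(1)] C.m_closed[OF y(1) x(1)] CC_commute[OF T x(1) y(1)]])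
    then show "X \<otimes>\<^bsub>CC G N T Mod C.null\<^esub> Y = Y \<otimes>\<^bsub>CC G N T Mod C.null\<^esub> X"
      unfolding x(2) y(2) mult_FactGroup n.rcos_sum[OF x(1) y(1)] n.rcos_sum[OF y(1) x(1)] .
  qed
qed

end

section \<open>Independence of scaling\<close>

text \<open>
  A diagonal argument: \<open>f t\<close> realises the largest index \<open>k \<le> t\<close> that is possible at time \<open>t\<close>, and these
  indices tend to infinity.
\<close>

lemma eventual_selection:
  fixes P :: "nat \<Rightarrow> real \<Rightarrow> 'v \<Rightarrow> bool"
  assumes mono: "\<And>j k t v. j \<le> k \<Longrightarrow> P k t v \<Longrightarrow> P j t v"
    and ev: "\<And>k. \<exists>t0. \<forall>t\<ge>t0. \<exists>v. P k t v"
  obtains f where "\<And>k. \<exists>t0. \<forall>t\<ge>t0. P k t (f t)"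
proof -
  let ?A = "\<lambda>t. {k. real k \<le> t \<and> (\<exists>v. P k t v)}"
  define f where "f t = (SOME v. P (Max (?A t)) t v)" for t
  have "\<exists>t0. \<forall>t\<ge>t0. P k t (f t)" for k
  proof -
    obtain t0 where t0: "\<And>t. t0 \<le> t \<Longrightarrow> \<exists>v. P k t v" using ev by blast
    have "P k t (f t)" if t: "max t0 (real k) \<le> t" for t
    proof -
      have "?A t \<subseteq> {..nat \<lfloor>t\<rfloor>}" by (auto simp: le_nat_floor)
      then have fin: "finite (?A t)" by (rule finite_subset) simp
      have k: "k \<in> ?A t" using t t0[of t] by simp
      have "Max (?A t) \<in> ?A t" using Max_in[OF fin] k by blast
      then have "P (Max (?A t)) t (f t)" unfolding f_def by (auto intro: someI_ex)
      then show ?thesis by (rule mono[OF Max_ge[OF fin k]])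
    qed
    then show ?thesis by blast
  qed
  then show ?thesis using that by blast
qed

lemma scaling_set_positive_reals: "scaling_set {0<..}"
proof -
  have "\<exists>t\<in>{0<..}. M < t" for M :: real by (rule bexI[of _ "max M 0 + 1"]) auto
  then show ?thesis unfolding scaling_set_def bdd_above_def by (auto simp: not_le)
qed

lemma within_at_top_mono: "T \<subseteq> T' \<Longrightarrow> within_at_top T \<le> within_at_top T'"
  by (intro inf_mono order_refl) simp

context conj_normed_group
begin

lemma direction_subset: "T \<subseteq> T' \<Longrightarrow> direction T' w \<Longrightarrow> direction T w"
  unfolding direction_def cauchy_along_def by (meson subsetD)

lemma restrict_CC:
  assumes "T \<subseteq> T'" "g \<in> carrier (CC G N T')" shows "restrict g T \<in> carrier (CC G N T)"
proof -
  obtain w where w: "direction T' w" "g = (\<lambda>t\<in>T'. pi_hom G (w t))" using assms(2) by (auto simp: CC_iff)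
  have "restrict g T = (\<lambda>t\<in>T. pi_hom G (w t))" using w(2) assms(1) by (auto simp: fun_eq_iff)
  then show ?thesis using CC_memI[OF direction_subset[OF assms(1) w(1)]] by simp
qed

lemma restrict_hom:
  assumes "T \<subseteq> T'" shows "(\<lambda>g. restrict g T) \<in> hom (CC G N T') (CC G N T)"
  by (rule homI) (use assms restrict_CC[OF assms] in \<open>auto simp: fun_eq_iff\<close>)

text \<open>
  Rounding the value of \<open>w\<close> at a fixed time \<open>s\<close> of \<open>T\<close> gives words for all times, whose directions are
  eventually close to that of \<open>w s\<close>.  Letting \<open>s\<close> grow slowly with \<open>t\<close> makes them converge.
\<close>

lemma direction_extend:
  assumes T: "scaling_set T" and w: "direction T w"
  obtains w' where "\<And>T'. direction T' w'"
    "\<And>e. 0 < e \<Longrightarrow> eventually (\<lambda>t. F.dst (rescale w' t) (rescale w t) \<le> e) (within_at_top T)"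
proof -
  (* The word v approximates at scale t, up to e, the limiting direction of w in the completion. *)
  define near where "near e t v \<longleftrightarrow> v \<in> carrier (FZ G) \<and>
      (\<exists>s0. \<forall>s\<in>T. s0 \<le> s \<longrightarrow> F.dst (psi G (1 / t) v) (rescale w s) < e)" for e t v
  have near_ex: "\<exists>t0. \<forall>t\<ge>t0. \<exists>v. near e t v" if e: "0 < e" for e
  proof -
    obtain s0 where s0: "\<And>t t'. t \<in> T \<Longrightarrow> t' \<in> T \<Longrightarrow> s0 \<le> t \<Longrightarrow> s0 \<le> t' \<Longrightarrow> F.dst (rescale w t) (rescale w t') < e / 2"
      using direction_cauchy[OF w, of "e / 2"] e by auto
    obtain s where s: "s \<in> T" "s0 \<le> s" using scaling_set_unbounded[OF T] by blast
    have x: "w s \<in> carrier (FZ G)" by (rule direction_FZ[OF w s(1)])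
    let ?v = "\<lambda>t. psi G (of_nat (nat \<lfloor>t / s\<rfloor>)) (w s)"
    obtain C where C: "0 \<le> C" "\<And>t. 0 < t \<Longrightarrow> F.dst (rescale ?v t) (rescale w s) \<le> C / t"
      using rounding_dst[OF FZ_subset[OF x] scaling_set_pos[OF T s(1)]] by blast
    have v: "?v t \<in> carrier (FZ G)" for t by (rule psi_in_FZ[OF x])
    (* From time 2 * C / e on, the rounding error C / t is at most e / 2. *)
    have "near e t (?v t)" if t: "max 1 (2 * C / e) \<le> t" for t
      unfolding near_def
    proof (intro conjI v exI[of _ s0] ballI impI)
      fix s' assume s': "s' \<in> T" "s0 \<le> s'"
      have tp: "0 < t" using t by simp
      have "2 * C / e \<le> t" using t by simp
      then have "C / t \<le> e / 2" using e tp by (simp add: field_simps)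
      then have "F.dst (rescale ?v t) (rescale w s) \<le> e / 2" by (rule order_trans[OF C(2)[OF tp]])
      moreover have "F.dst (rescale ?v t) (rescale w s') \<le> F.dst (rescale ?v t) (rescale w s) + F.dst (rescale w s) (rescale w s')"
        by (rule F.dst_triangle[OF psi_closed[OF FZ_subset[OF v]] direction_FR[OF w s(1)] direction_FR[OF w s'(1)]])
      ultimately show "F.dst (rescale ?v t) (rescale w s') < e" using s0[OF s(1) s'(1) s(2) s'(2)] by simp
    qed
    then show ?thesis by blast
  qed
  have near_mono: "near e' t v" if "near e t v" "e \<le> e'" for e e' t v
    using that unfolding near_def by (meson less_le_trans)
  have "\<exists>f. \<forall>k. \<exists>t0. \<forall>t\<ge>t0. near (1 / real (Suc k)) t (f t)"
  proof (rule eventual_selection[of "\<lambda>k. near (1 / real (Suc k))"])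
    fix j k :: nat and t v assume "j \<le> k" and near: "near (1 / real (Suc k)) t v"
    then have "1 / real (Suc k) \<le> 1 / real (Suc j)" by (intro divide_left_mono) auto
    then show "near (1 / real (Suc j)) t v" using near near_mono by blast
  next
    fix k show "\<exists>t0. \<forall>t\<ge>t0. \<exists>v. near (1 / real (Suc k)) t v" by (rule near_ex) simp
  qed blast
  then obtain f where f: "\<And>k. \<exists>t0. \<forall>t\<ge>t0. near (1 / real (Suc k)) t (f t)" by blast
  define w' where "w' t = (if f t \<in> carrier (FZ G) then f t else \<one>\<^bsub>FR G\<^esub>)" for t
  have w'Z: "w' t \<in> carrier (FZ G)" for t using Z.one_closed by (simp add: w'_def)
  have w'R: "rescale w' t \<in> carrier (FR G)" for t using FZ_subset[OF w'Z] by simp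
  have w': "\<exists>t0. \<forall>t\<ge>t0. near e t (w' t)" if e: "0 < e" for e
  proof -
    obtain k where k: "1 / real (Suc k) < e" using e nat_approx_posE by blast
    obtain t0 where t0: "\<And>t. t0 \<le> t \<Longrightarrow> near (1 / real (Suc k)) t (f t)" using f by blast
    have "near e t (w' t)" if "t0 \<le> t" for t
    proof -
      have "near e t (f t)" using near_mono[OF t0[OF that]] k by simp
      moreover from this have "w' t = f t" unfolding near_def w'_def by simp
      ultimately show ?thesis by simp
    qed
    then show ?thesis by blast
  qed
  have "direction T' w'" for T'
    unfolding direction_def cauchy_along_def
  proof (intro conjI ballI w'Z allI impI)
    fix e :: real assume e: "0 < e"
    obtain t0 where t0: "\<And>t. t0 \<le> t \<Longrightarrow> near (e / 2) t (w' t)" using w'[of "e / 2"] e by auto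
    show "\<exists>t0. \<forall>t\<in>T'. \<forall>t'\<in>T'. t0 \<le> t \<longrightarrow> t0 \<le> t' \<longrightarrow> F.dst (rescale w' t) (rescale w' t') < e"
    proof (intro exI[of _ t0] ballI impI)
      fix t t' assume t: "t0 \<le> t" "t0 \<le> t'"
      obtain s1 where s1: "\<And>s. s \<in> T \<Longrightarrow> s1 \<le> s \<Longrightarrow> F.dst (rescale w' t) (rescale w s) < e / 2"
        using t0[OF t(1)] unfolding near_def by blast
      obtain s2 where s2: "\<And>s. s \<in> T \<Longrightarrow> s2 \<le> s \<Longrightarrow> F.dst (rescale w' t') (rescale w s) < e / 2"
        using t0[OF t(2)] unfolding near_def by blast
      obtain s where s: "s \<in> T" "max s1 s2 \<le> s" using scaling_set_unbounded[OF T] by blast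
      have ws: "rescale w s \<in> carrier (FR G)" by (rule direction_FR[OF w s(1)])
      have "F.dst (rescale w' t) (rescale w' t') \<le> F.dst (rescale w' t) (rescale w s) + F.dst (rescale w' t') (rescale w s)"
        using F.dst_triangle[OF w'R[of t] ws w'R[of t']] F.dst_sym[OF ws w'R[of t']] by simp
      also have "\<dots> < e" using s1[OF s(1)] s2[OF s(1)] s(2) by simp
      finally show "F.dst (rescale w' t) (rescale w' t') < e" .
    qed
  qed
  moreover have "eventually (\<lambda>t. F.dst (rescale w' t) (rescale w t) \<le> e) (within_at_top T)" if e: "0 < e" for e
  proof -
    obtain t0 where t0: "\<And>t. t0 \<le> t \<Longrightarrow> near (e / 2) t (w' t)" using w'[of "e / 2"] e by auto
    obtain t1 where t1: "\<And>t t'. t \<in> T \<Longrightarrow> t' \<in> T \<Longrightarrow> t1 \<le> t \<Longrightarrow> t1 \<le> t' \<Longrightarrow> F.dst (rescale w t) (rescale w t') < e / 2"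
      using direction_cauchy[OF w, of "e / 2"] e by auto
    show ?thesis
      unfolding eventually_within_at_top
    proof (intro exI[of _ "max t0 t1"] ballI impI)
      fix t assume t: "t \<in> T" "max t0 t1 \<le> t"
      obtain s1 where s1: "\<And>s. s \<in> T \<Longrightarrow> s1 \<le> s \<Longrightarrow> F.dst (rescale w' t) (rescale w s) < e / 2"
        using t0[of t] t(2) unfolding near_def by auto
      obtain s where s: "s \<in> T" "max s1 t1 \<le> s" using scaling_set_unbounded[OF T] by blast
      have "F.dst (rescale w' t) (rescale w t) \<le> F.dst (rescale w' t) (rescale w s) + F.dst (rescale w s) (rescale w t)"
        by (rule F.dst_triangle[OF w'R direction_FR[OF w s(1)] direction_FR[OF w t(1)]])
      also have "\<dots> \<le> e" using s1[OF s(1)] t1[OF s(1) t(1)] s(2) t(2) by simp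
      finally show "F.dst (rescale w' t) (rescale w t) \<le> e" .
    qed
  qed
  ultimately show ?thesis using that by blast
qed

end

lemma dir_cone_norm_eq: "dir_cone_norm G N T = (\<lambda>A. the_elem (CC_norm G N T ` A))"
  by (rule ext) (simp add: dir_cone_norm_def)

context nilpotent_normed_group
begin

text \<open>
  Both sides are the limit of \<open>N (g t) / t\<close> along \<open>T\<close>.
\<close>

lemma CC_norm_restrict:
  assumes T: "scaling_set T" and T': "scaling_set T'" and sub: "T \<subseteq> T'" and g: "g \<in> carrier (CC G N T')"
  shows "CC_norm G N T (restrict g T) = CC_norm G N T' g"
proof (rule tendsto_unique[OF within_at_top_neq_bot[OF T] CC_norm_tendsto[OF T restrict_CC[OF sub g]]])
  have "((\<lambda>t. N (g t) / t) \<longlongrightarrow> CC_norm G N T' g) (within_at_top T)"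
    by (rule tendsto_mono[OF within_at_top_mono[OF sub] CC_norm_tendsto[OF T' g]])
  then show "((\<lambda>t. N (restrict g T t) / t) \<longlongrightarrow> CC_norm G N T' g) (within_at_top T)"
    by (rule Lim_transform_eventually) (rule eventually_mono[OF eventually_in_scaling_set], simp)
qed

lemma restrict_almost_onto:
  assumes T: "scaling_set T" and sub: "T \<subseteq> T'" and g: "g \<in> carrier (CC G N T)"
  shows "\<exists>g'\<in>carrier (CC G N T'). norm_dist (CC G N T) (CC_norm G N T) (restrict g' T) g = 0"
proof -
  obtain w where w: "direction T w" "g = (\<lambda>t\<in>T. pi_hom G (w t))" using g by (auto simp: CC_iff)
  obtain w' where w': "\<And>T'. direction T' w'"
    and near: "\<And>e. 0 < e \<Longrightarrow> eventually (\<lambda>t. F.dst (rescale w' t) (rescale w t) \<le> e) (within_at_top T)"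
    using direction_extend[OF T w(1)] by blast
  let ?g' = "\<lambda>t\<in>T'. pi_hom G (w' t)"
  have g': "?g' \<in> carrier (CC G N T')" by (rule CC_memI[OF w'])
  have "norm_dist (CC G N T) (CC_norm G N T) (restrict ?g' T) g = 0"
  proof (rule CC_dst_eq_0I[OF T restrict_CC[OF sub g'] g])
    fix e :: real assume e: "0 < e"
    show "\<exists>K. eventually (\<lambda>t. N.dst (restrict ?g' T t) (g t) \<le> e * t + K) (within_at_top T)"
    proof (rule exI[of _ 0])
      show "eventually (\<lambda>t. N.dst (restrict ?g' T t) (g t) \<le> e * t + 0) (within_at_top T)"
        using near[OF e] eventually_in_scaling_set
      proof eventually_elim
        case (elim t)
        have tp: "0 < t" using scaling_set_pos[OF T elim(2)] .
        have "N.dst (pi_hom G (w' t)) (pi_hom G (w t)) \<le> t * F.dst (rescale w' t) (rescale w t)"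
          by (rule pi_hom_dst_le[OF direction_FZ[OF w' elim(2)] direction_FZ[OF w(1) elim(2)] tp])
        also have "\<dots> \<le> t * e" using elim(1) tp by (intro mult_left_mono) auto
        finally show ?case using elim(2) sub w(2) by (auto simp: mult.commute)
      qed
    qed
  qed
  then show ?thesis using g' by blast
qed

theorem restriction_isometry:
  assumes T: "scaling_set T" and T': "scaling_set T'" and sub: "T \<subseteq> T'"
  shows "g \<in> carrier (CC G N T') \<Longrightarrow>
      restriction_map G N T' T (dir_class G N T' g) = dir_class G N T (restrict g T)"
    and "isometry (dir_cone G N T') (dir_cone_norm G N T') (dir_cone G N T) (dir_cone_norm G N T)
          (restriction_map G N T' T)"
proof -
  interpret A: pseudonormed_group "CC G N T'" "CC_norm G N T'" by (rule pseudonormed_CC[OF T'])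
  interpret B: pseudonormed_group "CC G N T" "CC_norm G N T" by (rule pseudonormed_CC[OF T])
  interpret R: norm_preserving_hom "CC G N T'" "CC_norm G N T'" "CC G N T" "CC_norm G N T" "\<lambda>g. restrict g T"
    by unfold_locales (rule restrict_hom[OF sub], rule CC_norm_restrict[OF T T' sub])
  have map: "restriction_map G N T' T = R.induced"
    by (rule ext) (simp only: restriction_map_def R.induced_def dir_class_def CC_null_eq[OF T])
  show "restriction_map G N T' T (dir_class G N T' g) = dir_class G N T (restrict g T)"
    if "g \<in> carrier (CC G N T')"
    unfolding map dir_class_def CC_null_eq[OF T] CC_null_eq[OF T'] by (rule R.induced_class[OF that])
  show "isometry (dir_cone G N T') (dir_cone_norm G N T') (dir_cone G N T) (dir_cone_norm G N T)
          (restriction_map G N T' T)"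
    unfolding map dir_cone_def dir_cone_norm_eq CC_null_eq[OF T] CC_null_eq[OF T']
    by (rule R.induced_isometry[OF restrict_almost_onto[OF T sub]])
qed

end

section \<open>Ultrafilter cones\<close>

text \<open>
  A nonprincipal ultrafilter contains the complement of each point, hence every cofinite set.
\<close>

lemma nonprincipal_ultrafilter_le_sequentially:
  assumes "nonprincipal_ultrafilter \<omega>" shows "\<omega> \<le> sequentially"
proof (rule filter_leI)
  have bot: "\<omega> \<noteq> bot" and ultra: "\<And>P. eventually P \<omega> \<or> eventually (\<lambda>n. \<not> P n) \<omega>"
    and np: "\<And>n. \<omega> \<noteq> principal {n}"
    using assms by (auto simp: nonprincipal_ultrafilter_def)
  have ne: "eventually (\<lambda>m. m \<noteq> n) \<omega>" for n
  proof (rule ccontr)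
    assume "\<not> eventually (\<lambda>m. m \<noteq> n) \<omega>"
    then have ev: "eventually (\<lambda>m. m = n) \<omega>" using ultra[of "\<lambda>m. m = n"] by simp
    have "\<omega> = principal {n}"
    proof (rule filter_eqI)
      fix P
      show "eventually P \<omega> \<longleftrightarrow> eventually P (principal {n})"
      proof
        assume "eventually P \<omega>"
        with ev have "eventually (\<lambda>m. P n) \<omega>" by eventually_elim simp
        then show "eventually P (principal {n})" using bot by (simp add: eventually_principal)
      next
        assume "eventually P (principal {n})"
        then have "P n" by (simp add: eventually_principal)
        then show "eventually P \<omega>" using ev by (auto elim: eventually_mono)
      qed
    qed
    then show False using np by blast
  qed
  fix P assume "eventually P sequentially"
  then obtain k where k: "\<And>n. k \<le> n \<Longrightarrow> P n" by (auto simp: eventually_sequentially)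
  have "eventually (\<lambda>m. \<forall>n\<in>{..<k}. m \<noteq> n) \<omega>" by (rule eventually_ball_finite) (simp_all add: ne)
  then show "eventually P \<omega>"
  proof eventually_elim
    case (elim m)
    then have "\<not> m < k" by auto
    then have "k \<le> m" by simp
    then show ?case by (rule k)
  qed
qed

lemma ultrafilter_bounded_limit:
  fixes x :: "nat \<Rightarrow> real"
  assumes "nonprincipal_ultrafilter \<omega>" and bounded: "eventually (\<lambda>n. x n \<in> {a..b}) \<omega>"
  obtains L where "(x \<longlongrightarrow> L) \<omega>"
proof -
  have bot: "\<omega> \<noteq> bot" and ultra: "\<And>P. eventually P \<omega> \<or> eventually (\<lambda>n. \<not> P n) \<omega>"
    using assms(1) by (auto simp: nonprincipal_ultrafilter_def)
  have "filtermap x \<omega> \<noteq> bot" using bot by (simp add: filtermap_bot_iff)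
  moreover have "eventually (\<lambda>y. y \<in> {a..b}) (filtermap x \<omega>)" using bounded by (simp add: eventually_filtermap)
  ultimately obtain L where L: "inf (nhds L) (filtermap x \<omega>) \<noteq> bot"
    using compact_Icc[of a b] unfolding compact_filter by blast
  have "(x \<longlongrightarrow> L) \<omega>"
  proof (rule topological_tendstoI, rule ccontr)
    fix S assume S: "open S" "L \<in> S" and "\<not> eventually (\<lambda>n. x n \<in> S) \<omega>"
    then have "eventually (\<lambda>y. y \<notin> S) (filtermap x \<omega>)" using ultra by (auto simp: eventually_filtermap)
    moreover have "eventually (\<lambda>y. y \<in> S) (nhds L)" using S by (rule eventually_nhds_in_open)
    ultimately have "eventually (\<lambda>y. False) (inf (nhds L) (filtermap x \<omega>))"
      unfolding eventually_inf by blast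
    then show False using L by (simp add: trivial_limit_def)
  qed
  then show ?thesis by (rule that)
qed

context conj_normed_group
begin

lemma bounded_seqs_iff:
  "g \<in> carrier (bounded_seqs G N d) \<longleftrightarrow>
    (\<forall>n. g n \<in> carrier G) \<and> (\<exists>B. eventually (\<lambda>n. N (g n) / d n \<le> B) sequentially)"
proof -
  let ?f = "\<lambda>n. ereal (N (g n) / d n)"
  have "limsup ?f < \<infinity> \<longleftrightarrow> (\<exists>B. eventually (\<lambda>n. N (g n) / d n \<le> B) sequentially)"
  proof
    assume "limsup ?f < \<infinity>"
    then obtain k :: nat where "limsup ?f < ereal (real k)" using less_PInf_Ex_of_nat[of "limsup ?f"] by auto
    then have "eventually (\<lambda>n. ?f n < ereal (real k)) sequentially" by (rule Limsup_lessD)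
    then have "eventually (\<lambda>n. N (g n) / d n \<le> real k) sequentially" by (rule eventually_mono) simp
    then show "\<exists>B. eventually (\<lambda>n. N (g n) / d n \<le> B) sequentially" by blast
  next
    assume "\<exists>B. eventually (\<lambda>n. N (g n) / d n \<le> B) sequentially"
    then obtain B where "eventually (\<lambda>n. N (g n) / d n \<le> B) sequentially" by blast
    then have "eventually (\<lambda>n. ?f n \<le> ereal B) sequentially" by (rule eventually_mono) simp
    then have "limsup ?f \<le> ereal B" by (rule Limsup_bounded)
    then show "limsup ?f < \<infinity>" by (rule le_less_trans) simp
  qed
  then show ?thesis by (auto simp: bounded_seqs_def PiE_iff)
qed

lemma bounded_seqs_mult [simp]: "g \<otimes>\<^bsub>bounded_seqs G N d\<^esub> h = (\<lambda>n. g n \<otimes> h n)"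
  by (simp add: bounded_seqs_def restrict_def)

lemma group_bounded_seqs:
  assumes d: "\<And>n. 0 < d n" shows "group (bounded_seqs G N d)"
proof -
  interpret P: group "product_group (UNIV :: nat set) (\<lambda>_. G)" by (simp add: is_group)
  let ?B = "carrier (bounded_seqs G N d)"
  have "subgroup ?B (product_group UNIV (\<lambda>_. G))"
  proof (rule P.subgroupI)
    show "?B \<subseteq> carrier (product_group UNIV (\<lambda>_. G))" by (auto simp: bounded_seqs_def)
    have "eventually (\<lambda>n. N \<one> / d n \<le> 0) sequentially" by (simp add: N.norm_one)
    then have "(\<lambda>n. \<one>) \<in> ?B" unfolding bounded_seqs_iff by blast
    then show "?B \<noteq> {}" by blast
    fix g assume g: "g \<in> ?B"
    then have gc: "g n \<in> carrier G" for n by (simp add: bounded_seqs_iff)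
    have "inv\<^bsub>product_group UNIV (\<lambda>_. G)\<^esub> g = (\<lambda>n. inv g n)"
      using inv_product_group[of g UNIV "\<lambda>_. G"] gc by (simp add: is_group PiE_iff restrict_def)
    moreover have "(\<lambda>n. inv g n) \<in> ?B" using g gc unfolding bounded_seqs_iff by (simp add: N.norm_inv)
    ultimately show "inv\<^bsub>product_group UNIV (\<lambda>_. G)\<^esub> g \<in> ?B" by simp
    fix h assume h: "h \<in> ?B"
    then have hc: "h n \<in> carrier G" for n by (simp add: bounded_seqs_iff)
    obtain a where a: "eventually (\<lambda>n. N (g n) / d n \<le> a) sequentially" using g by (auto simp: bounded_seqs_iff)
    obtain b where b: "eventually (\<lambda>n. N (h n) / d n \<le> b) sequentially" using h by (auto simp: bounded_seqs_iff)
    from a b have "eventually (\<lambda>n. N (g n \<otimes> h n) / d n \<le> a + b) sequentially"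
    proof eventually_elim
      case (elim n)
      have "N (g n \<otimes> h n) / d n \<le> (N (g n) + N (h n)) / d n"
        using N.triangle[OF gc hc] d[of n] by (intro divide_right_mono) auto
      then show ?case using elim by (simp add: add_divide_distrib)
    qed
    then have "(\<lambda>n. g n \<otimes> h n) \<in> ?B" unfolding bounded_seqs_iff using gc hc by auto
    then show "g \<otimes>\<^bsub>product_group UNIV (\<lambda>_. G)\<^esub> h \<in> ?B" by (simp add: restrict_def)
  qed
  then have "group ((product_group UNIV (\<lambda>_. G))\<lparr>carrier := ?B\<rparr>)" by (rule P.subgroup_imp_group)
  then show ?thesis by (simp add: bounded_seqs_def)
qed

definition ultra_norm :: "nat filter \<Rightarrow> (nat \<Rightarrow> real) \<Rightarrow> (nat \<Rightarrow> 'a) \<Rightarrow> real" where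
  "ultra_norm \<omega> d g = Lim \<omega> (\<lambda>n. N (g n) / d n)"

lemma ultra_norm_tendsto:
  assumes \<omega>: "nonprincipal_ultrafilter \<omega>" and d: "\<And>n. 0 < d n" and g: "g \<in> carrier (bounded_seqs G N d)"
  shows "((\<lambda>n. N (g n) / d n) \<longlongrightarrow> ultra_norm \<omega> d g) \<omega>"
proof -
  obtain B where "eventually (\<lambda>n. N (g n) / d n \<le> B) sequentially" using g by (auto simp: bounded_seqs_iff)
  then have "eventually (\<lambda>n. N (g n) / d n \<le> B) \<omega>"
    using nonprincipal_ultrafilter_le_sequentially[OF \<omega>] by (auto simp: le_filter_def)
  then have "eventually (\<lambda>n. N (g n) / d n \<in> {0..B}) \<omega>"
  proof eventually_elim
    case (elim n)
    then show ?case using N.nonneg[of "g n"] d[of n] g by (simp add: bounded_seqs_iff)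
  qed
  then obtain L where L: "((\<lambda>n. N (g n) / d n) \<longlongrightarrow> L) \<omega>" using ultrafilter_bounded_limit[OF \<omega>] by metis
  have "\<omega> \<noteq> bot" using \<omega> by (simp add: nonprincipal_ultrafilter_def)
  then show ?thesis using L by (simp add: ultra_norm_def tendsto_Lim)
qed

lemma pseudonormed_bounded_seqs:
  assumes \<omega>: "nonprincipal_ultrafilter \<omega>" and d: "\<And>n. 0 < d n"
  shows "pseudonormed_group (bounded_seqs G N d) (ultra_norm \<omega> d)"
proof (rule pseudonormed_group_limit[where F = \<omega> and I = UNIV and d = d, OF group_bounded_seqs[OF d]])
  show "pseudonormed_group G N" by (rule N.pseudonormed_group_axioms)
  show "\<omega> \<noteq> bot" using \<omega> by (simp add: nonprincipal_ultrafilter_def)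
  show "(\<lambda>g. g i) \<in> hom (bounded_seqs G N d) G" for i
    by (rule homI) (auto simp: bounded_seqs_iff)
qed (use d ultra_norm_tendsto[OF \<omega> d] in simp_all)

lemma null_seqs_eq:
  assumes \<omega>: "nonprincipal_ultrafilter \<omega>" and d: "\<And>n. 0 < d n"
  shows "null_seqs G N \<omega> d = pseudonormed_group.null (bounded_seqs G N d) (ultra_norm \<omega> d)"
proof -
  have bot: "\<omega> \<noteq> bot" using \<omega> by (simp add: nonprincipal_ultrafilter_def)
  have "((\<lambda>n. N (g n) / d n) \<longlongrightarrow> 0) \<omega> \<longleftrightarrow> ultra_norm \<omega> d g = 0" if "g \<in> carrier (bounded_seqs G N d)" for g
    using ultra_norm_tendsto[OF \<omega> d that] tendsto_unique[OF bot, of _ "ultra_norm \<omega> d g" 0] by auto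
  then show ?thesis
    unfolding null_seqs_def pseudonormed_group.null_def[OF pseudonormed_bounded_seqs[OF \<omega> d]]
    by (intro Collect_cong conj_cong refl)
qed

end

context nilpotent_normed_group
begin

text \<open>
  The limit of \<open>N (g t) / t\<close> is in particular the limit along \<open>t = d n\<close>, and hence the one along every
  nonprincipal ultrafilter.
\<close>

theorem rho_isometric_embedding:
  assumes \<omega>: "nonprincipal_ultrafilter \<omega>" and d: "scaling_sequence d"
  shows "g \<in> carrier (CC G N {0<..}) \<Longrightarrow>
      rho G N \<omega> d (dir_class G N {0<..} g) = ucone_class G N \<omega> d (\<lambda>n. g (d n))"
    and "isometric_embedding (dir_cone G N {0<..}) (dir_cone_norm G N {0<..})
         (ucone G N \<omega> d) (ucone_norm G N \<omega> d) (rho G N \<omega> d)"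
proof -
  let ?T = "{0<..} :: real set"
  have T: "scaling_set ?T" by (rule scaling_set_positive_reals)
  have dp: "0 < d n" for n using d by (simp add: scaling_sequence_def)
  have "filterlim d (within_at_top ?T) sequentially"
    using d by (simp add: scaling_sequence_def filterlim_inf filterlim_principal)
  then have lim: "((\<lambda>n. N (g (d n)) / d n) \<longlongrightarrow> CC_norm G N ?T g) sequentially"
    if "g \<in> carrier (CC G N ?T)" for g
    using filterlim_compose[OF CC_norm_tendsto[OF T that]] by blast
  have mem: "(\<lambda>n. g (d n)) \<in> carrier (bounded_seqs G N d)" if g: "g \<in> carrier (CC G N ?T)" for g
    unfolding bounded_seqs_iff
  proof (intro conjI allI exI[of _ "CC_norm G N ?T g + 1"])
    show "g (d n) \<in> carrier G" for n using CC_closed[OF g] dp by simp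
    have "eventually (\<lambda>n. N (g (d n)) / d n < CC_norm G N ?T g + 1) sequentially"
      by (rule order_tendstoD(2)[OF lim[OF g]]) simp
    then show "eventually (\<lambda>n. N (g (d n)) / d n \<le> CC_norm G N ?T g + 1) sequentially"
      by (rule eventually_mono) simp
  qed
  have bot: "\<omega> \<noteq> bot" using \<omega> by (simp add: nonprincipal_ultrafilter_def)
  have norm: "ultra_norm \<omega> d (\<lambda>n. g (d n)) = CC_norm G N ?T g" if g: "g \<in> carrier (CC G N ?T)" for g
    by (rule tendsto_unique[OF bot ultra_norm_tendsto[OF \<omega> dp mem[OF g]]
          tendsto_mono[OF nonprincipal_ultrafilter_le_sequentially[OF \<omega>] lim[OF g]]])
  interpret A: pseudonormed_group "CC G N ?T" "CC_norm G N ?T" by (rule pseudonormed_CC[OF T])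
  interpret B: pseudonormed_group "bounded_seqs G N d" "ultra_norm \<omega> d"
    by (rule pseudonormed_bounded_seqs[OF \<omega> dp])
  interpret R: norm_preserving_hom "CC G N ?T" "CC_norm G N ?T" "bounded_seqs G N d" "ultra_norm \<omega> d" "\<lambda>g n. g (d n)"
  proof unfold_locales
    show "(\<lambda>g n. g (d n)) \<in> hom (CC G N ?T) (bounded_seqs G N d)"
      by (rule homI) (use mem dp in auto)
  qed (rule norm)
  have map: "rho G N \<omega> d = R.induced"
    by (rule ext) (simp only: rho_def R.induced_def ucone_class_def null_seqs_eq[OF \<omega> dp])
  have un: "ucone_norm G N \<omega> d = (\<lambda>A. the_elem (ultra_norm \<omega> d ` A))"
    unfolding ucone_norm_def ultra_norm_def ..
  show "rho G N \<omega> d (dir_class G N ?T g) = ucone_class G N \<omega> d (\<lambda>n. g (d n))"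
    if "g \<in> carrier (CC G N ?T)"
    unfolding map dir_class_def ucone_class_def CC_null_eq[OF T] null_seqs_eq[OF \<omega> dp]
    by (rule R.induced_class[OF that])
  show "isometric_embedding (dir_cone G N ?T) (dir_cone_norm G N ?T)
         (ucone G N \<omega> d) (ucone_norm G N \<omega> d) (rho G N \<omega> d)"
    unfolding map dir_cone_def ucone_def dir_cone_norm_eq un CC_null_eq[OF T] null_seqs_eq[OF \<omega> dp]
    by (rule R.induced_isometric_embedding)
qed

end

theorem proposition10p3:
  fixes G :: "('a, 'b) monoid_scheme" and N :: "'a \<Rightarrow> real"
  assumes "nilpotent_group G" and "conj_invariant_norm G N"
  shows "independent_of_scaling G N \<and>
    comm_group (dir_cone G N {0<..}) \<and>
    (\<forall>\<omega> d. nonprincipal_ultrafilter \<omega> \<and> scaling_sequence d \<longrightarrow>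
       (\<forall>g\<in>carrier (CC G N {0<..}).
          rho G N \<omega> d (dir_class G N {0<..} g) = ucone_class G N \<omega> d (\<lambda>n. g (d n))) \<and>
       isometric_embedding (dir_cone G N {0<..}) (dir_cone_norm G N {0<..})
         (ucone G N \<omega> d) (ucone_norm G N \<omega> d) (rho G N \<omega> d))"
proof -
  have "group G" using assms(1) by (simp add: nilpotent_group_def)
  then interpret nilpotent_normed_group G N
    using assms by (simp add: nilpotent_normed_group_def nilpotent_normed_group_axioms_def
        conj_normed_group_def conj_normed_group_axioms_def)
  show ?thesis
    unfolding independent_of_scaling_def
  proof (intro conjI allI impI ballI)
    show "comm_group (dir_cone G N {0<..})" by (rule comm_group_dir_cone[OF scaling_set_positive_reals])
  qed (use restriction_isometry rho_isometric_embedding in simp_all)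
qed

end
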